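(* Let $1<p<\infty$, $\frac12<\alpha<\frac14\left(5-\frac3p\right)$ and $\nu>0$. There is a constant $\varepsilon>0$, independent of the Coriolis parameter and of the external force, such that for every external force $F\in\dot{FB}^{4-4\alpha-\frac3p}_{p,p}(\mathbb R^3)$ there exists $\Omega_0>0$ such that, for all $\Omega\in\mathbb R$ with $|\Omega|\ge\Omega_0$, there is a stationary (mild) solution $u\in\dot{FB}^{4-2\alpha-\frac3p}_{p,p}(\mathbb R^3)$ of the stationary fractional Navier-Stokes-Coriolis system with Coriolis parameter $\Omega$ and external force $F$, and $u$ is the unique such solution satisfying $\|u\|_{\dot{FB}^{4-2\alpha-\frac3p}_{p,p}(\mathbb R^3)}\le2\varepsilon$.
   Context: Fourier-Besov spaces on $\mathbb R^3$: fix a radially symmetric $\varphi\in\mathcal S(\mathbb R^3)$ supported in $\{\xi:\frac34\le|\xi|\le\frac83\}$ with $\sum_{j\in\mathbb Z}\varphi(2^{-j}\xi)=1$ for all $\xi\ne0$, and put $\varphi_j(\xi)=\varphi(2^{-j}\xi)$. For $s\in\mathbb R$, $1\le p,q\le\infty$, $\dot{FB}^s_{p,q}$ is the set of $f\in\mathcal S'$ with $\hat f\in L^1_{loc}$ and $\|f\|_{\dot{FB}^s_{p,q}}=\big\|\big(2^{js}\|\varphi_j\hat f\|_{L^p}\big)_{j\in\mathbb Z}\big\|_{\ell^q}<\infty$ (vector-valued versions are understood). The stationary fractional Navier-Stokes-Coriolis system is $\nu(-\Delta)^\alpha u+\Omega e_3\times u+(u\cdot\nabla)u+\nabla p=F$,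 $\mathrm{div}\,u=0$ in $\mathbb R^3$, with $\nu>0$, $\Omega\in\mathbb R$, $e_3=(0,0,1)$. Semigroup: $(S^\alpha_\Omega(t)f)^\wedge(\xi)=e^{-\nu|\xi|^{2\alpha}t}\big[\cos(\Omega\tfrac{\xi_3}{|\xi|}t)\,I_3+\sin(\Omega\tfrac{\xi_3}{|\xi|}t)\,R(\xi)\big]\hat f(\xi)$, where $I_3$ is the identity matrix and $R(\xi)=\frac1{|\xi|}\begin{pmatrix}0&\xi_3&-\xi_2\\-\xi_3&0&\xi_1\\\xi_2&-\xi_1&0\end{pmatrix}$. $\mathbb P$ is the Leray projector, with symbol $\hat{\mathbb P}(\xi)_{mk}=\delta_{mk}-\xi_m\xi_k/|\xi|^2$; $u\otimes u$ has Fourier transform with entries $\hat u_m*\hat u_k$. Stationary (mild) solution: a time-independent $u\in\dot{FB}^{4-2\alpha-\frac3p}_{p,p}$ such that $u=S^\alpha_\Omega(t)u-\int_0^tS^\alpha_\Omega(t-\tau)\mathbb P\nabla\cdot(u\otimes u)\,d\tau+\int_0^tS^\alpha_\Omega(\tau)\mathbb PF\,d\tau$ for every $t>0$; equivalently, $u=-\int_0^\infty S^\alpha_\Omega(\tau)\mathbb P\nabla\cdot(u\otimes u)\,d\tau+\int_0^\infty S^\alpha_\Omega(\tau)\mathbb PF\,d\tau$. All integrals are understood in Fourier variables, for almost every $\xi\in\mathbb R^3$. *)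

theory Defs
  imports "HOL-Analysis.Analysis"
begin

subsection \<open>Schwartz functions and tempered distributions on three-dimensional space\<close>

definition partial :: "3 \<Rightarrow> (real^3 \<Rightarrow> complex) \<Rightarrow> real^3 \<Rightarrow> complex" where
  "partial k f x = frechet_derivative f (at x) (axis k 1)"

definition partials :: "3 list \<Rightarrow> (real^3 \<Rightarrow> complex) \<Rightarrow> real^3 \<Rightarrow> complex" where
  "partials ks f = foldr partial ks f"

definition smooth :: "(real^3 \<Rightarrow> complex) \<Rightarrow> bool" where
  "smooth f \<longleftrightarrow> (\<forall>ks x. partials ks f differentiable (at x))"

definition schwartz :: "(real^3 \<Rightarrow> complex) set" where
  "schwartz = {f. smooth f \<and>
     (\<forall>N ks. bdd_above (range (\<lambda>x. (1 + norm x) ^ N * norm (partials ks f x))))}"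

definition test_functions :: "(real^3 \<Rightarrow> complex) set" where
  "test_functions = {f. smooth f \<and> bounded {x. f x \<noteq> 0}}"

definition schwartz_norm :: "nat \<Rightarrow> (real^3 \<Rightarrow> complex) \<Rightarrow> real" where
  "schwartz_norm N f =
     (\<Sum>ks | length ks \<le> N. SUP x. (1 + norm x) ^ N * norm (partials ks f x))"

text \<open>Continuous linear functionals on the Schwartz space. They are set to 0 off that
  space, so that equality in the type is equality of functionals on Schwartz functions.\<close>

typedef tempered = "{T :: (real^3 \<Rightarrow> complex) \<Rightarrow> complex.
    (\<forall>f. f \<notin> schwartz \<longrightarrow> T f = 0) \<and>
    (\<forall>f\<in>schwartz. \<forall>g\<in>schwartz. T (\<lambda>x. f x + g x) = T f + T g) \<and>
    (\<forall>f\<in>schwartz. \<forall>a. T (\<lambda>x. a * f x) = a * T f) \<and>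
    (\<exists>N C. \<forall>f\<in>schwartz. norm (T f) \<le> C * schwartz_norm N f)}"
  morphisms pairing Abs_tempered
proof
  have "\<forall>f\<in>schwartz. norm (0 :: complex) \<le> 0 * schwartz_norm 0 f" by simp
  then show "(\<lambda>_. 0) \<in> {T :: (real^3 \<Rightarrow> complex) \<Rightarrow> complex.
    (\<forall>f. f \<notin> schwartz \<longrightarrow> T f = 0) \<and>
    (\<forall>f\<in>schwartz. \<forall>g\<in>schwartz. T (\<lambda>x. f x + g x) = T f + T g) \<and>
    (\<forall>f\<in>schwartz. \<forall>a. T (\<lambda>x. a * f x) = a * T f) \<and>
    (\<exists>N C. \<forall>f\<in>schwartz. norm (T f) \<le> C * schwartz_norm N f)}"
    by (auto intro!: exI[of _ 0])
qed

subsection \<open>Fourier transform\<close>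

text \<open>With the factor \<open>(2\<pi>)\<^sup>-\<^sup>3\<close> on the direct transform, \<open>\<partial>\<^sub>k\<close> has symbol
  \<open>\<i> \<xi>\<^sub>k\<close>, the Laplacian has symbol \<open>- |\<xi>|\<^sup>2\<close>, and products become convolutions without
  any further constant.\<close>

definition fourier :: "(real^3 \<Rightarrow> complex) \<Rightarrow> real^3 \<Rightarrow> complex" where
  "fourier f \<xi> = (1 / (2 * pi) ^ 3) *\<^sub>R (LINT x|lborel. cis (- (x \<bullet> \<xi>)) * f x)"

definition locally_integrable :: "(real^3 \<Rightarrow> complex) \<Rightarrow> bool" where
  "locally_integrable g \<longleftrightarrow> (\<forall>K. compact K \<longrightarrow> set_integrable lborel K g)"

text \<open>The Fourier transform of \<open>T\<close>, i.e. the distribution \<open>f \<mapsto> \<langle>T, fourier f\<rangle>\<close>, is the locally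
  integrable function \<open>g\<close>. Test functions suffice since they are dense in the Schwartz space,
  whereas \<open>g f\<close> need not be integrable for all Schwartz functions \<open>f\<close>.\<close>

definition has_fourier_fun :: "tempered \<Rightarrow> (real^3 \<Rightarrow> complex) \<Rightarrow> bool" where
  "has_fourier_fun T g \<longleftrightarrow> locally_integrable g \<and>
     (\<forall>f\<in>test_functions. pairing T (fourier f) = (LINT \<xi>|lborel. g \<xi> * f \<xi>))"

text \<open>Vector fields are triples of distributions. The function below is determined up to a
  null set; it is only used where such a set does not matter.\<close>

definition fourier_fun :: "tempered^3 \<Rightarrow> real^3 \<Rightarrow> complex^3" where
  "fourier_fun u \<xi> = (\<chi> m. (SOME g. has_fourier_fun (u $ m) g) \<xi>)"

subsection \<open>Fourier-Besov spaces\<close>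

definition ennreal_powr :: "ennreal \<Rightarrow> real \<Rightarrow> ennreal" where
  "ennreal_powr x a = (if x = \<infinity> then \<infinity> else ennreal (enn2real x powr a))"

text \<open>Finite exponents only; with the counting measure this is the sequence space norm.\<close>

definition Lp_norm :: "'a measure \<Rightarrow> real \<Rightarrow> ('a \<Rightarrow> ennreal) \<Rightarrow> ennreal" where
  "Lp_norm M p f = ennreal_powr (\<integral>\<^sup>+x. ennreal_powr (f x) p \<partial>M) (1 / p)"

definition dyadic :: "(real^3 \<Rightarrow> complex) \<Rightarrow> int \<Rightarrow> real^3 \<Rightarrow> complex" where
  "dyadic \<phi> j \<xi> = \<phi> ((2 powi (- j)) *\<^sub>R \<xi>)"

definition littlewood_paley :: "(real^3 \<Rightarrow> complex) \<Rightarrow> bool" where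
  "littlewood_paley \<phi> \<longleftrightarrow> \<phi> \<in> schwartz \<and>
     (\<forall>\<xi> \<eta>. norm \<xi> = norm \<eta> \<longrightarrow> \<phi> \<xi> = \<phi> \<eta>) \<and>
     (\<forall>\<xi>. \<phi> \<xi> \<noteq> 0 \<longrightarrow> 3 / 4 \<le> norm \<xi> \<and> norm \<xi> \<le> 8 / 3) \<and>
     (\<forall>\<xi>. \<xi> \<noteq> 0 \<longrightarrow> ((\<lambda>j. dyadic \<phi> j \<xi>) has_sum 1) UNIV)"

definition fb_norm ::
  "(real^3 \<Rightarrow> complex) \<Rightarrow> real \<Rightarrow> real \<Rightarrow> real \<Rightarrow> tempered^3 \<Rightarrow> ennreal" where
  "fb_norm \<phi> s p q f = Lp_norm (count_space UNIV) q
     (\<lambda>j::int. ennreal (2 powr (of_int j * s)) *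
        Lp_norm lborel p (\<lambda>\<xi>. ennreal (norm (dyadic \<phi> j \<xi> *s fourier_fun f \<xi>))))"

definition fb_space ::
  "(real^3 \<Rightarrow> complex) \<Rightarrow> real \<Rightarrow> real \<Rightarrow> real \<Rightarrow> (tempered^3) set" where
  "fb_space \<phi> s p q =
     {f. (\<forall>m. \<exists>g. has_fourier_fun (f $ m) g) \<and> fb_norm \<phi> s p q f < \<infinity>}"

subsection \<open>The stationary fractional Navier-Stokes-Coriolis system\<close>

definition R_matrix :: "real^3 \<Rightarrow> complex^3^3" where
  "R_matrix \<xi> = (1 / norm \<xi>) *\<^sub>R vector
     [vector [0, of_real (\<xi>$3), - of_real (\<xi>$2)],
      vector [- of_real (\<xi>$3), 0, of_real (\<xi>$1)],
      vector [of_real (\<xi>$2), - of_real (\<xi>$1), 0]]"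

definition semigroup_symbol ::
  "real \<Rightarrow> real \<Rightarrow> real \<Rightarrow> real \<Rightarrow> real^3 \<Rightarrow> complex^3^3" where
  "semigroup_symbol \<nu> \<alpha> \<Omega> t \<xi> = exp (- \<nu> * norm \<xi> powr (2 * \<alpha>) * t) *\<^sub>R
     (cos (\<Omega> * (\<xi>$3 / norm \<xi>) * t) *\<^sub>R mat 1 +
      sin (\<Omega> * (\<xi>$3 / norm \<xi>) * t) *\<^sub>R R_matrix \<xi>)"

definition leray_symbol :: "real^3 \<Rightarrow> complex^3^3" where
  "leray_symbol \<xi> =
     (\<chi> m k. of_real ((if m = k then 1 else 0) - \<xi>$m * \<xi>$k / (norm \<xi>)\<^sup>2))"

definition conv_integrable_at ::
  "(real^3 \<Rightarrow> complex) \<Rightarrow> (real^3 \<Rightarrow> complex) \<Rightarrow> real^3 \<Rightarrow> bool" where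
  "conv_integrable_at f g \<xi> \<longleftrightarrow> integrable lborel (\<lambda>\<eta>. f (\<xi> - \<eta>) * g \<eta>)"

definition conv :: "(real^3 \<Rightarrow> complex) \<Rightarrow> (real^3 \<Rightarrow> complex) \<Rightarrow> real^3 \<Rightarrow> complex" where
  "conv f g \<xi> = (LINT \<eta>|lborel. f (\<xi> - \<eta>) * g \<eta>)"

text \<open>Fourier transform of the divergence of \<open>u \<otimes> u\<close>, as a function of \<open>v = fourier_fun u\<close>.\<close>

definition div_tensor :: "(real^3 \<Rightarrow> complex^3) \<Rightarrow> real^3 \<Rightarrow> complex^3" where
  "div_tensor v \<xi> =
     (\<chi> m. \<Sum>k\<in>UNIV. \<i> * of_real (\<xi>$k) * conv (\<lambda>\<eta>. v \<eta> $ m) (\<lambda>\<eta>. v \<eta> $ k) \<xi>)"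

text \<open>The second conjunct says that the convolutions in the third one exist almost everywhere.
  The integrands of the time integrals are continuous in \<open>\<tau>\<close>. Incompressibility follows from
  the equation: taking the inner product with \<open>\<xi>\<close> gives
  \<open>\<xi> \<cdot> v = exp (- \<nu> |\<xi>|\<^sup>2\<^sup>\<alpha> t) cos (\<Omega> \<xi>\<^sub>3 t / |\<xi>|) (\<xi> \<cdot> v)\<close>, hence \<open>\<xi> \<cdot> v = 0\<close>.\<close>

definition stationary_mild_solution ::
  "(real^3 \<Rightarrow> complex) \<Rightarrow> real \<Rightarrow> real \<Rightarrow> real \<Rightarrow> real \<Rightarrow> tempered^3 \<Rightarrow> tempered^3 \<Rightarrow> bool" where
  "stationary_mild_solution \<phi> p \<nu> \<alpha> \<Omega> F u \<longleftrightarrow>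
     u \<in> fb_space \<phi> (4 - 2 * \<alpha> - 3 / p) p p \<and>
     (let v = fourier_fun u; G = fourier_fun F; S = semigroup_symbol \<nu> \<alpha> \<Omega> in
        (AE \<xi> in lborel. \<forall>m k. conv_integrable_at (\<lambda>\<eta>. v \<eta> $ m) (\<lambda>\<eta>. v \<eta> $ k) \<xi>) \<and>
        (\<forall>t>0. AE \<xi> in lborel.
           v \<xi> = S t \<xi> *v v \<xi>
             - (LINT \<tau>:{0..t}|lborel. S (t - \<tau>) \<xi> *v (leray_symbol \<xi> *v div_tensor v \<xi>))
             + (LINT \<tau>:{0..t}|lborel. S \<tau> \<xi> *v (leray_symbol \<xi> *v G \<xi>))))"

end

theory Submission
  imports Defs "HOL-Probability.Probability"
begin

text \<open>Since the integrability and summability exponents agree, the Fourier-Besov norm is equivalent to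
  the norm of \<open>|\<xi>|\<^sup>s v\<close> in \<open>L\<^sup>p\<close>, where \<open>v\<close> is the Fourier transform of \<open>u\<close>. In terms of \<open>v\<close> the mild
  equation is the pointwise equation \<open>v = M P (G - D v)\<close>, where \<open>M\<close> is the inverse of
  \<open>\<nu> |\<xi>|\<^sup>2\<^sup>\<alpha> - \<Omega> (\<xi>\<^sub>3 / |\<xi>|) R\<close> on divergence-free vectors, so \<open>|M|\<close> is at most a constant times
  \<open>|\<xi>|\<^sup>-\<^sup>2\<^sup>\<alpha>\<close> uniformly in \<open>\<Omega>\<close>. The bilinear term is therefore controlled by
  \<open>|\<xi>|\<^sup>1\<^sup>-\<^sup>2\<^sup>\<alpha> (|v| * |v|)\<close>, which is bounded in the weighted space by Hoelder's inequality, since the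
  convolution of \<open>|\<cdot>|\<^sup>-\<^sup>\<sigma>\<close> with itself is a multiple of \<open>|\<cdot>|\<^sup>3\<^sup>-\<^sup>2\<^sup>\<sigma>\<close> for \<open>\<sigma> = s p / (p - 1)\<close>, and
  \<open>3/2 < \<sigma> < 3\<close> is exactly the assumption on \<open>\<alpha>\<close>. By dominated convergence \<open>M P G\<close> tends to \<open>0\<close> in
  the weighted space as \<open>|\<Omega>| \<rightarrow> \<infinity>\<close>, so the contraction principle applies to forces of any size.
  Passing between \<open>v\<close> and the distribution \<open>u\<close> requires Fourier inversion on the Schwartz space and
  the density of test functions.\<close>

subsection \<open>Radial integrals\<close>

text \<open>The obstacle is that the linear response to the force does not become small in operator
  norm under strong rotation: near the plane \<open>\<xi> $ 3 = 0\<close> and at high frequencies,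
  diffusion dominates for every \<Omega>. There is decay only at each fixed frequency off that
  plane, so smallness comes from the integrability of the given force, without a rate. Hence
  \<open>\<Omega>\<^sub>0\<close> depends on the force itself. The nonlinear estimate uses diffusion
  alone and is uniform in \<Omega>, hence so is \<epsilon>. All estimates are for p-th powers of
  weighted norms, which obey the triangle inequality only up to the factor \<open>2 powr p\<close>.
  The iteration is therefore made to contract p-th powers by \<open>4 powr (- p)\<close>, which is
  fast enough for pointwise convergence almost everywhere. The Fourier function of a distribution is
  a chosen representative, and the mild equation at each time has its own exceptional null set. The
  first point requires that the nonlinearity ignore null sets, the second that only countably many
  times be used.\<close>

lemma cball_borel [measurable]: "cball (a :: 'a :: metric_space) r \<in> sets borel"
  by (simp add: borel_closed)

lemma dyadic_bracket:
  fixes y :: real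
  assumes "1 \<le> y"
  obtains j :: nat where "2 ^ j \<le> y" "y < 2 ^ (j + 1)"
proof -
  obtain n where "y < 2 ^ n"
    using real_arch_pow[of 2 y] by auto
  define m where "m = (LEAST n. y < 2 ^ n)"
  have m: "y < 2 ^ m" unfolding m_def by (rule LeastI) fact
  with assms obtain j where j: "m = Suc j" by (cases m) auto
  have "\<not> y < 2 ^ j"
    using not_less_Least[of j "\<lambda>n. y < 2 ^ n"] j by (simp add: m_def)
  with m j that[of j] show ?thesis by simp
qed

text \<open>Replaces polar coordinates: once a radial function is dominated by constants on balls,
  only the volume of balls enters, and the integral becomes a numerical series.\<close>

lemma nn_integral_le_dyadic_cover:
  fixes f :: "real^3 \<Rightarrow> real" and c r :: "nat \<Rightarrow> real"
  assumes "AE x in lborel. ennreal (f x) \<le> (\<Sum>j. ennreal (c j) * indicator (cball 0 (r j)) x)"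
    and c: "\<And>j. 0 \<le> c j" and r: "\<And>j. 0 \<le> r j"
    and s: "(\<lambda>j. c j * (r j) ^ 3) sums S"
  shows "(\<integral>\<^sup>+x. ennreal (f x) \<partial>lborel) \<le> ennreal (unit_ball_vol 3 * S)"
proof -
  have "(\<integral>\<^sup>+x. ennreal (f x) \<partial>lborel) \<le> (\<integral>\<^sup>+x. (\<Sum>j. ennreal (c j) * indicator (cball (0::real^3) (r j)) x) \<partial>lborel)"
    by (rule nn_integral_mono_AE[OF assms(1)])
  also have "\<dots> = (\<Sum>j. \<integral>\<^sup>+x. ennreal (c j) * indicator (cball (0::real^3) (r j)) x \<partial>lborel)"
    by (rule nn_integral_suminf) measurable
  also have "\<dots> = (\<Sum>j. ennreal (unit_ball_vol 3 * (c j * (r j) ^ 3)))"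
    using c r by (simp add: nn_integral_cmult_indicator emeasure_cball ennreal_mult' [symmetric]
       ennreal_mult''[symmetric] unit_ball_vol_nonneg algebra_simps power3_eq_cube)
  also have "\<dots> = ennreal (unit_ball_vol 3 * S)"
  proof (rule suminf_ennreal_eq)
    show "(\<lambda>j. unit_ball_vol 3 * (c j * r j ^ 3)) sums (unit_ball_vol 3 * S)"
      using s by (rule sums_mult)
  qed (use c r in \<open>simp add: unit_ball_vol_nonneg\<close>)
  finally show ?thesis .
qed

lemma suminf_term_le:
  fixes f :: "nat \<Rightarrow> ennreal"
  shows "f j \<le> (\<Sum>j. f j)"
  using sum_le_suminf[of f "{j}"] by simp

text \<open>The shell between the radii \<open>R / 2 ^ (j + 1)\<close> and \<open>R / 2 ^ j\<close>
  contributes at most a multiple of \<open>q ^ j\<close>, and \<open>\<sigma> < 3\<close> makes this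
  series converge. The constant is uniform in \<open>R\<close>, because \<open>R\<close> will later
  be half the norm of a frequency.\<close>

lemma integral_singular_ball:
  assumes "0 \<le> \<sigma>" "\<sigma> < 3"
  shows "\<exists>C\<ge>0. \<forall>R>0. (\<integral>\<^sup>+(x::real^3). ennreal (indicator (cball 0 R) x * norm x powr (-\<sigma>)) \<partial>lborel)
          \<le> ennreal (C * R powr (3 - \<sigma>))"
proof -
  define q where "q = 2 powr (\<sigma> - 3)"
  have q: "0 < q" "q < 1" using assms by (auto simp: q_def powr_less_one)
  define C where "C = unit_ball_vol 3 * (2 powr \<sigma> * (1 / (1 - q)))"
  have "0 \<le> C" using q by (simp add: C_def)
  moreover have "(\<integral>\<^sup>+(x::real^3). ennreal (indicator (cball 0 R) x * norm x powr (-\<sigma>)) \<partial>lborel)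
          \<le> ennreal (C * R powr (3 - \<sigma>))" if R: "R > 0" for R
  proof -
    define c where "c j = R powr (-\<sigma>) * (2 ^ (j + 1)) powr \<sigma>" for j :: nat
    define r where "r j = R / 2 ^ j" for j :: nat
    have cr: "c j * r j ^ 3 = (R powr (3 - \<sigma>) * 2 powr \<sigma>) * q ^ j" for j
    proof -
      have "r j ^ 3 = r j powr 3"
        using R by (simp add: r_def)
      then have "c j * r j ^ 3 = (R powr (-\<sigma>) * R powr 3) * ((2 ^ (j + 1)) powr \<sigma> / (2 ^ j) powr 3)"
        using R by (simp add: c_def r_def powr_divide)
      also have "(R powr (-\<sigma>) * R powr 3) = R powr (3 - \<sigma>)"
        by (simp add: powr_add[symmetric])
      also have "((2::real) ^ (j + 1)) powr \<sigma> / (2 ^ j) powr 3 = 2 powr (real (j + 1) * \<sigma> - real j * 3)"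
        by (simp only: powr_realpow[symmetric] powr_powr powr_diff zero_less_numeral)
      also have "real (j + 1) * \<sigma> - real j * 3 = \<sigma> + (\<sigma> - 3) * real j"
        by (simp add: algebra_simps)
      also have "2 powr (\<sigma> + (\<sigma> - 3) * real j) = 2 powr \<sigma> * q ^ j"
        by (simp add: powr_add powr_powr[symmetric] q_def powr_realpow)
      finally show ?thesis by simp
    qed
    have "(\<integral>\<^sup>+(x::real^3). ennreal (indicator (cball 0 R) x * norm x powr (-\<sigma>)) \<partial>lborel)
       \<le> ennreal (unit_ball_vol 3 * ((R powr (3 - \<sigma>) * 2 powr \<sigma>) * (1 / (1 - q))))"
    proof (rule nn_integral_le_dyadic_cover[where c=c and r=r])
      show "(\<lambda>j. c j * r j ^ 3) sums ((R powr (3 - \<sigma>) * 2 powr \<sigma>) * (1 / (1 - q)))"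
        unfolding cr using q by (intro sums_mult geometric_sums) auto
      show "AE x in lborel. ennreal (indicator (cball (0::real^3) R) x * norm x powr (-\<sigma>)) \<le>
          (\<Sum>j. ennreal (c j) * indicator (cball 0 (r j)) x)"
      proof (rule AE_I2)
        fix x :: "real^3"
        show "ennreal (indicator (cball 0 R) x * norm x powr (-\<sigma>)) \<le>
          (\<Sum>j. ennreal (c j) * indicator (cball 0 (r j)) x)"
        \<comment> \<open>The other case is trivial: the indicator vanishes outside the ball, and at
          the origin \<open>0 powr (-\<sigma>)\<close> is 0 by convention.\<close>
        proof (cases "x \<noteq> 0 \<and> norm x \<le> R")
          case True
          then have n: "0 < norm x" by simp
          have "1 \<le> R / norm x" using True by simp
          then obtain j :: nat where j: "2 ^ j \<le> R / norm x" "R / norm x < 2 ^ (j + 1)"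
            by (rule dyadic_bracket)
          have "norm x \<le> r j" using j(1) n by (simp add: r_def field_simps)
          have "norm x powr (-\<sigma>) = R powr (-\<sigma>) * (R / norm x) powr \<sigma>"
            using n R by (simp add: powr_divide powr_minus field_simps)
          also have "\<dots> \<le> c j"
            unfolding c_def using j(2) R n assms by (intro mult_left_mono powr_mono2) auto
          finally have "ennreal (indicator (cball 0 R) x * norm x powr (-\<sigma>)) \<le> ennreal (c j) * indicator (cball 0 (r j)) x"
            using True \<open>norm x \<le> r j\<close> by (simp add: ennreal_leI)
          also have "\<dots> \<le> (\<Sum>j. ennreal (c j) * indicator (cball 0 (r j)) x)"
            by (rule suminf_term_le)
          finally show ?thesis .
        qed (auto simp: indicator_def)
      qed
    qed (use R in \<open>auto simp: c_def r_def\<close>)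
    then show ?thesis by (simp add: C_def mult_ac)
  qed
  ultimately show ?thesis by blast
qed

text \<open>The shells now grow with \<open>j\<close>, and the ratio of the series is
  \<open>2 powr (3 - \<tau>)\<close>. Enlarging a shell to the full ball of radius
  \<open>R * 2 ^ (j + 1)\<close> costs the factor \<open>8 = 2 ^ 3\<close>.\<close>

lemma integral_decay_outside_ball:
  assumes "3 < \<tau>"
  shows "\<exists>C\<ge>0. \<forall>R>0. (\<integral>\<^sup>+(x::real^3). ennreal (indicator {x. R \<le> norm x} x * norm x powr (-\<tau>)) \<partial>lborel)
          \<le> ennreal (C * R powr (3 - \<tau>))"
proof -
  define q where "q = 2 powr (3 - \<tau>)"
  have q: "0 < q" "q < 1" using assms by (auto simp: q_def powr_less_one)
  define C where "C = unit_ball_vol 3 * (8 * (1 / (1 - q)))"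
  have "0 \<le> C" using q by (simp add: C_def)
  moreover have "(\<integral>\<^sup>+(x::real^3). ennreal (indicator {x. R \<le> norm x} x * norm x powr (-\<tau>)) \<partial>lborel)
          \<le> ennreal (C * R powr (3 - \<tau>))" if R: "R > 0" for R
  proof -
    define c where "c j = (R * 2 ^ j) powr (-\<tau>)" for j :: nat
    define r where "r j = R * 2 ^ (j + 1)" for j :: nat
    have cr: "c j * r j ^ 3 = (R powr (3 - \<tau>) * 8) * q ^ j" for j
    proof -
      have "r j ^ 3 = (R * 2 ^ j) powr 3 * 8"
        using R by (simp add: r_def power_mult_distrib power3_eq_cube)
      then have "c j * r j ^ 3 = (R * 2 ^ j) powr (3 - \<tau>) * 8"
        by (simp add: c_def powr_add[symmetric])
      also have "(R * 2 ^ j) powr (3 - \<tau>) = R powr (3 - \<tau>) * q ^ j"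
        using R by (simp add: powr_mult q_def powr_realpow[symmetric] powr_powr mult.commute)
      finally show ?thesis by simp
    qed
    have "(\<integral>\<^sup>+(x::real^3). ennreal (indicator {x. R \<le> norm x} x * norm x powr (-\<tau>)) \<partial>lborel)
       \<le> ennreal (unit_ball_vol 3 * ((R powr (3 - \<tau>) * 8) * (1 / (1 - q))))"
    proof (rule nn_integral_le_dyadic_cover[where c=c and r=r])
      show "(\<lambda>j. c j * r j ^ 3) sums ((R powr (3 - \<tau>) * 8) * (1 / (1 - q)))"
        unfolding cr using q by (intro sums_mult geometric_sums) auto
      show "AE x in lborel. ennreal (indicator {x::real^3. R \<le> norm x} x * norm x powr (-\<tau>)) \<le>
          (\<Sum>j. ennreal (c j) * indicator (cball 0 (r j)) x)"
      proof (rule AE_I2)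
        fix x :: "real^3"
        show "ennreal (indicator {x. R \<le> norm x} x * norm x powr (-\<tau>)) \<le>
          (\<Sum>j. ennreal (c j) * indicator (cball 0 (r j)) x)"
        proof (cases "R \<le> norm x")
          case True
          then have "1 \<le> norm x / R" using R by simp
          then obtain j :: nat where j: "2 ^ j \<le> norm x / R" "norm x / R < 2 ^ (j + 1)"
            by (rule dyadic_bracket)
          have n: "R * 2 ^ j \<le> norm x" "norm x \<le> r j" using j R by (auto simp: r_def field_simps)
          have "norm x powr (-\<tau>) \<le> c j"
            unfolding c_def using n(1) R assms by (intro powr_mono2') auto
          then have "ennreal (indicator {x. R \<le> norm x} x * norm x powr (-\<tau>)) \<le> ennreal (c j) * indicator (cball 0 (r j)) x"
            using True n by (simp add: ennreal_leI)
          also have "\<dots> \<le> (\<Sum>j. ennreal (c j) * indicator (cball 0 (r j)) x)"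
            by (rule suminf_term_le)
          finally show ?thesis .
        qed (auto simp: indicator_def)
      qed
    qed (use R in \<open>auto simp: c_def r_def\<close>)
    then show ?thesis by (simp add: C_def mult_ac)
  qed
  ultimately show ?thesis by blast
qed

text \<open>Common majorant for the dominated convergence and growth arguments below; 4 is the least
  integer exponent above the dimension.\<close>

lemma integrable_decay4: "integrable lborel (\<lambda>x::real^3. 1 / (1 + norm x) ^ 4)"
proof (rule integrableI_bounded)
  obtain C where C: "\<And>R. R > 0 \<Longrightarrow> (\<integral>\<^sup>+(x::real^3). ennreal (indicator {x. R \<le> norm x} x * norm x powr (-4)) \<partial>lborel)
          \<le> ennreal (C * R powr (3 - 4))"
    using integral_decay_outside_ball[of 4] by auto
  have "(\<integral>\<^sup>+(x::real^3). ennreal (norm (1 / (1 + norm x) ^ 4)) \<partial>lborel) \<le>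
     (\<integral>\<^sup>+(x::real^3). indicator (cball 0 1) x + ennreal (indicator {x. 1 \<le> norm x} x * norm x powr (-4)) \<partial>lborel)"
  proof (rule nn_integral_mono)
    fix x :: "real^3"
    show "ennreal (norm (1 / (1 + norm x) ^ 4)) \<le> indicator (cball 0 1) x + ennreal (indicator {x. 1 \<le> norm x} x * norm x powr (-4))"
    proof (cases "norm x \<le> 1")
      case True
      have "ennreal (norm (1 / (1 + norm x) ^ 4)) \<le> ennreal 1"
        using one_le_power[of "1 + norm x" 4] by (intro ennreal_leI) (simp add: divide_le_eq)
      also have "\<dots> \<le> indicator (cball 0 1) x + ennreal (indicator {x. 1 \<le> norm x} x * norm x powr (-4))"
        using True by simp
      finally show ?thesis .
    next
      case False
      then have "norm (1 / (1 + norm x) ^ 4) \<le> norm x powr (-4)"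
        by (auto simp: powr_minus divide_inverse intro!: power_mono le_imp_inverse_le)
      then show ?thesis using False by (simp add: ennreal_leI)
    qed
  qed
  also have "\<dots> = emeasure lborel (cball (0::real^3) 1) +
      (\<integral>\<^sup>+(x::real^3). ennreal (indicator {x. 1 \<le> norm x} x * norm x powr (-4)) \<partial>lborel)"
    by (subst nn_integral_add) simp_all
  also have "\<dots> < \<infinity>"
    using C[of 1] emeasure_lborel_cball_finite[of "0::real^3" 1] by (auto simp: top_unique less_top[symmetric])
  finally show "(\<integral>\<^sup>+(x::real^3). ennreal (norm (1 / (1 + norm x) ^ 4)) \<partial>lborel) < \<infinity>" .
qed auto

subsection \<open>Iterated partial derivatives\<close>

lemma partials_Nil [simp]: "partials [] f = f"
  by (simp add: partials_def)

lemma partials_Cons: "partials (k # ks) f = partial k (partials ks f)"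
  by (simp add: partials_def)

lemma partials_append: "partials (as @ bs) f = partials as (partials bs f)"
  by (simp add: partials_def)

lemma partial_has_derivative:
  assumes "(f has_derivative D) (at x)"
  shows "partial k f x = D (axis k 1)"
  using assms by (simp add: partial_def frechet_derivative_at[symmetric])

lemma derivative_eq_partials:
  fixes f :: "real^3 \<Rightarrow> complex"
  assumes "f differentiable (at x)"
  shows "(f has_derivative (\<lambda>h. \<Sum>k\<in>UNIV. h $ k *\<^sub>R partial k f x)) (at x)"
proof -
  let ?D = "frechet_derivative f (at x)"
  have D: "(f has_derivative ?D) (at x)"
    using assms by (simp add: frechet_derivative_works)
  interpret bounded_linear ?D
    using D by (rule has_derivative_bounded_linear)
  have "?D h = (\<Sum>k\<in>UNIV. h $ k *\<^sub>R partial k f x)" for h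
  proof -
    have "h = (\<Sum>k\<in>UNIV. h $ k *\<^sub>R axis k 1)"
      using basis_expansion[of h] by (simp add: scalar_mult_eq_scaleR)
    then have "?D h = ?D (\<Sum>k\<in>UNIV. h $ k *\<^sub>R axis k 1)" by simp
    also have "\<dots> = (\<Sum>k\<in>UNIV. h $ k *\<^sub>R partial k f x)"
      by (simp add: sum scaleR partial_def)
    finally show ?thesis .
  qed
  then have "?D = (\<lambda>h. \<Sum>k\<in>UNIV. h $ k *\<^sub>R partial k f x)" by (rule ext)
  with D show ?thesis by simp
qed

lemma smoothD: "smooth f \<Longrightarrow> partials ks f differentiable (at x)"
  by (simp add: smooth_def)

lemma derivative_partials:
  "smooth f \<Longrightarrow> (partials ks f has_derivative (\<lambda>h. \<Sum>k\<in>UNIV. h $ k *\<^sub>R partial k (partials ks f) x)) (at x)"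
  by (rule derivative_eq_partials[OF smoothD])

lemma smooth_differentiable: "smooth f \<Longrightarrow> f differentiable (at x)"
  using smoothD[of f "[]"] by simp

lemma smooth_partials: "smooth f \<Longrightarrow> smooth (partials ks f)"
  by (metis partials_append smooth_def)

lemma smooth_partial: "smooth f \<Longrightarrow> smooth (partial k f)"
  using smooth_partials[of f "[k]"] by (simp add: partials_Cons)

lemma smooth_continuous_on: "smooth f \<Longrightarrow> continuous_on S f"
  by (meson continuous_at_imp_continuous_on differentiable_imp_continuous_within smooth_differentiable)

lemma smooth_borel: "smooth f \<Longrightarrow> f \<in> borel_measurable borel"
  by (simp add: borel_measurable_continuous_onI smooth_continuous_on)

lemma partials_add:
  assumes "smooth f" "smooth g"
  shows "partials ks (\<lambda>x. f x + g x) = (\<lambda>x. partials ks f x + partials ks g x)"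
proof (induction ks)
  case (Cons k ks)
  have "partial k (\<lambda>x. partials ks f x + partials ks g x) x
      = partial k (partials ks f) x + partial k (partials ks g) x" for x
    using partial_has_derivative[OF has_derivative_add[OF derivative_partials[OF assms(1), of ks x]
          derivative_partials[OF assms(2), of ks x]], of k]
    by (simp add: axis_def if_distrib[of "\<lambda>c. c *\<^sub>R _"] cong: if_cong)
  then show ?case using Cons by (auto simp: partials_Cons)
qed simp

lemma smooth_add: "smooth f \<Longrightarrow> smooth g \<Longrightarrow> smooth (\<lambda>x. f x + g x)"
  by (auto simp: smooth_def[of "\<lambda>x. f x + g x"] partials_add intro!: differentiable_add smoothD)

lemma partials_cmult:
  assumes "smooth f"
  shows "partials ks (\<lambda>x. c * f x) = (\<lambda>x. c * partials ks f x)"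
proof (induction ks)
  case (Cons k ks)
  have "partial k (\<lambda>x. c * partials ks f x) x = c * partial k (partials ks f) x" for x
    using partial_has_derivative[OF has_derivative_mult_right[OF derivative_partials[OF assms, of ks x], of c], of k]
    by (simp add: axis_def if_distrib[of "\<lambda>c. c *\<^sub>R _"] cong: if_cong)
  then show ?case using Cons by (auto simp: partials_Cons)
qed simp

lemma smooth_cmult: "smooth f \<Longrightarrow> smooth (\<lambda>x. c * f x)"
  by (auto simp: smooth_def[of "\<lambda>x. c * f x"] partials_cmult
      intro!: differentiable_mult smoothD)

lemma partial_zero [simp]: "partial k (\<lambda>x. c) = (\<lambda>x. 0)"
  by (simp add: fun_eq_iff partial_def)

lemma partials_const: "partials ks (\<lambda>x. c) = (if ks = [] then (\<lambda>x. c) else (\<lambda>x. 0))"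
  by (induction ks) (auto simp: partials_Cons)

lemma smooth_const: "smooth (\<lambda>x. c)"
  by (simp add: smooth_def partials_const)

text \<open>Each derivative falls on one of the two factors. The resulting pairs are listed with
  repetitions instead of being counted by binomial coefficients, so that one more derivative is a
  mere \<open>concat\<close>.\<close>

fun leibniz_splits :: "3 list \<Rightarrow> (3 list \<times> 3 list) list" where
  "leibniz_splits [] = [([], [])]"
| "leibniz_splits (k # ks) =
     concat (map (\<lambda>(a, b). [(k # a, b), (a, k # b)]) (leibniz_splits ks))"

definition leibniz_sum where
  "leibniz_sum L f g x = (\<Sum>(a, b)\<leftarrow>L. partials a f x * partials b g x)"

lemma leibniz_sum_derivative:
  assumes "smooth f" "smooth g"
  shows "leibniz_sum L f g differentiable (at x)"
    and "partial k (leibniz_sum L f g) x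
      = leibniz_sum (concat (map (\<lambda>(a, b). [(k # a, b), (a, k # b)]) L)) f g x"
proof (induction L)
  case Nil
  show "leibniz_sum [] f g differentiable (at x)"
    by (simp add: leibniz_sum_def[abs_def])
  show "partial k (leibniz_sum [] f g) x = leibniz_sum (concat (map (\<lambda>(a, b). [(k # a, b), (a, k # b)]) [])) f g x"
    by (simp add: leibniz_sum_def[abs_def])
next
  case (Cons ab L)
  obtain a b where ab: "ab = (a, b)" by fastforce
  have eq: "leibniz_sum (ab # L) f g = (\<lambda>x. partials a f x * partials b g x + leibniz_sum L f g x)"
    by (simp add: leibniz_sum_def[abs_def] ab)
  note D = has_derivative_add[OF has_derivative_mult[OF derivative_partials[OF assms(1), of a x]
        derivative_partials[OF assms(2), of b x]] derivative_eq_partials[OF Cons.IH(1)]]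
  show "leibniz_sum (ab # L) f g differentiable (at x)"
    unfolding eq using D by (rule differentiableI)
  show "partial k (leibniz_sum (ab # L) f g) x
      = leibniz_sum (concat (map (\<lambda>(a, b). [(k # a, b), (a, k # b)]) (ab # L))) f g x"
    unfolding eq using partial_has_derivative[OF D, of k] Cons.IH(2)
    by (simp add: axis_def if_distrib[of "\<lambda>c. c *\<^sub>R _"] ab partials_Cons leibniz_sum_def
         cong: if_cong)
qed

lemma partials_mult:
  assumes "smooth f" "smooth g"
  shows "partials ks (\<lambda>x. f x * g x) = leibniz_sum (leibniz_splits ks) f g"
proof (induction ks)
  case (Cons k ks)
  then show ?case by (auto simp: partials_Cons leibniz_sum_derivative[OF assms])
qed (simp add: fun_eq_iff leibniz_sum_def)

lemma smooth_mult: "smooth f \<Longrightarrow> smooth g \<Longrightarrow> smooth (\<lambda>x. f x * g x)"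
  unfolding smooth_def[of "\<lambda>x. f x * g x"] by (simp add: partials_mult leibniz_sum_derivative(1))

text \<open>For functions whose derivatives are not expressed by the function itself but stay in a
  family, such as Fourier transforms of Schwartz functions or the functions \<open>flat P\<close>
  with varying \<open>P\<close>.\<close>

lemma smooth_coinduct:
  assumes "f \<in> A" and "\<And>g x. g \<in> A \<Longrightarrow> g differentiable (at x)"
    and "\<And>g k. g \<in> A \<Longrightarrow> partial k g \<in> A"
  shows "smooth f"
proof -
  have "partials ks f \<in> A" for ks
    by (induction ks) (use assms in \<open>auto simp: partials_Cons\<close>)
  then show ?thesis using assms(2) by (auto simp: smooth_def)
qed

lemma partial_coordinate: "partial k (\<lambda>x. complex_of_real (x $ j)) = (\<lambda>x. if k = j then 1 else 0)"
proof
  fix x :: "real^3"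
  have "((\<lambda>x::real^3. complex_of_real (x $ j)) has_derivative (\<lambda>h. complex_of_real (h $ j))) (at x)"
    by (intro bounded_linear.has_derivative[OF bounded_linear_of_real]
       bounded_linear_imp_has_derivative bounded_linear_vec_nth)
  from partial_has_derivative[OF this] show "partial k (\<lambda>x. complex_of_real (x $ j)) x = (if k = j then 1 else 0)"
    by (simp add: axis_def)
qed

lemma partials_coordinate:
  "partials ks (\<lambda>x. complex_of_real (x $ j)) =
    (if ks = [] then (\<lambda>x. complex_of_real (x $ j)) else
      if length ks = 1 then (\<lambda>x. if hd ks = j then 1 else 0) else (\<lambda>x. 0))"
proof (induction ks)
  case (Cons k ks)
  then show ?case by (auto simp: partials_Cons partial_coordinate length_Suc_conv)
qed simp

lemma smooth_coordinate: "smooth (\<lambda>x. complex_of_real (x $ j))"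
proof -
  have "(\<lambda>x::real^3. complex_of_real (x $ j)) differentiable (at x)" for x
    by (intro bounded_linear_imp_differentiable bounded_linear_compose[OF bounded_linear_of_real bounded_linear_vec_nth])
  then show ?thesis by (auto simp: smooth_def partials_coordinate)
qed

text \<open>The multipliers of the Schwartz space.\<close>

definition tame :: "(real^3 \<Rightarrow> complex) \<Rightarrow> bool" where
  "tame g \<longleftrightarrow> smooth g \<and> (\<forall>ks. \<exists>C M. \<forall>x. norm (partials ks g x) \<le> C * (1 + norm x) ^ M)"

lemma tame_coordinate: "tame (\<lambda>x. complex_of_real (x $ j))"
  unfolding tame_def
proof (intro conjI allI smooth_coordinate)
  fix ks
  have "norm (partials ks (\<lambda>x. complex_of_real (x $ j)) x) \<le> 1 * (1 + norm x) ^ 1" for x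
    using component_le_norm_cart[of x j] norm_ge_zero[of x] by (simp add: partials_coordinate del: norm_ge_zero)
  then show "\<exists>C M. \<forall>x. norm (partials ks (\<lambda>x. complex_of_real (x $ j)) x) \<le> C * (1 + norm x) ^ M"
    by blast
qed

lemma tame_const: "tame (\<lambda>x. c)"
  unfolding tame_def
  by (auto simp: smooth_const partials_const intro!: exI[of _ "norm c"] exI[of _ "0::nat"])

subsection \<open>Continuous operators on the Schwartz space\<close>

lemma schwartzI:
  assumes "smooth f" "\<And>N ks. \<exists>C. \<forall>x. (1 + norm x) ^ N * norm (partials ks f x) \<le> C"
  shows "f \<in> schwartz"
  using assms unfolding schwartz_def bdd_above_def by fastforce

lemma schwartz_smooth: "f \<in> schwartz \<Longrightarrow> smooth f"
  by (simp add: schwartz_def)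

lemma finite_multi_indices: "finite {ks :: 3 list. length ks \<le> N}"
  using finite_lists_length_le[of "UNIV :: 3 set" N] by simp

lemma schwartz_norm_SUP:
  assumes "f \<in> schwartz"
  shows "(1 + norm x) ^ N * norm (partials ks f x) \<le> (SUP x. (1 + norm x) ^ N * norm (partials ks f x))"
  using assms by (intro cSUP_upper) (auto simp: schwartz_def)

lemma schwartz_norm_bound:
  assumes "f \<in> schwartz" "n \<le> N" "length ks \<le> N"
  shows "(1 + norm x) ^ n * norm (partials ks f x) \<le> schwartz_norm N f"
proof -
  have nonneg: "0 \<le> (SUP x. (1 + norm x) ^ N * norm (partials ks f x))" for ks
    by (rule order_trans[OF _ schwartz_norm_SUP[OF assms(1), of 0]]) simp
  have "(1 + norm x) ^ n * norm (partials ks f x) \<le> (1 + norm x) ^ N * norm (partials ks f x)"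
    using assms(2) by (intro mult_right_mono power_increasing) auto
  also have "\<dots> \<le> (SUP x. (1 + norm x) ^ N * norm (partials ks f x))"
    by (rule schwartz_norm_SUP[OF assms(1)])
  also have "\<dots> \<le> schwartz_norm N f"
    unfolding schwartz_norm_def using assms(3) nonneg
    by (intro member_le_sum finite_multi_indices) auto
  finally show ?thesis .
qed

lemma schwartz_norm_nonneg: "f \<in> schwartz \<Longrightarrow> 0 \<le> schwartz_norm N f"
  using schwartz_norm_bound[of f 0 N "[]" 0] by (auto intro: order_trans[OF norm_ge_zero])

lemma schwartz_norm_leI:
  assumes "\<And>ks x. length ks \<le> N \<Longrightarrow> (1 + norm x) ^ N * norm (partials ks f x) \<le> B"
  shows "schwartz_norm N f \<le> real (card {ks :: 3 list. length ks \<le> N}) * B"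
  unfolding schwartz_norm_def
  using assms by (intro sum_bounded_above cSUP_least) auto

lemma schwartz_norm_mono:
  assumes "f \<in> schwartz" "N \<le> M"
  shows "schwartz_norm N f \<le> real (card {ks :: 3 list. length ks \<le> N}) * schwartz_norm M f"
  using assms by (intro schwartz_norm_leI schwartz_norm_bound) auto

lemma schwartz_add: 
  assumes "f \<in> schwartz" "g \<in> schwartz" shows "(\<lambda>x. f x + g x) \<in> schwartz"
proof (rule schwartzI)
  show "\<exists>C. \<forall>x. (1 + norm x) ^ N * norm (partials ks (\<lambda>x. f x + g x) x) \<le> C" for N ks
  proof (intro exI allI)
    fix x
    let ?M = "max N (length ks)"
    have "(1 + norm x) ^ N * norm (partials ks f x + partials ks g x)
       \<le> (1 + norm x) ^ N * norm (partials ks f x) + (1 + norm x) ^ N * norm (partials ks g x)"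
      by (simp add: distrib_left[symmetric] mult_left_mono norm_triangle_ineq)
    also have "\<dots> \<le> schwartz_norm ?M f + schwartz_norm ?M g"
      using assms by (intro add_mono schwartz_norm_bound) auto
    finally show "(1 + norm x) ^ N * norm (partials ks (\<lambda>x. f x + g x) x) \<le> schwartz_norm ?M f + schwartz_norm ?M g"
      using assms by (simp add: partials_add schwartz_smooth)
  qed
qed (use assms in \<open>auto intro: smooth_add schwartz_smooth\<close>)

text \<open>For linear \<open>A\<close> this is continuity in the topology defined by the seminorms
  \<open>schwartz_norm N\<close>.\<close>

definition schwartz_continuous :: "((real^3 \<Rightarrow> complex) \<Rightarrow> real^3 \<Rightarrow> complex) \<Rightarrow> bool" where
  "schwartz_continuous A \<longleftrightarrow> (\<forall>f\<in>schwartz. A f \<in> schwartz) \<and>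
     (\<forall>N. \<exists>C\<ge>0. \<exists>M. \<forall>f\<in>schwartz. schwartz_norm N (A f) \<le> C * schwartz_norm M f)"

text \<open>Each weight and each multi-index may be treated separately, since a seminorm involves
  only finitely many of them.\<close>

lemma schwartz_continuousI:
  assumes smooth: "\<And>f. f \<in> schwartz \<Longrightarrow> smooth (A f)"
    and bound: "\<And>N ks. \<exists>C\<ge>0. \<exists>M. \<forall>f\<in>schwartz. \<forall>x.
        (1 + norm x) ^ N * norm (partials ks (A f) x) \<le> C * schwartz_norm M f"
  shows "schwartz_continuous A"
  unfolding schwartz_continuous_def
proof (intro conjI ballI allI)
  fix f assume "f \<in> schwartz"
  show "A f \<in> schwartz"
    by (rule schwartzI[OF smooth[OF \<open>f \<in> schwartz\<close>]]) (use bound \<open>f \<in> schwartz\<close> in blast)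
next
  fix N
  let ?K = "{ks :: 3 list. length ks \<le> N}"
  obtain C M where C: "\<And>ks. 0 \<le> C ks" and
    CM: "\<And>ks f x. f \<in> schwartz \<Longrightarrow> (1 + norm x) ^ N * norm (partials ks (A f) x) \<le> C ks * schwartz_norm (M ks) f"
    using bound[of N] by metis
  \<comment> \<open>One seminorm has to serve all multi-indices of length at most \<open>N\<close>;
    the cardinalities in \<open>c\<close> pay for the passage from \<open>M ks\<close> to
    \<open>m\<close>.\<close>
  define m where "m = Max (M ` ?K)"
  define c where "c ks = C ks * real (card {ks' :: 3 list. length ks' \<le> M ks})" for ks
  have c: "0 \<le> c ks" for ks using C by (simp add: c_def)
  have "schwartz_norm N (A f) \<le> (real (card ?K) * sum c ?K) * schwartz_norm m f" if f: "f \<in> schwartz" for f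
  proof -
    have "schwartz_norm N (A f) \<le> real (card ?K) * (sum c ?K * schwartz_norm m f)"
    proof (rule schwartz_norm_leI)
      fix ks :: "3 list" and x :: "real^3" assume ks: "length ks \<le> N"
      have "M ks \<le> m" unfolding m_def using ks finite_multi_indices by (intro Max_ge) auto
      have "(1 + norm x) ^ N * norm (partials ks (A f) x) \<le> C ks * schwartz_norm (M ks) f"
        by (rule CM[OF f])
      also have "\<dots> \<le> C ks * (real (card {ks' :: 3 list. length ks' \<le> M ks}) * schwartz_norm m f)"
        by (intro mult_left_mono schwartz_norm_mono f C \<open>M ks \<le> m\<close>)
      also have "\<dots> = c ks * schwartz_norm m f" by (simp add: c_def)
      also have "\<dots> \<le> sum c ?K * schwartz_norm m f"
        using ks c by (intro mult_right_mono member_le_sum finite_multi_indices schwartz_norm_nonneg f) auto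
      finally show "(1 + norm x) ^ N * norm (partials ks (A f) x) \<le> sum c ?K * schwartz_norm m f" .
    qed
    then show ?thesis by simp
  qed
  moreover have "0 \<le> real (card ?K) * sum c ?K" by (intro mult_nonneg_nonneg sum_nonneg c) auto
  ultimately show "\<exists>C\<ge>0. \<exists>M. \<forall>f\<in>schwartz. schwartz_norm N (A f) \<le> C * schwartz_norm M f"
    by blast
qed

lemma schwartz_continuousD: "schwartz_continuous A \<Longrightarrow> f \<in> schwartz \<Longrightarrow> A f \<in> schwartz"
  by (simp add: schwartz_continuous_def)

lemma schwartz_continuous_norm:
  assumes "schwartz_continuous A"
  obtains C M where "0 \<le> C" "\<And>f. f \<in> schwartz \<Longrightarrow> schwartz_norm N (A f) \<le> C * schwartz_norm M f"
  using assms unfolding schwartz_continuous_def by metis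

lemma schwartz_continuous_compose:
  assumes A: "schwartz_continuous A" and B: "schwartz_continuous B"
  shows "schwartz_continuous (\<lambda>f. A (B f))"
  unfolding schwartz_continuous_def
proof (intro conjI ballI allI)
  fix N
  obtain C M where C: "0 \<le> C" "\<And>f. f \<in> schwartz \<Longrightarrow> schwartz_norm N (A f) \<le> C * schwartz_norm M f"
    using schwartz_continuous_norm[OF A] by blast
  obtain D L where D: "0 \<le> D" "\<And>f. f \<in> schwartz \<Longrightarrow> schwartz_norm M (B f) \<le> D * schwartz_norm L f"
    using schwartz_continuous_norm[OF B] by blast
  have "schwartz_norm N (A (B f)) \<le> C * D * schwartz_norm L f" if "f \<in> schwartz" for f
    using C(2)[OF schwartz_continuousD[OF B that]] mult_left_mono[OF D(2)[OF that] C(1)] by simp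
  then show "\<exists>C\<ge>0. \<exists>M. \<forall>f\<in>schwartz. schwartz_norm N (A (B f)) \<le> C * schwartz_norm M f"
    using C(1) D(1) by (intro exI[of _ "C * D"]) auto
qed (use assms in \<open>auto simp: schwartz_continuousD\<close>)

lemma schwartz_continuous_id: "schwartz_continuous (\<lambda>f. f)"
  unfolding schwartz_continuous_def by (auto intro!: exI[of _ "1::real"])

lemma schwartz_continuous_partial: "schwartz_continuous (partial k)"
proof (rule schwartz_continuousI)
  fix N ks
  have "(1 + norm x) ^ N * norm (partials ks (partial k f) x) \<le> 1 * schwartz_norm (max N (Suc (length ks))) f"
    if "f \<in> schwartz" for f x
    using schwartz_norm_bound[OF that, of N "max N (Suc (length ks))" "ks @ [k]" x]
    by (simp add: partials_append partials_Cons)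
  then show "\<exists>C\<ge>0. \<exists>M. \<forall>f\<in>schwartz. \<forall>x.
        (1 + norm x) ^ N * norm (partials ks (partial k f) x) \<le> C * schwartz_norm M f"
    by (metis zero_le_one)
qed (auto intro: smooth_partial schwartz_smooth)

text \<open>The constants are uniform over a family of multipliers because
  \<open>cutoff_convergence\<close> applies this to difference quotients indexed by the scale in
  \<open>{0<..1}\<close>. A single multiplier is a family with one member.\<close>

lemma leibniz_sum_bound:
  assumes g: "\<And>ks. \<exists>C M. \<forall>i\<in>I. \<forall>x. norm (partials ks (g i) x) \<le> C * (1 + norm x) ^ M"
  shows "\<exists>C\<ge>0. \<exists>M. \<forall>i\<in>I. \<forall>f\<in>schwartz. \<forall>x.
        (1 + norm x) ^ N * norm (leibniz_sum L (g i) f x) \<le> C * schwartz_norm M f"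
proof (induction L)
  case Nil
  show ?case by (auto simp: leibniz_sum_def intro!: exI[of _ "0::real"])
next
  case (Cons ab L)
  obtain a b where ab: "ab = (a, b)" by fastforce
  obtain C M where C: "0 \<le> C" and CM: "\<And>i f x. i \<in> I \<Longrightarrow> f \<in> schwartz \<Longrightarrow>
        (1 + norm x) ^ N * norm (leibniz_sum L (g i) f x) \<le> C * schwartz_norm M f"
    using Cons.IH by blast
  obtain D' m where "\<And>i x. i \<in> I \<Longrightarrow> norm (partials a (g i) x) \<le> D' * (1 + norm x) ^ m"
    using g[of a] by blast
  then have D: "norm (partials a (g i) x) \<le> \<bar>D'\<bar> * (1 + norm x) ^ m" if "i \<in> I" for i x
    using that by (force intro: order_trans mult_right_mono)
  define D where "D = \<bar>D'\<bar>"
  have D0: "0 \<le> D" by (simp add: D_def)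
  define K where "K = max M (max (N + m) (length b))"
  define c where "c = C * real (card {ks :: 3 list. length ks \<le> M}) + D"
  have "(1 + norm x) ^ N * norm (leibniz_sum (ab # L) (g i) f x) \<le> c * schwartz_norm K f"
    if i: "i \<in> I" and f: "f \<in> schwartz" for i f x
  proof -
    have "(1 + norm x) ^ N * norm (leibniz_sum (ab # L) (g i) f x) \<le>
       (1 + norm x) ^ N * norm (leibniz_sum L (g i) f x) + (1 + norm x) ^ N * norm (partials a (g i) x * partials b f x)"
      unfolding distrib_left[symmetric] leibniz_sum_def
      by (intro mult_left_mono) (auto simp: ab add.commute norm_triangle_ineq)
    also have "(1 + norm x) ^ N * norm (leibniz_sum L (g i) f x) \<le> C * schwartz_norm M f"
      by (rule CM[OF i f])
    also have "\<dots> \<le> C * (real (card {ks :: 3 list. length ks \<le> M}) * schwartz_norm K f)"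
      using C by (intro mult_left_mono schwartz_norm_mono f) (auto simp: K_def)
    also have "(1 + norm x) ^ N * norm (partials a (g i) x * partials b f x) \<le>
       (1 + norm x) ^ N * (D * (1 + norm x) ^ m * norm (partials b f x))"
      unfolding norm_mult by (intro mult_left_mono mult_right_mono D[OF i, folded D_def]) auto
    also have "\<dots> = D * ((1 + norm x) ^ (N + m) * norm (partials b f x))"
      by (simp add: power_add)
    also have "\<dots> \<le> D * schwartz_norm K f"
      by (intro mult_left_mono schwartz_norm_bound f D0) (auto simp: K_def)
    finally show ?thesis by (simp add: c_def algebra_simps)
  qed
  moreover have "0 \<le> c" using C D0 by (simp add: c_def)
  ultimately show ?case by blast
qed

lemma schwartz_continuous_mult:
  assumes g: "tame g"
  shows "schwartz_continuous (\<lambda>f x. g x * f x)"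
proof (rule schwartz_continuousI)
  have sg: "smooth g" using g by (simp add: tame_def)
  show "smooth (\<lambda>x. g x * f x)" if "f \<in> schwartz" for f
    by (intro smooth_mult sg schwartz_smooth that)
  show "\<exists>C\<ge>0. \<exists>M. \<forall>f\<in>schwartz. \<forall>x.
        (1 + norm x) ^ N * norm (partials ks (\<lambda>x. g x * f x) x) \<le> C * schwartz_norm M f" for N ks
    using leibniz_sum_bound[of "{g}" "\<lambda>g. g" N "leibniz_splits ks"] g
    by (simp add: partials_mult[OF sg schwartz_smooth] tame_def)
qed

lemma schwartz_cmult: "f \<in> schwartz \<Longrightarrow> (\<lambda>x. c * f x) \<in> schwartz"
  using schwartz_continuousD[OF schwartz_continuous_mult[OF tame_const[of c]]] .

lemma schwartz_diff: 
  assumes "f \<in> schwartz" "g \<in> schwartz" shows "(\<lambda>x. f x - g x) \<in> schwartz"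
  using schwartz_add[OF assms(1) schwartz_cmult[OF assms(2), of "-1"]] by simp

lemma schwartz_continuous_scaled_coordinate:
  "schwartz_continuous (\<lambda>f x. c * of_real (x $ k) * f x)"
  using schwartz_continuous_compose[OF schwartz_continuous_mult[OF tame_const[of c]]
      schwartz_continuous_mult[OF tame_coordinate[of k]]]
  by (simp add: mult.assoc)

lemma schwartz_decay4:
  assumes "f \<in> schwartz"
  shows "norm (f x) \<le> schwartz_norm 4 f * (1 / (1 + norm x) ^ 4)"
proof -
  have "0 < 1 + norm x" by (simp add: add_pos_nonneg)
  then have "0 < (1 + norm x) ^ 4" by (rule zero_less_power)
  then show ?thesis
    using schwartz_norm_bound[OF assms, of 4 4 "[]" x] by (simp add: field_simps)
qed

lemma schwartz_borel: "f \<in> schwartz \<Longrightarrow> f \<in> borel_measurable borel"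
  by (intro smooth_borel schwartz_smooth)

lemma schwartz_integrable:
  assumes "f \<in> schwartz"
  shows "integrable lborel f"
  by (rule Bochner_Integration.integrable_bound[OF integrable_mult_right[OF integrable_decay4, of "schwartz_norm 4 f"]])
     (use schwartz_decay4[OF assms] assms in \<open>auto simp: schwartz_norm_nonneg schwartz_borel\<close>)

lemma schwartz_integral_norm_le:
  assumes "f \<in> schwartz"
  shows "(LINT x|lborel. norm (f x)) \<le> schwartz_norm 4 f * (LINT x|lborel. 1 / (1 + norm (x::real^3)) ^ 4)"
  unfolding integral_mult_right_zero[symmetric]
  by (rule integral_mono[OF integrable_norm[OF schwartz_integrable[OF assms]]
        integrable_mult_right[OF integrable_decay4] schwartz_decay4[OF assms]])

subsection \<open>The Fourier transform on the Schwartz space\<close>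

lemma integral_translate:
  fixes f :: "real^3 \<Rightarrow> complex"
  shows "(LINT x|lborel. f (c + x)) = (LINT x|lborel. f x)"
proof (cases "f \<in> borel_measurable borel")
  case True
  have "(LINT x|lborel. f x) = (LINT x|distr lborel borel ((+) c). f x)"
    by (simp add: lborel_distr_plus)
  also have "\<dots> = (LINT x|lborel. f (c + x))"
    using True by (intro integral_distr) auto
  finally show ?thesis ..
next
  \<comment> \<open>If \<open>f\<close> is not measurable, neither is its translate, and both
    integrals are 0 by convention.\<close>
  case False
  have "(\<lambda>x. f (c + x)) \<notin> borel_measurable borel"
  proof
    assume "(\<lambda>x. f (c + x)) \<in> borel_measurable borel"
    then have "(\<lambda>x. f (c + x)) \<circ> (\<lambda>x. x - c) \<in> borel_measurable borel"
      by (rule measurable_comp[rotated]) simp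
    then show False using False by (simp add: comp_def)
  qed
  then show ?thesis using False by (metis borel_measurable_integrable measurable_lborel2 not_integrable_integral_eq)
qed

text \<open>Majorant for the limit in \<open>integral_partial_eq_0\<close>. A shift by at most 1
  changes \<open>1 + norm x\<close> by at most the factor 2, hence
  \<open>16 = 2 ^ 4\<close>.\<close>

lemma schwartz_difference_quotient:
  assumes f: "f \<in> schwartz" and h: "0 < h" "h \<le> 1"
  shows "norm ((f (x + h *\<^sub>R axis k 1) - f x) /\<^sub>R h)
    \<le> 16 * schwartz_norm 4 (partial k f) * (1 / (1 + norm x) ^ 4)"
proof -
  let ?B = "16 * schwartz_norm 4 (partial k f) * (1 / (1 + norm x) ^ 4)"
  have pf: "partial k f \<in> schwartz" by (rule schwartz_continuousD[OF schwartz_continuous_partial f])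
  have "norm (f (x + h *\<^sub>R axis k 1) - f (x + 0 *\<^sub>R axis k 1)) \<le> ?B * norm (h - 0)"
  proof (rule differentiable_bound[where S="{0..h}"])
    fix t assume t: "t \<in> {0..h}"
    have l: "((\<lambda>t. x + t *\<^sub>R axis k 1) has_derivative (\<lambda>s. s *\<^sub>R axis k 1)) (at t within {0..h})"
      by (auto intro!: derivative_eq_intros)
    from diff_chain_within[OF l has_derivative_at_withinI[OF derivative_partials[OF schwartz_smooth[OF f], of "[]"]]]
    show "((\<lambda>t. f (x + t *\<^sub>R axis k 1)) has_derivative (\<lambda>s. s *\<^sub>R partial k f (x + t *\<^sub>R axis k 1))) (at t within {0..h})"
      by (simp add: comp_def axis_def if_distrib[of "\<lambda>c. (_ * c) *\<^sub>R _"] if_distrib[of "\<lambda>c. c *\<^sub>R _"] cong: if_cong)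
    have "1 + norm x \<le> 2 * (1 + norm (x + t *\<^sub>R axis k 1))"
    proof -
      define w :: "real^3" where "w = t *\<^sub>R axis k 1"
      have "norm w \<le> 1" using t h by (simp add: w_def)
      moreover have "norm x \<le> norm (x + w) + norm w"
        by (metis add_diff_cancel_right' norm_triangle_ineq4)
      ultimately have "1 + norm x \<le> 2 * (1 + norm (x + w))"
        using norm_ge_zero[of "x + w"] by argo
      then show ?thesis by (simp add: w_def)
    qed
    then have "(1 + norm x) ^ 4 \<le> (2 * (1 + norm (x + t *\<^sub>R axis k 1))) ^ 4"
      by (intro power_mono) auto
    then have le: "(1 + norm x) ^ 4 \<le> 16 * (1 + norm (x + t *\<^sub>R axis k 1)) ^ 4"
      unfolding power_mult_distrib by simp
    have pos: "0 < (1 + norm y) ^ 4" for y :: "real^3" by (intro zero_less_power) (simp add: add_pos_nonneg)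
    have "onorm (\<lambda>s. s *\<^sub>R partial k f (x + t *\<^sub>R axis k 1)) = norm (partial k f (x + t *\<^sub>R axis k 1))"
      using onorm_scaleR_left[OF bounded_linear_ident, of "partial k f (x + t *\<^sub>R axis k 1)"]
      by (simp add: onorm_id[unfolded id_def])
    also have "\<dots> \<le> schwartz_norm 4 (partial k f) * (1 / (1 + norm (x + t *\<^sub>R axis k 1)) ^ 4)"
      by (rule schwartz_decay4[OF pf])
    also have "\<dots> \<le> schwartz_norm 4 (partial k f) * (16 / (1 + norm x) ^ 4)"
      using le pos[of x] pos[of "x + t *\<^sub>R axis k 1"]
      by (intro mult_left_mono schwartz_norm_nonneg[OF pf]) (simp add: field_simps)
    finally show "onorm (\<lambda>s. s *\<^sub>R partial k f (x + t *\<^sub>R axis k 1)) \<le> ?B" by (simp add: mult.commute)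
  qed (use h in auto)
  then have "norm (f (x + h *\<^sub>R axis k 1) - f x) \<le> ?B * h" using h by simp
  then have "norm (f (x + h *\<^sub>R axis k 1) - f x) / h \<le> ?B" using h by (simp only: pos_divide_le_eq)
  moreover have "norm ((f (x + h *\<^sub>R axis k 1) - f x) /\<^sub>R h) = norm (f (x + h *\<^sub>R axis k 1) - f x) / h"
    using h by (simp add: divide_inverse mult.commute)
  ultimately show ?thesis by simp
qed

text \<open>By translation invariance every difference quotient has integral 0, and dominated
  convergence passes this on to the derivative. Neither Fubini nor one-dimensional integration is
  involved.\<close>

lemma integral_partial_eq_0:
  assumes f: "f \<in> schwartz"
  shows "(LINT x|lborel. partial k f x) = 0"
proof -
  have pf: "partial k f \<in> schwartz" by (rule schwartz_continuousD[OF schwartz_continuous_partial f])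
  define h where "h n = 1 / real (Suc n)" for n
  have h: "0 < h n" "h n \<le> 1" for n by (auto simp: h_def)
  define s where "s n x = (f (x + h n *\<^sub>R axis k 1) - f x) /\<^sub>R h n" for n x
  have fb [measurable]: "f \<in> borel_measurable borel" "partial k f \<in> borel_measurable borel"
    using f pf by (auto intro: schwartz_borel)
  have fi: "integrable lborel f" by (rule schwartz_integrable[OF f])
  have fi': "integrable lborel (\<lambda>x. f (x + c))" for c
  proof -
    have "integrable (distr lborel borel ((+) c)) f" using fi by (simp add: lborel_distr_plus)
    then show ?thesis by (subst (asm) integrable_distr_eq) (auto simp: add.commute)
  qed
  have translate: "(LINT x|lborel. f (x + c)) = (LINT x|lborel. f x)" for c
    using integral_translate[of f c] by (simp add: add.commute)
  have zero: "(LINT x|lborel. s n x) = 0" for n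
    unfolding s_def by (simp add: fi fi' translate)
  have "(\<lambda>n. LINT x|lborel. s n x) \<longlonglongrightarrow> (LINT x|lborel. partial k f x)"
  proof (rule integral_dominated_convergence)
    show "integrable lborel (\<lambda>x::real^3. 16 * schwartz_norm 4 (partial k f) * (1 / (1 + norm x) ^ 4))"
      by (intro integrable_mult_right integrable_decay4)
    show "AE x in lborel. norm (s n x) \<le> 16 * schwartz_norm 4 (partial k f) * (1 / (1 + norm x) ^ 4)" for n
      unfolding s_def by (intro AE_I2 schwartz_difference_quotient f h)
    show "s n \<in> borel_measurable lborel" for n unfolding s_def by measurable
    show "AE x in lborel. (\<lambda>n. s n x) \<longlonglongrightarrow> partial k f x"
    proof (rule AE_I2)
      fix x :: "real^3"
      have l: "((\<lambda>t. x + t *\<^sub>R axis k 1) has_derivative (\<lambda>s. s *\<^sub>R axis k 1)) (at 0)"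
        by (auto intro!: derivative_eq_intros)
      have "((\<lambda>t. f (x + t *\<^sub>R axis k 1)) has_derivative (\<lambda>s. s *\<^sub>R partial k f x)) (at 0)"
        using diff_chain_at[OF l, of f "\<lambda>h. \<Sum>k\<in>UNIV. h $ k *\<^sub>R partial k f x"]
          derivative_partials[OF schwartz_smooth[OF f], of "[]" x]
        by (simp add: comp_def axis_def if_distrib[of "\<lambda>c. (_ * c) *\<^sub>R _"] if_distrib[of "\<lambda>c. c *\<^sub>R _"] cong: if_cong)
      then have "((\<lambda>t. norm (f (x + t *\<^sub>R axis k 1) - f x - t *\<^sub>R partial k f x) / norm t) \<longlongrightarrow> 0) (at 0)"
        by (simp add: has_derivative_at)
      then have "((\<lambda>t. norm ((f (x + t *\<^sub>R axis k 1) - f x) /\<^sub>R t - partial k f x)) \<longlongrightarrow> 0) (at 0)"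
      proof (rule Lim_transform_eventually)
        show "\<forall>\<^sub>F t in at 0. norm (f (x + t *\<^sub>R axis k 1) - f x - t *\<^sub>R partial k f x) / norm t
           = norm ((f (x + t *\<^sub>R axis k 1) - f x) /\<^sub>R t - partial k f x)"
        proof (intro eventually_at_filter[THEN iffD2] always_eventually allI impI)
          fix t :: real assume "t \<noteq> 0"
          then have "(f (x + t *\<^sub>R axis k 1) - f x) /\<^sub>R t - partial k f x
             = (f (x + t *\<^sub>R axis k 1) - f x - t *\<^sub>R partial k f x) /\<^sub>R t"
            by (simp add: scaleR_diff_right)
          then show "norm (f (x + t *\<^sub>R axis k 1) - f x - t *\<^sub>R partial k f x) / norm t
           = norm ((f (x + t *\<^sub>R axis k 1) - f x) /\<^sub>R t - partial k f x)"
            by (simp only: norm_scaleR) (simp add: field_simps)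
        qed
      qed
      then have lim: "((\<lambda>t. (f (x + t *\<^sub>R axis k 1) - f x) /\<^sub>R t) \<longlongrightarrow> partial k f x) (at 0)"
        by (simp add: tendsto_norm_zero_iff Lim_null[symmetric])
      have "filterlim h (at 0) sequentially"
        unfolding h_def filterlim_at using LIMSEQ_inverse_real_of_nat
        by (auto simp: inverse_eq_divide)
      from filterlim_compose[OF lim this] show "(\<lambda>n. s n x) \<longlonglongrightarrow> partial k f x"
        by (simp add: s_def)
    qed
  qed (auto simp: fb)
  then have "(\<lambda>n. 0) \<longlonglongrightarrow> (LINT x|lborel. partial k f x)" by (simp add: zero)
  then show ?thesis by (simp add: LIMSEQ_const_iff)
qed

section \<open>Characters and the exchange of derivatives with moments\<close>

definition character :: "real^3 \<Rightarrow> real^3 \<Rightarrow> complex" where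
  "character \<xi> x = cis (- (x \<bullet> \<xi>))"

lemma norm_character [simp]: "norm (character \<xi> x) = 1"
  by (simp add: character_def)

lemma character_borel [measurable]: "character \<xi> \<in> borel_measurable borel"
proof -
  have "continuous_on UNIV (character \<xi>)"
    unfolding character_def[abs_def] by (intro continuous_intros)
  then show ?thesis by (rule borel_measurable_continuous_onI)
qed

lemma character_derivative:
  "((\<lambda>x. c * character \<xi> x) has_derivative (\<lambda>h. c * (- \<i> * of_real (h \<bullet> \<xi>) * character \<xi> x))) (at x)"
proof -
  have "((\<lambda>x. - (\<i> * complex_of_real (x \<bullet> \<xi>))) has_derivative (\<lambda>h. - (\<i> * of_real (h \<bullet> \<xi>)))) (at x)"
    by (auto intro!: derivative_eq_intros)
  from has_derivative_mult_right[OF has_derivative_compose[OF this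
      DERIV_exp[THEN has_field_derivative_imp_has_derivative]], of c]
  show ?thesis
    by (simp add: character_def[abs_def] cis_conv_exp mult_ac)
qed

lemma partial_character:
  "partial k (\<lambda>x. c * character \<xi> x) = (\<lambda>x. (c * (- \<i> * of_real (\<xi> $ k))) * character \<xi> x)"
  using partial_has_derivative[OF character_derivative] by (auto simp: inner_axis' mult_ac)

lemma partials_character: "\<exists>c. partials ks (character \<xi>) = (\<lambda>x. c * character \<xi> x)"
proof (induction ks)
  case Nil
  show ?case by (auto intro: exI[of _ 1])
next
  case (Cons k ks)
  then obtain c where "partials ks (character \<xi>) = (\<lambda>x. c * character \<xi> x)" by blast
  then show ?case
    by (intro exI[of _ "c * (- \<i> * of_real (\<xi> $ k))"]) (simp add: partials_Cons partial_character)
qed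

lemma tame_character: "tame (character \<xi>)"
  unfolding tame_def smooth_def
proof (intro conjI allI)
  fix ks
  obtain c where c: "partials ks (character \<xi>) = (\<lambda>x. c * character \<xi> x)"
    using partials_character by blast
  show "partials ks (character \<xi>) differentiable (at x)" for x
    unfolding c using character_derivative by (rule differentiableI)
  have "norm (partials ks (character \<xi>) x) \<le> norm c * (1 + norm x) ^ 0" for x
    by (simp add: c norm_mult)
  then show "\<exists>C M. \<forall>x. norm (partials ks (character \<xi>) x) \<le> C * (1 + norm x) ^ M" by blast
qed

lemma fourier_character: "fourier f \<xi> = (1 / (2 * pi) ^ 3) *\<^sub>R (LINT x|lborel. character \<xi> x * f x)"
  by (simp add: fourier_def character_def)

text \<open>Integration by parts: the derivative of \<open>character \<xi> x * f x\<close> has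
  integral 0.\<close>

lemma fourier_partial:
  assumes f: "f \<in> schwartz"
  shows "fourier (partial k f) \<xi> = \<i> * of_real (\<xi> $ k) * fourier f \<xi>"
proof -
  note sc = tame_character[of \<xi>, unfolded tame_def, THEN conjunct1]
  have ef: "(\<lambda>x. character \<xi> x * f x) \<in> schwartz"
    by (rule schwartz_continuousD[OF schwartz_continuous_mult[OF tame_character] f])
  have epf: "(\<lambda>x. character \<xi> x * partial k f x) \<in> schwartz"
    by (rule schwartz_continuousD[OF schwartz_continuous_mult[OF tame_character]
        schwartz_continuousD[OF schwartz_continuous_partial f]])
  have "partial k (\<lambda>x. character \<xi> x * f x) = (\<lambda>x. character \<xi> x * partial k f x - \<i> * of_real (\<xi> $ k) * (character \<xi> x * f x))"
    using partials_mult[OF sc schwartz_smooth[OF f], of "[k]"] partial_character[of k 1 \<xi>]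
    by (auto simp: partials_Cons leibniz_sum_def fun_eq_iff)
  then have "0 = (LINT x|lborel. character \<xi> x * partial k f x - \<i> * of_real (\<xi> $ k) * (character \<xi> x * f x))"
    using integral_partial_eq_0[OF ef, of k] by simp
  also have "\<dots> = (LINT x|lborel. character \<xi> x * partial k f x) - \<i> * of_real (\<xi> $ k) * (LINT x|lborel. character \<xi> x * f x)"
    using schwartz_integrable[OF ef] schwartz_integrable[OF epf] by simp
  finally show ?thesis by (simp add: fourier_character)
qed

lemma norm_cis_Taylor: "norm (cis t - 1 - \<i> * of_real t) \<le> t\<^sup>2"
proof -
  have "norm (cis t - 1 - \<i> * of_real t) \<le> t\<^sup>2 / 2"
    using iexp_approx1[of t 1] by (simp add: cis_conv_exp power2_eq_square diff_diff_eq)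
  then show ?thesis using zero_le_power2[of t] by linarith
qed

definition moment :: "3 \<Rightarrow> (real^3 \<Rightarrow> complex) \<Rightarrow> real^3 \<Rightarrow> complex" where
  "moment k f x = - \<i> * of_real (x $ k) * f x"

lemma schwartz_continuous_moment: "schwartz_continuous (moment k)"
  using schwartz_continuous_scaled_coordinate[of "- \<i>" k] by (simp add: moment_def[abs_def])

text \<open>Instead of differentiating under the integral, the remainder is bounded explicitly: the
  second-order Taylor estimate for \<open>cis\<close> gives an error of at most \<open>K\<close>
  times the square of \<open>norm h\<close>, with \<open>K\<close> built from second moments of
  \<open>f\<close>.\<close>

lemma fourier_derivative:
  assumes f: "f \<in> schwartz"
  shows "(fourier f has_derivative (\<lambda>h. \<Sum>k\<in>UNIV. h $ k *\<^sub>R fourier (moment k f) \<xi>)) (at \<xi>)"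
proof -
  let ?c = "1 / (2 * pi) ^ 3"
  have cf: "(\<lambda>x. character \<xi> x * f x) \<in> schwartz" if "f \<in> schwartz" for f \<xi>
    by (rule schwartz_continuousD[OF schwartz_continuous_mult[OF tame_character] that])
  have mf: "moment k f \<in> schwartz" for k by (rule schwartz_continuousD[OF schwartz_continuous_moment f])
  note int = schwartz_integrable[OF cf[OF f]] schwartz_integrable[OF cf[OF mf]]
  have mmi: "integrable lborel (\<lambda>x. norm (moment k (moment k f) x))" for k
    by (intro integrable_norm schwartz_integrable schwartz_continuousD[OF schwartz_continuous_moment] mf)
  define K where "K = ?c * (\<Sum>k\<in>UNIV. LINT x|lborel. norm (moment k (moment k f) x))"
  define L where "L h = (\<Sum>k\<in>UNIV. h $ k *\<^sub>R fourier (moment k f) \<xi>)" for h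
  have L: "L h = ?c *\<^sub>R (LINT x|lborel. (- \<i> * of_real (x \<bullet> h)) * (character \<xi> x * f x))" for h
  proof -
    have "(LINT x|lborel. (- \<i> * of_real (x \<bullet> h)) * (character \<xi> x * f x)) =
      (LINT x|lborel. (\<Sum>k\<in>UNIV. h $ k *\<^sub>R (character \<xi> x * moment k f x)))"
      by (intro Bochner_Integration.integral_cong)
         (auto simp: moment_def inner_vec_def sum_distrib_left sum_distrib_right sum_negf scaleR_conv_of_real mult_ac)
    also have "\<dots> = (\<Sum>k\<in>UNIV. h $ k *\<^sub>R (LINT x|lborel. character \<xi> x * moment k f x))"
      using int(2) by simp
    finally show ?thesis
      by (simp add: L_def fourier_character scaleR_sum_right)
  qed
  have bound: "norm (fourier f (\<xi> + h) - fourier f \<xi> - L h) \<le> K * (norm h)\<^sup>2" for h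
  proof -
    have Li: "integrable lborel (\<lambda>x. (- \<i> * of_real (x \<bullet> h)) * (character \<xi> x * f x))"
    proof -
      have "integrable lborel (\<lambda>x. \<Sum>k\<in>UNIV. h $ k *\<^sub>R (character \<xi> x * moment k f x))"
        using int(2) by simp
      then show ?thesis
        by (rule back_subst[where P="integrable lborel"])
         (auto simp: moment_def inner_vec_def sum_distrib_left sum_distrib_right sum_negf scaleR_conv_of_real mult_ac)
    qed
    have "fourier f (\<xi> + h) - fourier f \<xi> - L h = ?c *\<^sub>R (LINT x|lborel.
        character (\<xi> + h) x * f x - character \<xi> x * f x - (- \<i> * of_real (x \<bullet> h)) * (character \<xi> x * f x))"
      using int(1) Li by (simp only: L fourier_character Bochner_Integration.integral_diff
          Bochner_Integration.integrable_diff scaleR_diff_right)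
    also have "norm \<dots> \<le> ?c * (LINT x|lborel. (norm h)\<^sup>2 * (\<Sum>k\<in>UNIV. norm (moment k (moment k f) x)))"
      unfolding norm_scaleR
    proof (intro mult_mono)
      show "norm (LINT x|lborel. character (\<xi> + h) x * f x - character \<xi> x * f x - (- \<i> * of_real (x \<bullet> h)) * (character \<xi> x * f x))
         \<le> (LINT x|lborel. (norm h)\<^sup>2 * (\<Sum>k\<in>UNIV. norm (moment k (moment k f) x)))"
      proof (rule order_trans[OF integral_norm_bound integral_mono])
        fix x
        have "character (\<xi> + h) x * f x - character \<xi> x * f x - (- \<i> * of_real (x \<bullet> h)) * (character \<xi> x * f x)
           = (cis (- (x \<bullet> h)) - 1 - \<i> * of_real (- (x \<bullet> h))) * (character \<xi> x * f x)"
          by (simp add: character_def inner_add_right algebra_simps cis_mult)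
        also have "norm \<dots> \<le> (- (x \<bullet> h))\<^sup>2 * norm (f x)"
          using norm_cis_Taylor[of "- (x \<bullet> h)"] by (simp add: norm_mult mult_right_mono)
        also have "\<dots> \<le> ((norm h)\<^sup>2 * (norm x)\<^sup>2) * norm (f x)"
          using Cauchy_Schwarz_ineq2[of x h]
          by (intro mult_right_mono) (auto simp: power_mult_distrib[symmetric] abs_le_square_iff[symmetric] abs_mult mult.commute)
        also have "\<dots> = (norm h)\<^sup>2 * (\<Sum>k\<in>UNIV. norm (moment k (moment k f) x))"
        proof -
          \<comment> \<open>The squares of the three coordinates add up to that of the norm, so the
            diagonal second moments suffice.\<close>
          have "(norm x)\<^sup>2 * norm (f x) = (\<Sum>k\<in>UNIV. norm (moment k (moment k f) x))"
            by (simp add: power2_norm_eq_inner inner_vec_def moment_def norm_mult sum_distrib_right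
                mult.assoc[symmetric])
          then show ?thesis by (simp add: mult.assoc)
        qed
        finally show "norm (character (\<xi> + h) x * f x - character \<xi> x * f x - (- \<i> * of_real (x \<bullet> h)) * (character \<xi> x * f x))
          \<le> (norm h)\<^sup>2 * (\<Sum>k\<in>UNIV. norm (moment k (moment k f) x))" .
      qed (use int Li mmi in auto)
    qed auto
    also have "\<dots> = K * (norm h)\<^sup>2"
      using mmi by (simp add: K_def)
    finally show ?thesis .
  qed
  have "((\<lambda>h. norm (fourier f (\<xi> + h) - fourier f \<xi> - L h) / norm h) \<longlongrightarrow> 0) (at 0)"
  proof (rule Lim_null_comparison)
    show "\<forall>\<^sub>F h in at 0. norm (norm (fourier f (\<xi> + h) - fourier f \<xi> - L h) / norm h) \<le> K * norm h"
      using bound by (auto simp: divide_simps power2_eq_square mult.assoc intro!: always_eventually)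
    have "((\<lambda>h::real^3. K * norm h) \<longlongrightarrow> K * norm (0::real^3)) (at 0)" by (intro tendsto_intros)
    then show "((\<lambda>h::real^3. K * norm h) \<longlongrightarrow> 0) (at 0)" by simp
  qed
  moreover have "bounded_linear L"
    unfolding L_def by (intro bounded_linear_sum bounded_linear_scaleR_const bounded_linear_vec_nth)
  ultimately show ?thesis unfolding L_def by (simp add: has_derivative_at)
qed

lemma partial_fourier: "f \<in> schwartz \<Longrightarrow> partial k (fourier f) = fourier (moment k f)"
  using partial_has_derivative[OF fourier_derivative]
  by (auto simp: axis_def if_distrib[of "\<lambda>c. c *\<^sub>R _"] cong: if_cong)

lemma smooth_fourier: "f \<in> schwartz \<Longrightarrow> smooth (fourier f)"
  by (rule smooth_coinduct[where A="fourier ` schwartz"])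
     (auto intro!: differentiableI[OF fourier_derivative] schwartz_continuousD[OF schwartz_continuous_moment]
       simp: partial_fourier)

lemma norm_fourier_le: "norm (fourier f \<xi>) \<le> (LINT x|lborel. norm (f x))"
proof -
  have "norm (fourier f \<xi>) \<le> (1 / (2 * pi) ^ 3) * (LINT x|lborel. norm (character \<xi> x * f x))"
    unfolding fourier_character norm_scaleR by (intro mult_mono integral_norm_bound) auto
  also have "\<dots> \<le> 1 * (LINT x|lborel. norm (f x))"
    using one_le_power[of "2 * pi" 3] pi_gt3 by (intro mult_mono) (auto simp: norm_mult divide_le_eq)
  finally show ?thesis by simp
qed

text \<open>Each further factor \<open>1 + norm \<xi>\<close> is traded for one derivative of
  \<open>f\<close>, because multiplication of the transform by a coordinate is, up to \<i>, the
  transform of a partial derivative.\<close>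

lemma fourier_decay:
  "\<exists>C\<ge>0. \<exists>M. \<forall>f\<in>schwartz. \<forall>\<xi>. (1 + norm \<xi>) ^ N * norm (fourier f \<xi>) \<le> C * schwartz_norm M f"
proof (induction N)
  case 0
  have "norm (fourier f \<xi>) \<le> (LINT x|lborel. 1 / (1 + norm (x::real^3)) ^ 4) * schwartz_norm 4 f"
    if "f \<in> schwartz" for f \<xi>
    using order_trans[OF norm_fourier_le schwartz_integral_norm_le[OF that]] by (simp add: mult.commute)
  moreover have "0 \<le> (LINT x|lborel. 1 / (1 + norm (x::real^3)) ^ 4)" by simp
  ultimately show ?case by (auto intro!: exI[of _ "LINT x|lborel. 1 / (1 + norm (x::real^3)) ^ 4"])
next
  case (Suc N)
  then obtain C M where C: "0 \<le> C" and
    CM: "\<And>f \<xi>. f \<in> schwartz \<Longrightarrow> (1 + norm \<xi>) ^ N * norm (fourier f \<xi>) \<le> C * schwartz_norm M f"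
    by blast
  have "\<exists>D m. 0 \<le> D \<and> (\<forall>f\<in>schwartz. schwartz_norm M (partial k f) \<le> D * schwartz_norm m f)" for k
    using schwartz_continuous_partial[of k] unfolding schwartz_continuous_def by metis
  then obtain D m where D: "\<And>k. 0 \<le> D k" and
    Dm: "\<And>k f. f \<in> schwartz \<Longrightarrow> schwartz_norm M (partial k f) \<le> D k * schwartz_norm (m k) f"
    by metis
  define J where "J = Max (insert M (range m))"
  define c where "c n = real (card {ks :: 3 list. length ks \<le> n})" for n
  define E where "E = C * c M + (\<Sum>k\<in>UNIV. C * (D k * c (m k)))"
  have E: "0 \<le> E" using C D by (auto simp: E_def c_def intro!: add_nonneg_nonneg sum_nonneg)
  have "(1 + norm \<xi>) ^ Suc N * norm (fourier f \<xi>) \<le> E * schwartz_norm J f" if f: "f \<in> schwartz" for f \<xi>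
  proof -
    have pf: "partial k f \<in> schwartz" for k by (rule schwartz_continuousD[OF schwartz_continuous_partial f])
    have mono: "schwartz_norm n f \<le> c n * schwartz_norm J f" if "n \<in> insert M (range m)" for n
    proof -
      have "n \<le> J" unfolding J_def using that by (intro Max_ge) simp_all
      then show ?thesis unfolding c_def by (intro schwartz_norm_mono f)
    qed
    have "(1 + norm \<xi>) ^ Suc N * norm (fourier f \<xi>) = (1 + norm \<xi>) ^ N * ((1 + norm \<xi>) * norm (fourier f \<xi>))"
      by simp
    also have "\<dots> \<le> (1 + norm \<xi>) ^ N * (norm (fourier f \<xi>) + (\<Sum>k\<in>UNIV. norm (fourier (partial k f) \<xi>)))"
    proof (intro mult_left_mono)
      have "norm \<xi> * norm (fourier f \<xi>) \<le> (\<Sum>k\<in>UNIV. \<bar>\<xi> $ k\<bar>) * norm (fourier f \<xi>)"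
        by (intro mult_right_mono norm_le_l1_cart) auto
      then show "(1 + norm \<xi>) * norm (fourier f \<xi>) \<le> norm (fourier f \<xi>) + (\<Sum>k\<in>UNIV. norm (fourier (partial k f) \<xi>))"
        by (simp add: fourier_partial[OF f] norm_mult sum_distrib_right distrib_right)
    qed simp
    also have "\<dots> = (1 + norm \<xi>) ^ N * norm (fourier f \<xi>) + (\<Sum>k\<in>UNIV. (1 + norm \<xi>) ^ N * norm (fourier (partial k f) \<xi>))"
      by (simp add: distrib_left sum_distrib_left)
    also have "\<dots> \<le> C * schwartz_norm M f + (\<Sum>k\<in>UNIV. C * schwartz_norm M (partial k f))"
      by (intro add_mono sum_mono CM f pf)
    also have "\<dots> \<le> C * (c M * schwartz_norm J f) + (\<Sum>k\<in>UNIV. C * (D k * (c (m k) * schwartz_norm J f)))"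
      by (intro add_mono sum_mono mult_left_mono C mono order_trans[OF Dm[OF f]] D) auto
    also have "\<dots> = E * schwartz_norm J f"
      by (simp add: E_def distrib_right sum_distrib_right mult.assoc)
    finally show ?thesis .
  qed
  with E show ?case by blast
qed

lemma schwartz_continuous_fourier: "schwartz_continuous fourier"
proof (rule schwartz_continuousI)
  fix N ks
  \<comment> \<open>\<open>A\<close> is the composition of the moments along \<open>ks\<close>. Thus
    the weighted derivatives of \<open>fourier f\<close> are covered by the decay estimate for
    \<open>fourier (A f)\<close>.\<close>
  have "\<exists>A. schwartz_continuous A \<and> (\<forall>f\<in>schwartz. partials ks (fourier f) = fourier (A f))"
  proof (induction ks)
    case Nil
    show ?case using schwartz_continuous_id by auto
  next
    case (Cons k ks)
    then obtain A where "schwartz_continuous A" "\<And>f. f \<in> schwartz \<Longrightarrow> partials ks (fourier f) = fourier (A f)"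
      by blast
    then show ?case
      by (intro exI[of _ "\<lambda>f. moment k (A f)"])
         (auto simp: partials_Cons partial_fourier schwartz_continuousD
           intro: schwartz_continuous_compose schwartz_continuous_moment)
  qed
  then obtain A where A: "schwartz_continuous A" "\<And>f. f \<in> schwartz \<Longrightarrow> partials ks (fourier f) = fourier (A f)"
    by blast
  obtain C M where C: "0 \<le> C" and
    CM: "\<And>f \<xi>. f \<in> schwartz \<Longrightarrow> (1 + norm \<xi>) ^ N * norm (fourier f \<xi>) \<le> C * schwartz_norm M f"
    using fourier_decay[of N] by blast
  obtain D L where D: "0 \<le> D" "\<And>f. f \<in> schwartz \<Longrightarrow> schwartz_norm M (A f) \<le> D * schwartz_norm L f"
    using schwartz_continuous_norm[OF A(1)] by blast
  have "(1 + norm \<xi>) ^ N * norm (partials ks (fourier f) \<xi>) \<le> (C * D) * schwartz_norm L f"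
    if f: "f \<in> schwartz" for f \<xi>
    using CM[OF schwartz_continuousD[OF A(1) f], of \<xi>] mult_left_mono[OF D(2)[OF f] C]
    by (simp add: A(2)[OF f])
  moreover have "0 \<le> C * D" using C D by simp
  ultimately show "\<exists>C\<ge>0. \<exists>M. \<forall>f\<in>schwartz. \<forall>x.
      (1 + norm x) ^ N * norm (partials ks (fourier f) x) \<le> C * schwartz_norm M f"
    by blast
qed (rule smooth_fourier)

subsection \<open>Fourier inversion\<close>

lemma integral_affine:
  fixes f :: "real^3 \<Rightarrow> complex"
  assumes [measurable]: "f \<in> borel_measurable borel" and c: "c \<noteq> 0"
  shows "(LINT x|lborel. f x) = \<bar>c\<bar> ^ 3 *\<^sub>R (LINT x|lborel. f (t + c *\<^sub>R x))"
proof -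
  have "(LINT x|lborel. f x) = (LINT x|density (distr lborel borel (\<lambda>x. t + c *\<^sub>R x)) (\<lambda>_. ennreal (\<bar>c\<bar> ^ 3)). f x)"
    using lborel_affine[OF c, of t] by simp
  also have "\<dots> = (LINT x|distr lborel borel (\<lambda>x. t + c *\<^sub>R x). \<bar>c\<bar> ^ 3 *\<^sub>R f x)"
    by (rule integral_density) auto
  also have "\<dots> = (LINT x|lborel. \<bar>c\<bar> ^ 3 *\<^sub>R f (t + c *\<^sub>R x))"
    by (rule integral_distr) auto
  finally show ?thesis by simp
qed

lemma integrable_affine:
  fixes f :: "real^3 \<Rightarrow> 'a :: {banach, second_countable_topology}"
  assumes f: "integrable lborel f" and c: "c \<noteq> 0"
  shows "integrable lborel (\<lambda>x. f (t + c *\<^sub>R x))"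
proof -
  have [measurable]: "f \<in> borel_measurable borel" using borel_measurable_integrable[OF f] by simp
  have "integrable (density (distr lborel borel (\<lambda>x. t + c *\<^sub>R x)) (\<lambda>_. ennreal (\<bar>c\<bar> ^ 3))) f"
    using f lborel_affine[OF c, of t] by simp
  then have "integrable (distr lborel borel (\<lambda>x. t + c *\<^sub>R x)) (\<lambda>x. \<bar>c\<bar> ^ 3 *\<^sub>R f x)"
    by (subst (asm) integrable_density) auto
  then have "integrable lborel (\<lambda>x. \<bar>c\<bar> ^ 3 *\<^sub>R f (t + c *\<^sub>R x))"
    by (subst (asm) integrable_distr_eq) auto
  from integrable_scaleR_right[OF this, of "inverse (\<bar>c\<bar> ^ 3)"] show ?thesis using c by simp
qed

text \<open>Lebesgue measure is the image of a product measure over \<open>Basis\<close>, which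
  reduces the Gaussian integral in space to the one on the line.\<close>

lemma product_Basis_integral:
  fixes f :: "real^3 \<Rightarrow> real \<Rightarrow> complex"
  assumes f: "\<And>b. b \<in> Basis \<Longrightarrow> integrable lborel (f b)"
  shows "integrable lborel (\<lambda>x. \<Prod>b\<in>Basis. f b (x \<bullet> b))"
    and "(LINT x|lborel. (\<Prod>b\<in>Basis. f b (x \<bullet> b))) = (\<Prod>b\<in>Basis. LINT t|lborel. f b t)"
proof -
  interpret product_sigma_finite "\<lambda>_ :: real^3. lborel :: real measure"
    by standard
  let ?T = "\<lambda>g. \<Sum>b\<in>Basis. g b *\<^sub>R (b :: real^3)"
  let ?M = "\<Pi>\<^sub>M b\<in>(Basis :: (real^3) set). (lborel :: real measure)"
  have [measurable]: "b \<in> Basis \<Longrightarrow> f b \<in> borel_measurable borel" for b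
    using borel_measurable_integrable[OF f] by simp
  have T: "?T \<in> measurable ?M borel" by measurable
  have m: "(\<lambda>x. \<Prod>b\<in>Basis. f b (x \<bullet> b)) \<in> borel_measurable borel" by measurable
  have eq: "(\<Prod>b\<in>Basis. f b (?T g \<bullet> b)) = (\<Prod>b\<in>Basis. f b (g b))" for g
    by (intro prod.cong refl) (simp add: inner_sum_left inner_Basis if_distrib[of "\<lambda>x. _ * x"] cong: if_cong)
  have i: "integrable ?M (\<lambda>g. \<Prod>b\<in>Basis. f b (g b))"
    by (rule product_integrable_prod) (auto intro: f)
  show "integrable lborel (\<lambda>x. \<Prod>b\<in>Basis. f b (x \<bullet> b))"
    unfolding lborel_eq[where 'a="real^3"] using i T m by (subst integrable_distr_eq) (auto simp: eq)
  show "(LINT x|lborel. (\<Prod>b\<in>Basis. f b (x \<bullet> b))) = (\<Prod>b\<in>Basis. LINT t|lborel. f b t)"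
    unfolding lborel_eq[where 'a="real^3"] using T m
    by (subst integral_distr) (auto simp: eq intro!: product_integral_prod f)
qed

section \<open>Gaussian integrals and regularised inversion\<close>

definition gauss :: "real^3 \<Rightarrow> complex" where
  "gauss y = of_real (exp (- (norm y)\<^sup>2 / 2))"

lemma gauss_borel [measurable]: "gauss \<in> borel_measurable borel"
  unfolding gauss_def[abs_def] by measurable

text \<open>This is the characteristic function of the standard normal distribution, multiplied by
  \<open>sqrt (2 * pi)\<close> to remove the normalisation of the density.\<close>

lemma gaussian_1d:
  fixes t :: real
  shows "integrable lborel (\<lambda>x. of_real (exp (- x\<^sup>2 / 2)) * cis (t * x))"
    and "(LINT x|lborel. of_real (exp (- x\<^sup>2 / 2)) * cis (t * x)) = of_real (sqrt (2 * pi) * exp (- t\<^sup>2 / 2))"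
proof -
  have d: "of_real (exp (- x\<^sup>2 / 2)) * cis (t * x) = sqrt (2 * pi) *\<^sub>R (std_normal_density x *\<^sub>R iexp (t * x))" for x
    by (simp add: std_normal_density_def cis_conv_exp scaleR_conv_of_real)
  have i: "integrable lborel (\<lambda>x. std_normal_density x *\<^sub>R iexp (t * x))"
    by (rule Bochner_Integration.integrable_bound[OF integrable_std_normal_moment[of 0]])
      (auto simp: norm_mult)
  then show "integrable lborel (\<lambda>x. of_real (exp (- x\<^sup>2 / 2)) * cis (t * x))"
    unfolding d by (rule integrable_scaleR_right)
  have "char std_normal_distribution t = (LINT x|lborel. std_normal_density x *\<^sub>R iexp (t * x))"
    unfolding char_def by (subst integral_density) auto
  then have "(LINT x|lborel. std_normal_density x *\<^sub>R iexp (t * x)) = of_real (exp (- t\<^sup>2 / 2))"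
    using char_std_normal_distribution by (simp add: fun_eq_iff)
  then show "(LINT x|lborel. of_real (exp (- x\<^sup>2 / 2)) * cis (t * x)) = of_real (sqrt (2 * pi) * exp (- t\<^sup>2 / 2))"
    unfolding d by (simp add: scaleR_conv_of_real)
qed

lemma gauss_character:
  shows "integrable lborel (\<lambda>x. gauss x * cis (z \<bullet> x))"
    and "(LINT x|lborel. gauss x * cis (z \<bullet> x)) = of_real (sqrt (2 * pi) ^ 3) * gauss z"
proof -
  have sq: "(norm x)\<^sup>2 = (\<Sum>b\<in>Basis. (x \<bullet> b)\<^sup>2)" for x :: "real^3"
    unfolding power2_norm_eq_inner by (subst euclidean_inner) (simp add: power2_eq_square)
  have g: "gauss x = (\<Prod>b\<in>Basis. of_real (exp (- (x \<bullet> b)\<^sup>2 / 2)))" for x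
    by (simp add: gauss_def sq sum_negf[symmetric] sum_divide_distrib exp_sum del: of_real_exp flip: of_real_prod)
  have c: "cis (z \<bullet> x) = (\<Prod>b\<in>Basis. cis ((z \<bullet> b) * (x \<bullet> b)))" for x
    by (simp add: euclidean_inner[of z x] cis_conv_exp exp_sum[symmetric] sum_distrib_left)
  have eq: "gauss x * cis (z \<bullet> x) = (\<Prod>b\<in>Basis. of_real (exp (- (x \<bullet> b)\<^sup>2 / 2)) * cis ((z \<bullet> b) * (x \<bullet> b)))" for x
    by (simp only: g c prod.distrib)
  show "integrable lborel (\<lambda>x. gauss x * cis (z \<bullet> x))"
    unfolding eq by (rule product_Basis_integral(1)) (rule gaussian_1d)
  have "(LINT x|lborel. gauss x * cis (z \<bullet> x)) = (\<Prod>b\<in>(Basis::(real^3) set). of_real (sqrt (2 * pi) * exp (- (z \<bullet> b)\<^sup>2 / 2)))"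
    unfolding eq by (subst product_Basis_integral(2)[OF gaussian_1d(1)]) (simp only: gaussian_1d(2))
  then show "(LINT x|lborel. gauss x * cis (z \<bullet> x)) = of_real (sqrt (2 * pi) ^ 3) * gauss z"
    by (simp add: g prod.distrib)
qed

lemma gauss_integrable: "integrable lborel gauss"
  using gauss_character(1)[of 0] by simp

lemma integral_gauss: "(LINT x|lborel. gauss x) = of_real (sqrt (2 * pi) ^ 3)"
  using gauss_character(2)[of 0] by (simp add: gauss_def)

lemma norm_gauss_le: "norm (gauss x) \<le> 1"
  by (simp add: gauss_def)

lemma gauss_scaled_character:
  assumes e: "e > 0"
  shows "(LINT \<xi>|lborel. gauss (e *\<^sub>R \<xi>) * cis (z \<bullet> \<xi>)) = of_real (sqrt (2 * pi) ^ 3 / e ^ 3) * gauss (z /\<^sub>R e)"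
proof -
  have "(LINT \<xi>|lborel. gauss \<xi> * cis ((z /\<^sub>R e) \<bullet> \<xi>)) = \<bar>e\<bar> ^ 3 *\<^sub>R (LINT \<xi>|lborel. gauss (0 + e *\<^sub>R \<xi>) * cis ((z /\<^sub>R e) \<bullet> (0 + e *\<^sub>R \<xi>)))"
  proof (rule integral_affine)
    have "(\<lambda>\<xi>. cis ((z /\<^sub>R e) \<bullet> \<xi>)) \<in> borel_measurable borel"
      by (intro borel_measurable_continuous_onI continuous_intros)
    then show "(\<lambda>\<xi>. gauss \<xi> * cis ((z /\<^sub>R e) \<bullet> \<xi>)) \<in> borel_measurable borel" by measurable
  qed (use e in simp)
  also have "(\<lambda>\<xi>. gauss (0 + e *\<^sub>R \<xi>) * cis ((z /\<^sub>R e) \<bullet> (0 + e *\<^sub>R \<xi>))) = (\<lambda>\<xi>. gauss (e *\<^sub>R \<xi>) * cis (z \<bullet> \<xi>))"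
    using e by (simp add: mult.assoc[symmetric])
  finally have "of_real (sqrt (2 * pi) ^ 3) * gauss (z /\<^sub>R e) = e ^ 3 *\<^sub>R (LINT \<xi>|lborel. gauss (e *\<^sub>R \<xi>) * cis (z \<bullet> \<xi>))"
    unfolding gauss_character(2) using e by simp
  then have "(1 / e ^ 3) *\<^sub>R (of_real (sqrt (2 * pi) ^ 3) * gauss (z /\<^sub>R e)) = (LINT \<xi>|lborel. gauss (e *\<^sub>R \<xi>) * cis (z \<bullet> \<xi>))"
    using e by simp
  then show ?thesis by (simp add: scaleR_conv_of_real)
qed

text \<open>Both sides are the double integral of the Gaussian regularisation, evaluated by Fubini.\<close>

lemma gauss_regularised_inversion:
  assumes f: "integrable lborel f" and e: "e > 0"
  shows "(LINT \<xi>|lborel. gauss (e *\<^sub>R \<xi>) * cis (x \<bullet> \<xi>) * ((2 * pi) ^ 3 *\<^sub>R fourier f \<xi>))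
    = of_real (sqrt (2 * pi) ^ 3) * (LINT t|lborel. gauss t * f (x + e *\<^sub>R t))"
proof -
  have [measurable]: "f \<in> borel_measurable borel" using borel_measurable_integrable[OF f] by simp
  have [measurable]: "(\<lambda>p :: (real^3) \<times> (real^3). cis ((x - snd p) \<bullet> fst p)) \<in> borel_measurable (lborel \<Otimes>\<^sub>M lborel)"
    unfolding lborel_prod measurable_lborel2 by (intro borel_measurable_continuous_onI continuous_intros)
  define K where "K = (\<lambda>(\<xi>, y). gauss (e *\<^sub>R \<xi>) * cis ((x - y) \<bullet> \<xi>) * f y)"
  have [measurable]: "K \<in> borel_measurable (lborel \<Otimes>\<^sub>M lborel)"
    unfolding K_def split_beta' by measurable
  have ge: "integrable lborel (\<lambda>\<xi>. gauss (e *\<^sub>R \<xi>))"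
    using integrable_affine[OF gauss_integrable, of e 0] e by simp
  have nK: "norm (K (\<xi>, y)) = norm (gauss (e *\<^sub>R \<xi>)) * norm (f y)" for \<xi> y
    by (simp add: K_def norm_mult)
  have Ki: "integrable (lborel \<Otimes>\<^sub>M lborel) K"
  proof (rule lborel_pair.Fubini_integrable)
    show "integrable lborel (\<lambda>\<xi>. LINT y|lborel. norm (K (\<xi>, y)))"
      unfolding nK using integrable_norm[OF f] integrable_norm[OF ge] by simp
    show "AE \<xi> in lborel. integrable lborel (\<lambda>y. K (\<xi>, y))"
    proof (rule AE_I2)
      fix \<xi>
      show "integrable lborel (\<lambda>y. K (\<xi>, y))"
        by (rule Bochner_Integration.integrable_bound[OF integrable_mult_right[OF integrable_norm[OF f], of "norm (gauss (e *\<^sub>R \<xi>))"]])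
           (auto simp: nK)
    qed
  qed measurable
  have "(LINT \<xi>|lborel. gauss (e *\<^sub>R \<xi>) * cis (x \<bullet> \<xi>) * ((2 * pi) ^ 3 *\<^sub>R fourier f \<xi>))
     = (LINT \<xi>|lborel. LINT y|lborel. K (\<xi>, y))"
  proof (rule Bochner_Integration.integral_cong)
    fix \<xi>
    have "gauss (e *\<^sub>R \<xi>) * cis (x \<bullet> \<xi>) * ((2 * pi) ^ 3 *\<^sub>R fourier f \<xi>)
        = (LINT y|lborel. (gauss (e *\<^sub>R \<xi>) * cis (x \<bullet> \<xi>)) * (cis (- (y \<bullet> \<xi>)) * f y))"
      by (simp add: fourier_def)
    also have "\<dots> = (LINT y|lborel. K (\<xi>, y))"
      by (intro Bochner_Integration.integral_cong)
         (auto simp: K_def inner_diff_left cis_mult)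
    finally show "gauss (e *\<^sub>R \<xi>) * cis (x \<bullet> \<xi>) * ((2 * pi) ^ 3 *\<^sub>R fourier f \<xi>) = (LINT y|lborel. K (\<xi>, y))" .
  qed simp
  also have "\<dots> = (LINT y|lborel. LINT \<xi>|lborel. K (\<xi>, y))"
    by (rule lborel_pair.Fubini_integral[symmetric]) (use Ki in \<open>simp add: split_beta'\<close>)
  also have "\<dots> = (LINT y|lborel. of_real (sqrt (2 * pi) ^ 3 / e ^ 3) * (gauss ((x - y) /\<^sub>R e) * f y))"
    unfolding K_def prod.case integral_mult_left_zero gauss_scaled_character[OF e] by (simp only: mult.assoc)
  also have "\<dots> = \<bar>e\<bar> ^ 3 *\<^sub>R (LINT t|lborel. of_real (sqrt (2 * pi) ^ 3 / e ^ 3) * (gauss ((x - (x + e *\<^sub>R t)) /\<^sub>R e) * f (x + e *\<^sub>R t)))"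
    by (rule integral_affine) (use e in auto)
  also have "\<dots> = of_real (sqrt (2 * pi) ^ 3) * (LINT t|lborel. gauss t * f (x + e *\<^sub>R t))"
  proof -
    have "gauss ((x - (x + e *\<^sub>R t)) /\<^sub>R e) = gauss t" for t
    proof -
      have "(x - (x + e *\<^sub>R t)) /\<^sub>R e = - t" using e by (simp add: scaleR_diff_right scaleR_add_right)
      then show ?thesis by (simp add: gauss_def)
    qed
    moreover have "\<bar>e\<bar> ^ 3 *\<^sub>R (of_real (sqrt (2 * pi) ^ 3 / e ^ 3) * w) = of_real (sqrt (2 * pi) ^ 3) * w" for w :: complex
      using e by (simp add: scaleR_conv_of_real)
    ultimately show ?thesis by simp
  qed
  finally show ?thesis .
qed

text \<open>The regularisation parameter tends to 0 on both sides of
  \<open>gauss_regularised_inversion\<close>. The majorant is a multiple of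
  \<open>norm (fourier f \<xi>)\<close> on the frequency side and of \<open>norm (gauss t)\<close>
  on the other, by boundedness of \<open>f\<close>. The factor \<open>sqrt (2 * pi) ^ 3\<close>
  occurs once explicitly and once as the integral of \<open>gauss\<close>, which together match the
  normalisation \<open>(2 * pi) ^ 3\<close>.\<close>

theorem fourier_inversion:
  assumes f: "integrable lborel f" and ff: "integrable lborel (fourier f)"
    and cont: "continuous_on UNIV f" and bdd: "\<And>x. norm (f x) \<le> B"
  shows "(LINT \<xi>|lborel. cis (x \<bullet> \<xi>) * fourier f \<xi>) = f x"
proof -
  have [measurable]: "f \<in> borel_measurable borel" "fourier f \<in> borel_measurable borel"
    using borel_measurable_integrable[OF f] borel_measurable_integrable[OF ff] by simp_all
  have [measurable]: "(\<lambda>\<xi>. cis (x \<bullet> \<xi>)) \<in> borel_measurable borel"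
    by (intro borel_measurable_continuous_onI continuous_intros)
  define e where "e n = 1 / real (Suc n)" for n
  have e: "e n > 0" for n by (simp add: e_def)
  have e0: "e \<longlonglongrightarrow> 0" unfolding e_def by (rule LIMSEQ_Suc) (rule lim_1_over_n)
  have "(\<lambda>n. LINT \<xi>|lborel. gauss (e n *\<^sub>R \<xi>) * cis (x \<bullet> \<xi>) * ((2 * pi) ^ 3 *\<^sub>R fourier f \<xi>))
     \<longlonglongrightarrow> (LINT \<xi>|lborel. cis (x \<bullet> \<xi>) * ((2 * pi) ^ 3 *\<^sub>R fourier f \<xi>))"
  proof (rule integral_dominated_convergence[where w="\<lambda>\<xi>. (2 * pi) ^ 3 * norm (fourier f \<xi>)"])
    show "AE \<xi> in lborel. (\<lambda>n. gauss (e n *\<^sub>R \<xi>) * cis (x \<bullet> \<xi>) * ((2 * pi) ^ 3 *\<^sub>R fourier f \<xi>))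
        \<longlonglongrightarrow> cis (x \<bullet> \<xi>) * ((2 * pi) ^ 3 *\<^sub>R fourier f \<xi>)"
    proof (rule AE_I2)
      fix \<xi> :: "real^3"
      have "(\<lambda>n. gauss (e n *\<^sub>R \<xi>)) \<longlonglongrightarrow> gauss (0 *\<^sub>R \<xi>)"
        unfolding gauss_def by (intro tendsto_intros e0) auto
      from tendsto_mult[OF this tendsto_const, of "cis (x \<bullet> \<xi>) * ((2 * pi) ^ 3 *\<^sub>R fourier f \<xi>)"]
      show "(\<lambda>n. gauss (e n *\<^sub>R \<xi>) * cis (x \<bullet> \<xi>) * ((2 * pi) ^ 3 *\<^sub>R fourier f \<xi>))
        \<longlonglongrightarrow> cis (x \<bullet> \<xi>) * ((2 * pi) ^ 3 *\<^sub>R fourier f \<xi>)"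
        by (simp add: gauss_def mult.assoc)
    qed
    show "AE \<xi> in lborel. norm (gauss (e n *\<^sub>R \<xi>) * cis (x \<bullet> \<xi>) * ((2 * pi) ^ 3 *\<^sub>R fourier f \<xi>)) \<le> (2 * pi) ^ 3 * norm (fourier f \<xi>)" for n
      using mult_right_mono[OF norm_gauss_le] by (auto simp: norm_mult)
  qed (use ff in auto)
  moreover have "(\<lambda>n. LINT t|lborel. gauss t * f (x + e n *\<^sub>R t)) \<longlonglongrightarrow> (LINT t|lborel. gauss t * f x)"
  proof (rule integral_dominated_convergence[where w="\<lambda>t. norm (gauss t) * B"])
    show "AE t in lborel. (\<lambda>n. gauss t * f (x + e n *\<^sub>R t)) \<longlonglongrightarrow> gauss t * f x"
    proof (rule AE_I2)
      fix t
      have "(\<lambda>n. x + e n *\<^sub>R t) \<longlonglongrightarrow> x + 0 *\<^sub>R t" by (intro tendsto_intros e0)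
      then have "(\<lambda>n. f (x + e n *\<^sub>R t)) \<longlonglongrightarrow> f x"
        using cont by (intro continuous_on_tendsto_compose[OF cont]) auto
      then show "(\<lambda>n. gauss t * f (x + e n *\<^sub>R t)) \<longlonglongrightarrow> gauss t * f x" by (intro tendsto_intros)
    qed
    show "integrable lborel (\<lambda>t. norm (gauss t) * B)"
      by (intro integrable_mult_left integrable_norm gauss_integrable)
    show "AE t in lborel. norm (gauss t * f (x + e n *\<^sub>R t)) \<le> norm (gauss t) * B" for n
      by (auto simp: norm_mult intro!: mult_left_mono bdd)
  qed auto
  then have "(\<lambda>n. of_real (sqrt (2 * pi) ^ 3) * (LINT t|lborel. gauss t * f (x + e n *\<^sub>R t)))
      \<longlonglongrightarrow> of_real (sqrt (2 * pi) ^ 3) * (LINT t|lborel. gauss t * f x)"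
    by (intro tendsto_intros)
  ultimately have "(LINT \<xi>|lborel. cis (x \<bullet> \<xi>) * ((2 * pi) ^ 3 *\<^sub>R fourier f \<xi>))
     = of_real (sqrt (2 * pi) ^ 3) * (LINT t|lborel. gauss t * f x)"
    unfolding gauss_regularised_inversion[OF f e] by (rule LIMSEQ_unique)
  also have "\<dots> = of_real ((sqrt (2 * pi))\<^sup>2 ^ 3) * f x"
  proof -
    have "of_real (s ^ 3) * (of_real (s ^ 3) * f x) = of_real ((s\<^sup>2) ^ 3) * f x" for s :: real
      by (simp add: eval_nat_numeral mult_ac)
    then show ?thesis using integral_gauss by (simp del: real_sqrt_pow2 of_real_power)
  qed
  also have "(sqrt (2 * pi))\<^sup>2 = 2 * pi" by simp
  finally have "(LINT \<xi>|lborel. cis (x \<bullet> \<xi>) * ((2 * pi) ^ 3 *\<^sub>R fourier f \<xi>)) = (2 * pi) ^ 3 *\<^sub>R f x"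
    by (simp add: scaleR_conv_of_real)
  moreover have "(LINT \<xi>|lborel. cis (x \<bullet> \<xi>) * (c *\<^sub>R fourier f \<xi>)) = c *\<^sub>R (LINT \<xi>|lborel. cis (x \<bullet> \<xi>) * fourier f \<xi>)" for c
    by simp
  ultimately show ?thesis by simp
qed

lemma fourier_uminus: "fourier f (- \<xi>) = (1 / (2 * pi) ^ 3) *\<^sub>R (LINT x|lborel. cis (\<xi> \<bullet> x) * f x)"
  by (simp add: fourier_def inner_commute)

lemma fourier_cmult: "fourier (\<lambda>x. c * f x) \<xi> = c * fourier f \<xi>"
  by (simp add: fourier_def mult.left_commute[of _ c])

lemma schwartz_bounded: "f \<in> schwartz \<Longrightarrow> norm (f x) \<le> schwartz_norm 0 f"
  using schwartz_norm_bound[of f 0 0 "[]" x] by simp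

lemma schwartz_fourier: "f \<in> schwartz \<Longrightarrow> fourier f \<in> schwartz"
  by (rule schwartz_continuousD[OF schwartz_continuous_fourier])

text \<open>The inverse transform carries no constant, whereas \<open>fourier\<close> does; using
  \<open>fourier\<close> a second time therefore has to be compensated by
  \<open>(2 * pi) ^ 3\<close>.\<close>

lemma fourier_fourier:
  assumes "f \<in> schwartz"
  shows "of_real ((2 * pi) ^ 3) * fourier (fourier f) (- x) = f x"
  unfolding fourier_uminus
  using fourier_inversion[OF schwartz_integrable[OF assms] schwartz_integrable[OF schwartz_fourier[OF assms]]
      smooth_continuous_on[OF schwartz_smooth[OF assms]] schwartz_bounded[OF assms], of x]
  by (simp add: scaleR_conv_of_real)

text \<open>The Fourier transform has order four up to a scalar, so it is onto.\<close>

lemma fourier_surj: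
  assumes f: "f \<in> schwartz"
  obtains g where "g \<in> schwartz" "fourier g = f"
proof
  define c where "c = complex_of_real ((2 * pi) ^ 3)"
  let ?g = "\<lambda>x. c\<^sup>2 * fourier (fourier (fourier f)) x"
  note F = schwartz_fourier
  show "?g \<in> schwartz" by (intro schwartz_cmult F f)
  have "fourier ?g x = c * (c * fourier (fourier (fourier (fourier f))) (- (- x)))" for x
    by (simp add: fourier_cmult power2_eq_square)
  then show "fourier ?g = f"
    using fourier_fourier[OF F[OF F[OF f]], folded c_def, of "- _"] fourier_fourier[OF f, folded c_def, of "_"]
    by (simp add: fun_eq_iff)
qed

subsection \<open>Bump functions and the fundamental lemma\<close>

definition flat :: "real poly \<Rightarrow> real \<Rightarrow> real" where
  "flat P x = (if x > 0 then poly P (1 / x) * exp (- (1 / x)) else 0)"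

text \<open>With \<open>y = 1 / x\<close>, the derivative of \<open>P(y) exp(-y)\<close> in
  \<open>x\<close> is \<open>y^2 (P - P')(y) exp(-y)\<close>; the polynomial
  \<open>[:0, 0, 1:]\<close> is \<open>y^2\<close>.\<close>

definition flat_step :: "real poly \<Rightarrow> real poly" where
  "flat_step P = [:0, 0, 1:] * (P - pderiv P)"

text \<open>The power \<open>y ^ k\<close> is there for the induction over \<open>P\<close>:
  splitting off a coefficient with \<open>pCons\<close> raises it to
  \<open>y ^ Suc k\<close>.\<close>

lemma power_poly_exp_tendsto_0:
  fixes P :: "real poly"
  shows "((\<lambda>y. y ^ k * poly P y * exp (- y)) \<longlongrightarrow> 0) at_top"
proof (induction P arbitrary: k)
  case (pCons a P)
  have "((\<lambda>y. a * (y ^ k / exp y) + y ^ Suc k * poly P y * exp (- y)) \<longlongrightarrow> a * 0 + 0) at_top"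
    by (intro tendsto_intros tendsto_power_div_exp_0 pCons.IH)
  moreover have "y ^ k * poly (pCons a P) y * exp (- y) = a * (y ^ k / exp y) + y ^ Suc k * poly P y * exp (- y)" for y
    unfolding poly_pCons exp_minus divide_inverse power_Suc distrib_left distrib_right by (simp only: mult_ac)
  ultimately show ?case by simp
qed simp

lemma flat_tendsto_0: "(flat P \<longlongrightarrow> 0) (at 0)"
proof -
  have "((\<lambda>x. poly P (1 / x) * exp (- (1 / x))) \<longlongrightarrow> 0) (at_right 0)"
    using filterlim_compose[OF power_poly_exp_tendsto_0[of 0 P] filterlim_inverse_at_top_right]
    by (simp add: inverse_eq_divide)
  then have "(flat P \<longlongrightarrow> 0) (at_right 0)"
    by (rule Lim_transform_eventually) (auto simp: flat_def eventually_at_filter)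
  moreover have "(flat P \<longlongrightarrow> 0) (at_left 0)"
    by (rule Lim_transform_eventually[OF tendsto_const]) (auto simp: flat_def eventually_at_filter)
  ultimately show ?thesis by (simp add: filterlim_split_at)
qed

lemma flat_derivative: "(flat P has_real_derivative flat (flat_step P) x) (at x)"
proof -
  consider "x > 0" | "x < 0" | "x = 0" by linarith
  then show ?thesis
  proof cases
    case 1
    have "((\<lambda>x. poly P (1 / x) * exp (- (1 / x))) has_real_derivative flat (flat_step P) x) (at x)"
    proof -
      have i: "((\<lambda>x. 1 / x) has_real_derivative - ((1 / x)\<^sup>2)) (at x)"
        using DERIV_inverse[of x] 1 by (simp add: inverse_eq_divide power2_eq_square)
      have e: "((\<lambda>x. exp (- (1 / x))) has_real_derivative exp (- (1 / x)) * - (- ((1 / x)\<^sup>2))) (at x)"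
        by (rule DERIV_chain2[OF DERIV_exp DERIV_minus[OF i]])
      have eq: "poly (pderiv P) (1 / x) * - ((1 / x)\<^sup>2) * exp (- (1 / x)) + exp (- (1 / x)) * - (- ((1 / x)\<^sup>2)) * poly P (1 / x)
          = flat (flat_step P) x"
        using 1 unfolding flat_def flat_step_def poly_mult poly_diff poly_pCons poly_0 power2_eq_square
        by (simp only: if_True mult_zero_right add_0_left add_0_right mult_1_right minus_minus left_diff_distrib right_diff_distrib
            mult_minus_right mult_minus_left mult_ac) simp
      show ?thesis
        using DERIV_mult[OF DERIV_chain2[OF poly_DERIV[of P] i] e] unfolding eq .
    qed
    then show ?thesis
      by (rule has_field_derivative_transform_within_open[where S="{0<..}"]) (use 1 in \<open>auto simp: flat_def\<close>)
  next
    case 2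
    have "((\<lambda>x. 0) has_real_derivative flat (flat_step P) x) (at x)" using 2 by (simp add: flat_def)
    then show ?thesis
      by (rule has_field_derivative_transform_within_open[where S="{..<0}"]) (use 2 in \<open>auto simp: flat_def\<close>)
  next
    case 3
    \<comment> \<open>At 0 the difference quotient is again a flat function: dividing by
      \<open>h\<close> multiplies the polynomial in \<open>1 / h\<close> by its variable, which
      gives \<open>pCons 0 P\<close>.\<close>
    have "((\<lambda>h. (flat P (0 + h) - flat P 0) / h) \<longlongrightarrow> 0) (at 0)"
      by (rule Lim_transform_eventually[OF flat_tendsto_0[of "pCons 0 P"]])
         (auto simp: flat_def eventually_at_filter)
    then show ?thesis using 3 by (simp add: DERIV_def flat_def)
  qed
qed

text \<open>Derivatives keep the affine argument and change only the polynomial and a scalar factor,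
  so the invariant family has to admit both.\<close>

lemma smooth_flat_coordinate: "smooth (\<lambda>x. of_real (flat P (c * x $ k + d)))"
proof (rule smooth_coinduct[where A="{(\<lambda>x. a * complex_of_real (flat P (c * x $ k + d))) | a P. True}"])
  have D: "((\<lambda>x::real^3. a * complex_of_real (flat P (c * x $ k + d))) has_derivative
     (\<lambda>h. a * complex_of_real (flat (flat_step P) (c * x $ k + d) * (c * h $ k)))) (at x)" for a P x
  proof -
    have "((\<lambda>x::real^3. c * x $ k + d) has_derivative (\<lambda>h. c * h $ k)) (at x)"
      by (auto intro!: derivative_eq_intros bounded_linear_imp_has_derivative[OF bounded_linear_vec_nth])
    from has_derivative_compose[OF this flat_derivative[THEN has_field_derivative_imp_has_derivative]]
    show ?thesis by (intro has_derivative_mult_right has_derivative_of_real)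
  qed
  show "g differentiable at x" if "g \<in> {(\<lambda>x. a * complex_of_real (flat P (c * x $ k + d))) | a P. True}" for g x
    using that D by (auto intro: differentiableI)
  show "partial j g \<in> {(\<lambda>x. a * complex_of_real (flat P (c * x $ k + d))) | a P. True}"
    if g: "g \<in> {(\<lambda>x. a * complex_of_real (flat P (c * x $ k + d))) | a P. True}" for g j
  proof -
    obtain a P where g: "g = (\<lambda>x. a * complex_of_real (flat P (c * x $ k + d)))" using g by blast
    have "partial j g = (\<lambda>x. (a * of_real (c * (if j = k then 1 else 0))) * complex_of_real (flat (flat_step P) (c * x $ k + d)))"
      unfolding g using partial_has_derivative[OF D, of j] by (auto simp: axis_def)
    then show ?thesis by blast
  qed
qed (auto intro!: exI[of _ "1::complex"])

lemma smooth_prod: "finite I \<Longrightarrow> (\<And>i. i \<in> I \<Longrightarrow> smooth (f i)) \<Longrightarrow> smooth (\<lambda>x. \<Prod>i\<in>I. f i x)"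
  by (induction I rule: finite_induct) (auto intro: smooth_const smooth_mult)

text \<open>A product of functions \<open>exp(-1 / (c t))\<close>, where \<open>t\<close> runs over
  the distances to the six faces. All members are supported in the same box, whatever
  \<open>c\<close> is, and they converge to its indicator as \<open>c\<close> grows, since each
  factor tends to 1 for positive \<open>t\<close>.\<close>

definition box_bump :: "real \<Rightarrow> real^3 \<Rightarrow> real^3 \<Rightarrow> real^3 \<Rightarrow> complex" where
  "box_bump c a b x = (\<Prod>i\<in>UNIV. of_real (flat 1 (c * x $ i + - (c * a $ i))) * of_real (flat 1 (- c * x $ i + c * b $ i)))"

lemma smooth_box_bump: "smooth (box_bump c a b)"
  unfolding box_bump_def[abs_def] by (intro smooth_prod smooth_mult smooth_flat_coordinate) auto

lemma flat_1_bounds: "0 \<le> flat 1 x" "flat 1 x \<le> 1"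
  by (auto simp: flat_def)

lemma box_bump_outside:
  assumes "c > 0" "x \<notin> box a b"
  shows "box_bump c a b x = 0"
proof -
  obtain i where "\<not> (a $ i < x $ i \<and> x $ i < b $ i)" using assms(2) by (auto simp: mem_box_cart)
  then have "flat 1 (c * x $ i + - (c * a $ i)) * flat 1 (- c * x $ i + c * b $ i) = 0"
    using assms(1) by (auto simp: flat_def algebra_simps not_less mult_le_cancel_left_pos)
  then have "complex_of_real (flat 1 (c * x $ i + - (c * a $ i))) * of_real (flat 1 (- c * x $ i + c * b $ i)) = 0"
    by (simp only: of_real_mult[symmetric] of_real_0)
  then show ?thesis unfolding box_bump_def by (intro prod_zero) auto
qed

lemma box_bump_test: "c > 0 \<Longrightarrow> box_bump c a b \<in> test_functions"
  using bounded_subset[OF bounded_box[of a b], of "{x. box_bump c a b x \<noteq> 0}"] box_bump_outside[of c _ a b]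
  by (auto simp: test_functions_def smooth_box_bump)

lemma norm_box_bump_le: "norm (box_bump c a b x) \<le> 1"
  unfolding box_bump_def prod_norm[symmetric]
  using flat_1_bounds by (intro prod_le_1) (auto simp: norm_mult mult_le_one)

lemma box_bump_tendsto: "(\<lambda>n. box_bump (real (Suc n)) a b x) \<longlonglongrightarrow> indicator (box a b) x"
proof (cases "x \<in> box a b")
  case False
  then show ?thesis by (simp add: box_bump_outside)
next
  case True
  have l: "(\<lambda>n. flat 1 (real (Suc n) * t)) \<longlonglongrightarrow> 1" if "t > 0" for t
  proof -
    have "(\<lambda>n. exp (- ((1 / t) * (1 / real (Suc n))))) \<longlonglongrightarrow> exp (- ((1 / t) * 0))"
      by (intro tendsto_intros LIMSEQ_Suc[OF lim_1_over_n])
    then show ?thesis using that by (simp add: flat_def zero_less_mult_iff add_pos_nonneg mult.commute)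
  qed
  have "(\<lambda>n. box_bump (real (Suc n)) a b x) \<longlonglongrightarrow> (\<Prod>i\<in>(UNIV::3 set). complex_of_real 1 * of_real 1)"
    unfolding box_bump_def
  proof (intro tendsto_prod tendsto_mult tendsto_of_real)
    fix i
    show "(\<lambda>n. flat 1 (real (Suc n) * x $ i + - (real (Suc n) * a $ i))) \<longlonglongrightarrow> 1"
      using l[of "x $ i - a $ i"] True by (simp add: mem_box_cart algebra_simps)
    show "(\<lambda>n. flat 1 (- real (Suc n) * x $ i + real (Suc n) * b $ i)) \<longlonglongrightarrow> 1"
      using l[of "b $ i - x $ i"] True by (simp add: mem_box_cart algebra_simps)
  qed
  then show ?thesis using True by simp
qed

section \<open>Locally integrable functions tested against bump functions\<close>

lemma locally_integrable_borel:
  assumes "locally_integrable g"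
  shows "g \<in> borel_measurable borel"
proof -
  have m: "(\<lambda>x. indicator (cball 0 (real n)) x *\<^sub>R g x) \<in> borel_measurable borel" for n
  proof -
    have "integrable lborel (\<lambda>x. indicator (cball 0 (real n)) x *\<^sub>R g x)"
      using assms compact_cball unfolding locally_integrable_def set_integrable_def by blast
    from borel_measurable_integrable[OF this] show ?thesis by simp
  qed
  show ?thesis
  proof (rule borel_measurable_LIMSEQ_metric[OF m])
    fix x :: "real^3"
    obtain N where "norm x \<le> real N" using real_arch_simple by blast
    then have "\<forall>\<^sub>F n in sequentially. indicator (cball 0 (real n)) x *\<^sub>R g x = g x"
      by (intro eventually_sequentiallyI[of N]) (auto simp: indicator_def)
    then show "(\<lambda>n. indicator (cball 0 (real n)) x *\<^sub>R g x) \<longlonglongrightarrow> g x"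
      by (rule tendsto_eventually)
  qed
qed

lemma locally_integrable_test_mult:
  assumes g: "locally_integrable g" and f: "f \<in> test_functions"
  shows "integrable lborel (\<lambda>x. g x * f x)"
proof -
  have sf: "smooth f" using f by (simp add: test_functions_def)
  obtain R where R: "\<And>x. f x \<noteq> 0 \<Longrightarrow> norm x \<le> R"
    using f unfolding test_functions_def bounded_iff by auto
  have "compact (f ` cball 0 R)" using sf by (intro compact_continuous_image smooth_continuous_on compact_cball)
  then obtain B where "\<forall>x\<in>cball 0 R. norm (f x) \<le> B"
    using compact_imp_bounded[of "f ` cball 0 R"] unfolding bounded_iff by auto
  then have B: "norm (f x) \<le> B" if "norm x \<le> R" for x
    using that by simp
  have i: "integrable lborel (\<lambda>x. indicator (cball 0 R) x *\<^sub>R g x)"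
    using g compact_cball unfolding locally_integrable_def set_integrable_def by blast
  show ?thesis
  proof (rule Bochner_Integration.integrable_bound[OF integrable_mult_right[OF integrable_norm[OF i], of B]])
    show "AE x in lborel. norm (g x * f x) \<le> norm (B * norm (indicator (cball 0 R) x *\<^sub>R g x))"
    proof (rule AE_I2)
      fix x
      show "norm (g x * f x) \<le> norm (B * norm (indicator (cball 0 R) x *\<^sub>R g x))"
      proof (cases "norm x \<le> R")
        case True
        have "norm (g x * f x) \<le> B * norm (g x)"
          using mult_right_mono[OF B[OF True] norm_ge_zero[of "g x"]] by (simp add: norm_mult mult.commute)
        also have "\<dots> \<le> \<bar>B\<bar> * norm (g x)" by (intro mult_right_mono) auto
        finally show ?thesis using True by (simp add: abs_mult)
      next
        case False
        then show ?thesis using R[of x] by auto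
      qed
    qed
  qed (use locally_integrable_borel[OF g] smooth_borel[OF sf] in auto)
qed

text \<open>The positive and negative parts of \<open>h\<close> are densities of two measures that
  agree, with finite values, on boxes. Boxes form an intersection-stable generator, so the measures
  coincide and their densities agree almost everywhere; both parts being equal forces
  \<open>h\<close> to vanish.\<close>

lemma AE_zero_if_box_integrals_zero:
  fixes h :: "real^3 \<Rightarrow> real"
  assumes int: "\<And>a b. integrable lborel (\<lambda>x. indicator (box a b) x * h x)"
    and zero: "\<And>a b. (LINT x|lborel. indicator (box a b) x * h x) = 0"
    and [measurable]: "h \<in> borel_measurable borel"
  shows "AE x in lborel. h x = 0"
proof -
  have fin: "(\<integral>\<^sup>+x. ennreal (h x) * indicator (box a b) x \<partial>lborel) < \<infinity>"
    and eq: "(\<integral>\<^sup>+x. ennreal (h x) * indicator (box a b) x \<partial>lborel) = (\<integral>\<^sup>+x. ennreal (- h x) * indicator (box a b) x \<partial>lborel)" for a b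
  proof -
    have p: "ennreal (h x) * indicator (box a b) x = ennreal (indicator (box a b) x * h x)"
       "ennreal (- h x) * indicator (box a b) x = ennreal (- (indicator (box a b) x * h x))" for x
      by (auto simp: indicator_def)
    have f: "(\<integral>\<^sup>+x. ennreal (indicator (box a b) x * h x) \<partial>lborel) < \<infinity>"
      "(\<integral>\<^sup>+x. ennreal (- (indicator (box a b) x * h x)) \<partial>lborel) < \<infinity>"
      using int[of a b] unfolding real_integrable_def by (auto simp: less_top)
    then show "(\<integral>\<^sup>+x. ennreal (h x) * indicator (box a b) x \<partial>lborel) < \<infinity>" by (simp add: p)
    show "(\<integral>\<^sup>+x. ennreal (h x) * indicator (box a b) x \<partial>lborel) = (\<integral>\<^sup>+x. ennreal (- h x) * indicator (box a b) x \<partial>lborel)"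
    proof -
      have "enn2real (\<integral>\<^sup>+x. ennreal (indicator (box a b) x * h x) \<partial>lborel)
        = enn2real (\<integral>\<^sup>+x. ennreal (- (indicator (box a b) x * h x)) \<partial>lborel)"
        using zero[of a b] real_lebesgue_integral_def[OF int[of a b]] by simp
      then show ?thesis using f unfolding p by (metis ennreal_enn2real infinity_ennreal_def)
    qed
  qed
  have "density lborel (\<lambda>x. ennreal (h x)) = density lborel (\<lambda>x. ennreal (- h x))"
  proof (rule measure_eqI_generator_eq)
    let ?E = "range (\<lambda>(a, b). box a b :: (real^3) set)"
    show "Int_stable ?E" by (auto simp: Int_stable_def box_Int_box)
    show "sets (density lborel (\<lambda>x. ennreal (h x))) = sigma_sets UNIV ?E"
      "sets (density lborel (\<lambda>x. ennreal (- h x))) = sigma_sets UNIV ?E"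
      by (simp_all add: borel_eq_box)
    let ?A = "\<lambda>n::nat. box (- (real n *\<^sub>R One)) (real n *\<^sub>R One) :: (real^3) set"
    show "range ?A \<subseteq> ?E" "(\<Union>i. ?A i) = UNIV" unfolding UN_box_eq_UNIV by auto
    show "emeasure (density lborel (\<lambda>x. ennreal (h x))) (?A i) \<noteq> \<infinity>" for i
      using fin by (subst emeasure_density) (auto simp: less_top)
    show "emeasure (density lborel (\<lambda>x. ennreal (h x))) X = emeasure (density lborel (\<lambda>x. ennreal (- h x))) X"
      if X: "X \<in> ?E" for X
    proof -
      obtain a b where "X = box a b" using X by auto
      then show ?thesis using eq[of a b] by (simp add: emeasure_density)
    qed
  qed auto
  then have "AE x in lborel. ennreal (h x) = ennreal (- h x)"
    by (intro sigma_finite_measure.density_unique[OF sigma_finite_lborel]) auto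
  then show ?thesis
    by eventually_elim (metis ennreal_eq_0_iff linear neg_le_0_iff_le neg_equal_zero order_antisym ennreal_neg)
qed

text \<open>Bump functions yield the integrals over boxes in the limit, with the restriction of
  \<open>g\<close> to the box as majorant; real and imaginary parts are then treated
  separately.\<close>

theorem AE_zero_if_test_integrals_zero:
  assumes g: "locally_integrable g"
    and zero: "\<And>f. f \<in> test_functions \<Longrightarrow> (LINT x|lborel. g x * f x) = 0"
  shows "AE x in lborel. g x = 0"
proof -
  have [measurable]: "g \<in> borel_measurable borel" by (rule locally_integrable_borel[OF g])
  have i: "integrable lborel (\<lambda>x. indicator (box a b) x *\<^sub>R g x)" for a b
  proof -
    have "set_integrable lborel (cbox a b) g" using g compact_cbox by (auto simp: locally_integrable_def)
    then have "set_integrable lborel (box a b) g" by (rule set_integrable_subset) (auto simp: box_subset_cbox)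
    then show ?thesis by (simp add: set_integrable_def)
  qed
  have z: "(LINT x|lborel. indicator (box a b) x *\<^sub>R g x) = 0" for a b
  proof -
    have "(\<lambda>n. LINT x|lborel. g x * box_bump (real (Suc n)) a b x) \<longlonglongrightarrow> (LINT x|lborel. g x * indicator (box a b) x)"
    proof (rule integral_dominated_convergence[where w="\<lambda>x. norm (indicator (box a b) x *\<^sub>R g x)"])
      show "AE x in lborel. (\<lambda>n. g x * box_bump (real (Suc n)) a b x) \<longlonglongrightarrow> g x * indicator (box a b) x"
        by (intro AE_I2 tendsto_mult tendsto_const box_bump_tendsto)
      show "AE x in lborel. norm (g x * box_bump (real (Suc n)) a b x) \<le> norm (indicator (box a b) x *\<^sub>R g x)" for n
      proof (rule AE_I2)
        fix x
        show "norm (g x * box_bump (real (Suc n)) a b x) \<le> norm (indicator (box a b) x *\<^sub>R g x)"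
          using mult_left_mono[OF norm_box_bump_le[of "real (Suc n)" a b x] norm_ge_zero[of "g x"]]
          by (cases "x \<in> box a b") (auto simp: norm_mult box_bump_outside)
      qed
      show "(\<lambda>x. g x * box_bump (real (Suc n)) a b x) \<in> borel_measurable lborel" for n
        using smooth_borel[OF smooth_box_bump] by auto
      show "integrable lborel (\<lambda>x. norm (indicator (box a b) x *\<^sub>R g x))"
        by (rule integrable_norm[OF i])
    qed auto
    then have "(LINT x|lborel. g x * indicator (box a b) x) = 0"
      using zero[OF box_bump_test] by (simp add: LIMSEQ_const_iff)
    moreover have "g x * indicator (box a b) x = indicator (box a b) x *\<^sub>R g x" for x
      by (simp add: indicator_def)
    ultimately show ?thesis by simp
  qed
  have "AE x in lborel. Re (g x) = 0"
  proof (rule AE_zero_if_box_integrals_zero)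
    show "integrable lborel (\<lambda>x. indicator (box a b) x * Re (g x))" for a b
      using integrable_Re[OF i[of a b]] by simp
    show "(LINT x|lborel. indicator (box a b) x * Re (g x)) = 0" for a b
      using integral_Re[OF i[of a b]] z[of a b] by simp
  qed simp
  moreover have "AE x in lborel. Im (g x) = 0"
  proof (rule AE_zero_if_box_integrals_zero)
    show "integrable lborel (\<lambda>x. indicator (box a b) x * Im (g x))" for a b
      using integrable_Im[OF i[of a b]] by simp
    show "(LINT x|lborel. indicator (box a b) x * Im (g x)) = 0" for a b
      using integral_Im[OF i[of a b]] z[of a b] by simp
  qed simp
  ultimately show ?thesis by eventually_elim (simp add: complex_eq_iff)
qed

subsection \<open>Tempered distributions with a Fourier transform in weighted spaces\<close>

lemma test_schwartz:
  assumes "f \<in> test_functions"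
  shows "f \<in> schwartz"
proof -
  have sf: "smooth f" using assms by (simp add: test_functions_def)
  obtain R where R: "\<And>x. f x \<noteq> 0 \<Longrightarrow> norm x \<le> R"
    using assms unfolding test_functions_def bounded_iff by auto
  have zero: "partials ks f x = 0" if "R < norm x" for ks x
    using that
  proof (induction ks arbitrary: x)
    case Nil
    then show ?case using R[of x] by auto
  next
    case (Cons k ks)
    \<comment> \<open>Vanishing on an open set is inherited by the derivative.\<close>
    have "open {x :: real^3. R < norm x}" by (intro open_Collect_less continuous_intros)
    then have "(partials ks f has_derivative (\<lambda>h. 0)) (at x)"
      by (rule has_derivative_transform_within_open[OF has_derivative_const])
         (use Cons in auto)
    then show ?case using partial_has_derivative by (simp add: partials_Cons)
  qed
  show ?thesis
  proof (rule schwartzI[OF sf])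
    fix N ks
    have "compact ((\<lambda>x. (1 + norm x) ^ N * norm (partials ks f x)) ` cball 0 R)"
      by (intro compact_continuous_image continuous_intros compact_cball smooth_continuous_on smooth_partials sf)
    then obtain B where B: "\<forall>x\<in>cball 0 R. norm ((1 + norm x) ^ N * norm (partials ks f x)) \<le> B"
      unfolding compact_eq_bounded_closed bounded_iff by auto
    have "(1 + norm x) ^ N * norm (partials ks f x) \<le> max B 0" for x
    proof (cases "norm x \<le> R")
      case True
      with B have "norm ((1 + norm x) ^ N * norm (partials ks f x)) \<le> B" by simp
      then show ?thesis using abs_ge_self[of "(1 + norm x) ^ N * norm (partials ks f x)"] by simp
    qed (use zero[of x ks] in simp)
    then show "\<exists>C. \<forall>x. (1 + norm x) ^ N * norm (partials ks f x) \<le> C" by blast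
  qed
qed

section \<open>Approximation of Schwartz functions by compactly supported ones\<close>

lemma partials_scale:
  assumes f: "smooth f"
  shows "partials ks (\<lambda>x. f (c *\<^sub>R x)) = (\<lambda>x. of_real (c ^ length ks) * partials ks f (c *\<^sub>R x))"
proof (induction ks)
  case (Cons k ks)
  have D: "((\<lambda>x. of_real (c ^ length ks) * partials ks f (c *\<^sub>R x)) has_derivative
     (\<lambda>h. of_real (c ^ length ks) * (\<Sum>j\<in>UNIV. (c *\<^sub>R h) $ j *\<^sub>R partial j (partials ks f) (c *\<^sub>R x)))) (at x)" for x
  proof -
    have "((\<lambda>x. c *\<^sub>R x) has_derivative (\<lambda>h. c *\<^sub>R h)) (at x)" by (auto intro!: derivative_eq_intros)
    from has_derivative_mult_right[OF has_derivative_compose[OF this derivative_partials[OF f]]]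
    show ?thesis .
  qed
  have S: "(\<Sum>j\<in>UNIV. (c *\<^sub>R axis k 1) $ j *\<^sub>R partial j (partials ks f) (c *\<^sub>R x)) = c *\<^sub>R partial k (partials ks f) (c *\<^sub>R x)" for x
    by (simp add: axis_def if_distrib[of "\<lambda>c. (_ * c) *\<^sub>R _"] if_distrib[of "\<lambda>c. c *\<^sub>R _"] cong: if_cong)
  have "partial k (\<lambda>x. of_real (c ^ length ks) * partials ks f (c *\<^sub>R x)) x
      = of_real (c ^ length ks) * (c *\<^sub>R partial k (partials ks f) (c *\<^sub>R x))" for x
    unfolding partial_has_derivative[OF D] S ..
  then show ?case
    by (simp add: partials_Cons Cons scaleR_conv_of_real[where 'a=complex] fun_eq_iff mult_ac)
qed simp

lemma smooth_scale:
  assumes f: "smooth f"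
  shows "smooth (\<lambda>x. f (c *\<^sub>R x))"
proof -
  have "(\<lambda>x. of_real (c ^ length ks) * partials ks f (c *\<^sub>R x)) differentiable (at x)" for ks x
  proof -
    have "((\<lambda>x. c *\<^sub>R x) has_derivative (\<lambda>h. c *\<^sub>R h)) (at x)" by (auto intro!: derivative_eq_intros)
    from has_derivative_mult_right[OF has_derivative_compose[OF this derivative_partials[OF f]]]
    show ?thesis by (rule differentiableI)
  qed
  then show ?thesis by (simp add: smooth_def[of "\<lambda>x. f (c *\<^sub>R x)"] partials_scale[OF f])
qed

lemma test_scale_mult:
  assumes E: "E \<in> test_functions" and f: "smooth f" and c: "c > 0"
  shows "(\<lambda>x. E (c *\<^sub>R x) * f x) \<in> test_functions"
proof -
  have "bounded {x. E x \<noteq> 0}" and sE: "smooth E" using E by (simp_all add: test_functions_def)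
  then obtain R where R: "\<And>x. E x \<noteq> 0 \<Longrightarrow> norm x \<le> R" unfolding bounded_iff by auto
  have "norm x \<le> R / c" if "E (c *\<^sub>R x) * f x \<noteq> 0" for x
    using R[of "c *\<^sub>R x"] that c by (simp add: pos_le_divide_eq mult.commute)
  then have "bounded {x. E (c *\<^sub>R x) * f x \<noteq> 0}" unfolding bounded_iff by blast
  moreover have "smooth (\<lambda>x. E (c *\<^sub>R x) * f x)" by (rule smooth_mult[OF smooth_scale[OF sE] f])
  ultimately show ?thesis unfolding test_functions_def by blast
qed

lemma cutoff_exists: obtains E where "E \<in> test_functions" "E 0 = 1"
proof -
  let ?b = "box_bump 1 (- 1) 1"
  have "?b 0 \<noteq> 0" by (simp add: box_bump_def flat_def)
  moreover have "(\<lambda>x. inverse (?b 0) * ?b x) \<in> test_functions"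
    using box_bump_test[of 1 "- 1" 1] unfolding test_functions_def
    by (auto intro: smooth_cmult elim!: bounded_subset)
  ultimately show ?thesis by (intro that[of "\<lambda>x. inverse (?b 0) * ?b x"]) auto
qed

lemma schwartz_Lipschitz:
  assumes f: "f \<in> schwartz"
  shows "norm (f y - f x) \<le> (3 * schwartz_norm 1 f) * norm (y - x)"
proof (rule differentiable_bound[where S=UNIV])
  fix x :: "real^3"
  show "(f has_derivative (\<lambda>h. \<Sum>k\<in>UNIV. h $ k *\<^sub>R partial k f x)) (at x within UNIV)"
    using derivative_partials[OF schwartz_smooth[OF f], of "[]"] by simp
  show "onorm (\<lambda>h. \<Sum>k\<in>UNIV. h $ k *\<^sub>R partial k f x) \<le> 3 * schwartz_norm 1 f"
  proof (rule onorm_le)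
    fix h :: "real^3"
    have "norm (\<Sum>k\<in>UNIV. h $ k *\<^sub>R partial k f x) \<le> (\<Sum>k\<in>UNIV. norm (h $ k *\<^sub>R partial k f x))" by (rule norm_sum)
    also have "\<dots> \<le> (\<Sum>k\<in>(UNIV::3 set). norm h * schwartz_norm 1 f)"
      unfolding norm_scaleR real_norm_def
      using schwartz_norm_bound[OF f, of 0 1 "[_]" x]
      by (intro sum_mono mult_mono component_le_norm_cart) (auto simp: partials_Cons)
    finally show "norm (\<Sum>k\<in>UNIV. h $ k *\<^sub>R partial k f x) \<le> 3 * schwartz_norm 1 f * norm h"
      by (simp add: mult_ac)
  qed
qed auto

text \<open>The error is \<open>c\<close> times the product of \<open>f\<close> with the quotient
  \<open>g c\<close>, which obeys polynomial bounds uniform in \<open>c\<close>. The quotient itself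
  grows at most linearly, because \<open>E 0 = 1\<close> and \<open>E\<close> is Lipschitz. A
  derivative of order \<open>n \<ge> 1\<close> gains \<open>c ^ n\<close> from the scaling and loses
  only one factor \<open>c\<close>.\<close>

lemma cutoff_convergence:
  assumes f: "f \<in> schwartz" and E: "E \<in> schwartz" "E 0 = 1"
  shows "\<exists>K\<ge>0. \<forall>c\<in>{0<..1}. schwartz_norm N (\<lambda>x. f x - E (c *\<^sub>R x) * f x) \<le> c * K"
proof -
  define g where "g c x = of_real (1 / c) * (1 + (- 1) * E (c *\<^sub>R x))" for c :: real and x
  have sE: "smooth (\<lambda>x. E (c *\<^sub>R x))" for c by (intro smooth_scale schwartz_smooth E)
  have sg: "smooth (g c)" for c
    unfolding g_def[abs_def] by (intro smooth_cmult smooth_add smooth_const sE)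
  have pg: "partials ks (g c) x = of_real (1 / c) * (partials ks (\<lambda>x. 1) x - of_real (c ^ length ks) * partials ks E (c *\<^sub>R x))" for ks c x
    unfolding g_def[abs_def]
    by (simp only: partials_cmult[OF smooth_add[OF smooth_const smooth_cmult[OF sE]]]
        partials_add[OF smooth_const smooth_cmult[OF sE]] partials_cmult[OF sE]
        partials_scale[OF schwartz_smooth[OF E(1)]]) simp
  have "\<exists>C M. \<forall>c\<in>{0<..1}. \<forall>x. norm (partials ks (g c) x) \<le> C * (1 + norm x) ^ M" for ks
  proof (cases ks)
    case Nil
    define L where "L = 3 * schwartz_norm 1 E"
    have L: "0 \<le> L" using schwartz_norm_nonneg[OF E(1)] by (simp add: L_def)
    have "norm (partials ks (g c) x) \<le> L * (1 + norm x) ^ 1" if "c \<in> {0<..1}" for c x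
    proof -
      have "norm (1 - E (c *\<^sub>R x)) \<le> L * norm (0 - c *\<^sub>R x)"
        using schwartz_Lipschitz[OF E(1), of 0 "c *\<^sub>R x"] by (simp add: E(2) L_def)
      then have "(1 / c) * norm (1 - E (c *\<^sub>R x)) \<le> (1 / c) * (L * (c * norm x))"
        using that by (intro mult_left_mono) auto
      also have "\<dots> = L * norm x" using that by simp
      also have "\<dots> \<le> L * (1 + norm x) ^ 1" using L by (intro mult_left_mono) auto
      finally show ?thesis using that by (simp add: Nil g_def norm_mult norm_divide)
    qed
    then show ?thesis by blast
  next
    case (Cons k ls)
    have "norm (partials ks (g c) x) \<le> schwartz_norm (length ks) E * (1 + norm x) ^ 0" if c: "c \<in> {0<..1}" for c x
    proof -
      have "norm (partials ks (g c) x) = (1 / c * c ^ length ks) * norm (partials ks E (c *\<^sub>R x))"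
        using c by (simp add: pg partials_const Cons norm_mult norm_power norm_divide)
      also have "1 / c * c ^ length ks = c ^ length ls" using c by (simp add: Cons)
      also have "c ^ length ls * norm (partials ks E (c *\<^sub>R x)) \<le> 1 * norm (partials ks E (c *\<^sub>R x))"
        using c by (intro mult_right_mono power_le_one) auto
      also have "\<dots> \<le> schwartz_norm (length ks) E"
        using schwartz_norm_bound[OF E(1), of 0 "length ks" ks "c *\<^sub>R x"] by simp
      finally show ?thesis by simp
    qed
    then show ?thesis by blast
  qed
  note lb = leibniz_sum_bound[of "{0<..1}" g, OF this]
  have "\<exists>D\<ge>0. \<forall>c\<in>{0<..1}. \<forall>x. (1 + norm x) ^ N * norm (partials ks (\<lambda>x. f x - E (c *\<^sub>R x) * f x) x) \<le> c * D" for ks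
  proof -
    obtain C M where C: "0 \<le> C" and CM: "\<And>c x. c \<in> {0<..1} \<Longrightarrow>
        (1 + norm x) ^ N * norm (leibniz_sum (leibniz_splits ks) (g c) f x) \<le> C * schwartz_norm M f"
      using lb[of N "leibniz_splits ks"] f by blast
    have "(1 + norm x) ^ N * norm (partials ks (\<lambda>x. f x - E (c *\<^sub>R x) * f x) x) \<le> c * (C * schwartz_norm M f)"
      if c: "c \<in> {0<..1}" for c x
    proof -
      have "(\<lambda>x. f x - E (c *\<^sub>R x) * f x) = (\<lambda>x. of_real c * (g c x * f x))"
        using c by (simp add: g_def fun_eq_iff algebra_simps)
      then have "partials ks (\<lambda>x. f x - E (c *\<^sub>R x) * f x) x = of_real c * leibniz_sum (leibniz_splits ks) (g c) f x"
        by (simp add: partials_cmult[OF smooth_mult[OF sg schwartz_smooth[OF f]]] partials_mult[OF sg schwartz_smooth[OF f]])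
      then have "(1 + norm x) ^ N * norm (partials ks (\<lambda>x. f x - E (c *\<^sub>R x) * f x) x)
          = c * ((1 + norm x) ^ N * norm (leibniz_sum (leibniz_splits ks) (g c) f x))"
        using c by (simp add: norm_mult)
      also have "\<dots> \<le> c * (C * schwartz_norm M f)" using c by (intro mult_left_mono CM) auto
      finally show ?thesis .
    qed
    moreover have "0 \<le> C * schwartz_norm M f" by (intro mult_nonneg_nonneg C schwartz_norm_nonneg f)
    ultimately show ?thesis by blast
  qed
  then have "\<forall>ks. \<exists>D. 0 \<le> D \<and> (\<forall>c\<in>{0<..1}. \<forall>x. (1 + norm x) ^ N * norm (partials ks (\<lambda>x. f x - E (c *\<^sub>R x) * f x) x) \<le> c * D)"
    by blast
  from choice[OF this] obtain D where D: "\<And>ks. 0 \<le> D ks" and DD: "\<And>ks c x. c \<in> {0<..1} \<Longrightarrow>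
      (1 + norm x) ^ N * norm (partials ks (\<lambda>x. f x - E (c *\<^sub>R x) * f x) x) \<le> c * D ks"
    by blast
  let ?I = "{ks :: 3 list. length ks \<le> N}"
  have "schwartz_norm N (\<lambda>x. f x - E (c *\<^sub>R x) * f x) \<le> real (card ?I) * (c * sum D ?I)" if c: "c \<in> {0<..1}" for c
  proof (rule schwartz_norm_leI)
    fix ks x assume "length (ks :: 3 list) \<le> N"
    then have "D ks \<le> sum D ?I" using D by (intro member_le_sum finite_multi_indices) auto
    then have "c * D ks \<le> c * sum D ?I" using c by (intro mult_left_mono) auto
    with DD[OF c, of x ks] show "(1 + norm x) ^ N * norm (partials ks (\<lambda>x. f x - E (c *\<^sub>R x) * f x) x) \<le> c * sum D ?I"
      by (rule order_trans)
  qed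
  then have "\<forall>c\<in>{0<..1}. schwartz_norm N (\<lambda>x. f x - E (c *\<^sub>R x) * f x) \<le> c * (real (card ?I) * sum D ?I)"
    by (simp add: mult.left_commute)
  moreover have "0 \<le> real (card ?I) * sum D ?I" by (intro mult_nonneg_nonneg sum_nonneg D) auto
  ultimately show ?thesis by blast
qed

lemma fourier_add:
  assumes "f \<in> schwartz" "g \<in> schwartz"
  shows "fourier (\<lambda>x. f x + g x) = (\<lambda>\<xi>. fourier f \<xi> + fourier g \<xi>)"
proof -
  have i: "integrable lborel (\<lambda>x. character \<xi> x * f x)" if "f \<in> schwartz" for f \<xi>
    by (intro schwartz_integrable schwartz_continuousD[OF schwartz_continuous_mult[OF tame_character]] that)
  show ?thesis
    by (simp add: fun_eq_iff fourier_character distrib_left i assms scaleR_add_right)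
qed

section \<open>Distributions determined by, and constructed from, their Fourier transform\<close>

lemma pairing_add: "f \<in> schwartz \<Longrightarrow> g \<in> schwartz \<Longrightarrow> pairing T (\<lambda>x. f x + g x) = pairing T f + pairing T g"
  and pairing_outside: "f \<notin> schwartz \<Longrightarrow> pairing T f = 0"
  and pairing_bounded: "\<exists>N C. \<forall>f\<in>schwartz. norm (pairing T f) \<le> C * schwartz_norm N f"
  using pairing[of T] by auto

lemma pairing_fourier_bounded:
  "\<exists>N. \<exists>C\<ge>0. \<forall>f\<in>schwartz. norm (pairing T (fourier f)) \<le> C * schwartz_norm N f"
proof -
  obtain N C where NC: "\<And>f. f \<in> schwartz \<Longrightarrow> norm (pairing T f) \<le> C * schwartz_norm N f"
    using pairing_bounded by blast
  obtain D M where D: "0 \<le> D" "\<And>f. f \<in> schwartz \<Longrightarrow> schwartz_norm N (fourier f) \<le> D * schwartz_norm M f"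
    using schwartz_continuous_norm[OF schwartz_continuous_fourier] by blast
  have "norm (pairing T (fourier f)) \<le> (\<bar>C\<bar> * D) * schwartz_norm M f" if f: "f \<in> schwartz" for f
  proof -
    have "norm (pairing T (fourier f)) \<le> C * schwartz_norm N (fourier f)"
      by (rule NC[OF schwartz_fourier[OF f]])
    also have "\<dots> \<le> \<bar>C\<bar> * schwartz_norm N (fourier f)"
      by (intro mult_right_mono schwartz_norm_nonneg schwartz_fourier f) auto
    also have "\<dots> \<le> \<bar>C\<bar> * (D * schwartz_norm M f)"
      by (intro mult_left_mono D f) auto
    finally show ?thesis by simp
  qed
  moreover have "0 \<le> \<bar>C\<bar> * D" using D by simp
  ultimately show ?thesis by blast
qed

lemma pairing_fourier_cutoff:
  assumes f: "f \<in> schwartz" and E: "E \<in> test_functions" "E 0 = 1"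
  shows "((\<lambda>c. pairing T (fourier (\<lambda>x. E (c *\<^sub>R x) * f x))) \<longlongrightarrow> pairing T (fourier f)) (at_right 0)"
proof -
  obtain N C where C: "0 \<le> C" "\<And>f. f \<in> schwartz \<Longrightarrow> norm (pairing T (fourier f)) \<le> C * schwartz_norm N f"
    using pairing_fourier_bounded by blast
  obtain K where K: "\<And>c. c \<in> {0<..1} \<Longrightarrow> schwartz_norm N (\<lambda>x. f x - E (c *\<^sub>R x) * f x) \<le> c * K"
    using cutoff_convergence[OF f test_schwartz[OF E(1)] E(2)] by blast
  have "norm (pairing T (fourier (\<lambda>x. E (c *\<^sub>R x) * f x)) - pairing T (fourier f)) \<le> C * (c * K)"
    if c: "c \<in> {0<..1}" and s: "(\<lambda>x. E (c *\<^sub>R x) * f x) \<in> schwartz" for c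
  proof -
    have d: "(\<lambda>x. f x - E (c *\<^sub>R x) * f x) \<in> schwartz" by (rule schwartz_diff[OF f s])
    have "pairing T (fourier (\<lambda>x. (f x - E (c *\<^sub>R x) * f x) + E (c *\<^sub>R x) * f x))
       = pairing T (fourier (\<lambda>x. f x - E (c *\<^sub>R x) * f x)) + pairing T (fourier (\<lambda>x. E (c *\<^sub>R x) * f x))"
      by (simp only: fourier_add[OF d s] pairing_add[OF schwartz_fourier[OF d] schwartz_fourier[OF s]])
    then have "norm (pairing T (fourier (\<lambda>x. E (c *\<^sub>R x) * f x)) - pairing T (fourier f))
       = norm (pairing T (fourier (\<lambda>x. f x - E (c *\<^sub>R x) * f x)))"
      by (simp add: norm_minus_commute)
    also have "\<dots> \<le> C * schwartz_norm N (\<lambda>x. f x - E (c *\<^sub>R x) * f x)" by (rule C(2)[OF d])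
    also have "\<dots> \<le> C * (c * K)" by (intro mult_left_mono K c C)
    finally show ?thesis .
  qed
  moreover have "(\<lambda>x. E (c *\<^sub>R x) * f x) \<in> schwartz" if "c > 0" for c
    by (intro test_schwartz test_scale_mult E schwartz_smooth f that)
  ultimately have ev: "\<forall>\<^sub>F c in at_right 0. norm (pairing T (fourier (\<lambda>x. E (c *\<^sub>R x) * f x)) - pairing T (fourier f)) \<le> C * (c * K)"
    by (auto simp: eventually_at_right_field intro!: exI[of _ 1])
  have "((\<lambda>c. C * (c * K)) \<longlongrightarrow> C * (0 * K)) (at_right 0)" by (intro tendsto_intros)
  with Lim_null_comparison[OF ev] show ?thesis by (simp add: Lim_null[symmetric])
qed

text \<open>The Fourier transforms of test functions do not exhaust the Schwartz space. Cutoff and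
  continuity extend the equality to transforms of all Schwartz functions, and these are all Schwartz
  functions by \<open>fourier_surj\<close>.\<close>

theorem tempered_eqI:
  assumes "\<And>f. f \<in> test_functions \<Longrightarrow> pairing T (fourier f) = pairing T' (fourier f)"
  shows "T = T'"
proof -
  obtain E where E: "E \<in> test_functions" "E 0 = 1" by (rule cutoff_exists)
  have eq: "pairing T (fourier f) = pairing T' (fourier f)" if f: "f \<in> schwartz" for f
  proof -
    have "(\<lambda>x. E (c *\<^sub>R x) * f x) \<in> test_functions" if "c > 0" for c
      by (intro test_scale_mult E schwartz_smooth f that)
    then have ev: "\<forall>\<^sub>F c in at_right 0. pairing T (fourier (\<lambda>x. E (c *\<^sub>R x) * f x)) = pairing T' (fourier (\<lambda>x. E (c *\<^sub>R x) * f x))"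
      using assms by (auto simp: eventually_at_right_field intro!: exI[of _ 1])
    show ?thesis
      by (rule tendsto_unique[OF trivial_limit_at_right_real
            Lim_transform_eventually[OF pairing_fourier_cutoff[OF f E] ev] pairing_fourier_cutoff[OF f E]])
  qed
  have "pairing T h = pairing T' h" for h
  proof (cases "h \<in> schwartz")
    case True
    then obtain g where "g \<in> schwartz" "fourier g = h" by (rule fourier_surj)
    then show ?thesis using eq by auto
  qed (simp add: pairing_outside)
  then have "pairing T = pairing T'" by (rule ext)
  then show ?thesis by (simp add: pairing_inject)
qed

text \<open>Makes the arbitrary choice in \<open>fourier_fun\<close> harmless up to null
  sets.\<close>

lemma has_fourier_fun_unique:
  assumes "has_fourier_fun T g" "has_fourier_fun T g'"
  shows "AE \<xi> in lborel. g \<xi> = g' \<xi>"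
proof -
  have "AE \<xi> in lborel. g \<xi> - g' \<xi> = 0"
  proof (rule AE_zero_if_test_integrals_zero)
    show "locally_integrable (\<lambda>\<xi>. g \<xi> - g' \<xi>)"
      using assms by (auto simp: has_fourier_fun_def locally_integrable_def)
    show "(LINT \<xi>|lborel. (g \<xi> - g' \<xi>) * f \<xi>) = 0" if f: "f \<in> test_functions" for f
    proof -
      have "(LINT \<xi>|lborel. (g \<xi> - g' \<xi>) * f \<xi>) = (LINT \<xi>|lborel. g \<xi> * f \<xi>) - (LINT \<xi>|lborel. g' \<xi> * f \<xi>)"
        using assms locally_integrable_test_mult[OF _ f]
        by (simp add: has_fourier_fun_def left_diff_distrib)
      then show ?thesis using assms f by (simp add: has_fourier_fun_def)
    qed
  qed
  then show ?thesis by simp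
qed

lemma tempered_eq_if_fourier_AE_eq:
  assumes "has_fourier_fun T g" "has_fourier_fun T' g'" and ae: "AE \<xi> in lborel. g \<xi> = g' \<xi>"
  shows "T = T'"
proof (rule tempered_eqI)
  fix f assume f: "f \<in> test_functions"
  have "(LINT \<xi>|lborel. g \<xi> * f \<xi>) = (LINT \<xi>|lborel. g' \<xi> * f \<xi>)"
  proof (rule integral_cong_AE)
    show "(\<lambda>\<xi>. g \<xi> * f \<xi>) \<in> borel_measurable lborel" "(\<lambda>\<xi>. g' \<xi> * f \<xi>) \<in> borel_measurable lborel"
      using assms locally_integrable_test_mult[OF _ f] borel_measurable_integrable
      by (auto simp: has_fourier_fun_def)
    show "AE \<xi> in lborel. g \<xi> * f \<xi> = g' \<xi> * f \<xi>" using ae by eventually_elim simp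
  qed
  then show "pairing T (fourier f) = pairing T' (fourier f)"
    using assms f by (simp add: has_fourier_fun_def)
qed

text \<open>The weight in the hypothesis is matched by \<open>fourier_decay\<close> with exponent 4:
  transforms of Schwartz functions decay at that rate, with a constant given by a seminorm, so the
  pairing converges and is continuous.\<close>

theorem tempered_exists:
  assumes [measurable]: "g \<in> borel_measurable borel"
    and fin: "(\<integral>\<^sup>+\<xi>. ennreal (norm (g \<xi>) / (1 + norm \<xi>) ^ 4) \<partial>lborel) < \<infinity>"
  obtains T where "has_fourier_fun T g"
proof -
  have pos: "0 < (1 + norm (\<xi> :: real^3)) ^ 4" for \<xi> by (intro zero_less_power) (simp add: add_pos_nonneg)
  have w: "integrable lborel (\<lambda>\<xi>. norm (g \<xi>) / (1 + norm \<xi>) ^ 4)"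
    using fin by (intro integrableI_bounded) auto
  have loc: "locally_integrable g"
    unfolding locally_integrable_def set_integrable_def
  proof (intro allI impI)
    fix K :: "(real^3) set" assume K: "compact K"
    then obtain R where R: "\<And>x. x \<in> K \<Longrightarrow> norm x \<le> R"
      using compact_imp_bounded[of K] unfolding bounded_iff by auto
    have [measurable]: "K \<in> sets borel" using K by (simp add: borel_closed compact_imp_closed)
    show "integrable lborel (\<lambda>x. indicator K x *\<^sub>R g x)"
    proof (rule Bochner_Integration.integrable_bound[OF integrable_mult_right[OF w, of "(1 + R) ^ 4"]])
      show "AE x in lborel. norm (indicator K x *\<^sub>R g x) \<le> norm ((1 + R) ^ 4 * (norm (g x) / (1 + norm x) ^ 4))"
      proof (rule AE_I2)
        fix x
        show "norm (indicator K x *\<^sub>R g x) \<le> norm ((1 + R) ^ 4 * (norm (g x) / (1 + norm x) ^ 4))"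
        proof (cases "x \<in> K")
          case True
          have "norm (g x) * (1 + norm x) ^ 4 \<le> norm (g x) * (1 + R) ^ 4"
            using R[OF True] by (intro mult_left_mono power_mono) auto
          then have "norm (g x) \<le> (1 + R) ^ 4 * (norm (g x) / (1 + norm x) ^ 4)"
            using pos[of x] by (simp add: pos_le_divide_eq mult.commute)
          also have "\<dots> \<le> norm ((1 + R) ^ 4 * (norm (g x) / (1 + norm x) ^ 4))" by simp
          finally show ?thesis using True by simp
        qed simp
      qed
    qed measurable
  qed
  \<comment> \<open>\<open>A\<close> is the inverse Fourier transform, by
    \<open>fourier_fourier\<close>. The functional \<open>S\<close> thus pairs \<open>g\<close> with
    the inverse transform of its argument, and on arguments \<open>fourier f\<close> it returns the
    pairing of \<open>g\<close> with \<open>f\<close>.\<close>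
  define A where "A h \<xi> = of_real ((2 * pi) ^ 3) * fourier h (- \<xi>)" for h \<xi>
  define S where "S h = (if h \<in> schwartz then (LINT \<xi>|lborel. g \<xi> * A h \<xi>) else 0)" for h
  obtain C M where C: "0 \<le> C" and CM: "\<And>h \<xi>. h \<in> schwartz \<Longrightarrow> (1 + norm \<xi>) ^ 4 * norm (fourier h \<xi>) \<le> C * schwartz_norm M h"
    using fourier_decay[of 4] by blast
  have bound: "norm (g \<xi> * A h \<xi>) \<le> (2 * pi) ^ 3 * C * schwartz_norm M h * (norm (g \<xi>) / (1 + norm \<xi>) ^ 4)" if h: "h \<in> schwartz" for h \<xi>
  proof -
    have "norm (fourier h (- \<xi>)) \<le> C * schwartz_norm M h / (1 + norm \<xi>) ^ 4"
      using CM[OF h, of "- \<xi>"] pos[of \<xi>] by (simp add: pos_le_divide_eq mult.commute)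
    then have "norm (g \<xi>) * ((2 * pi) ^ 3 * norm (fourier h (- \<xi>))) \<le> norm (g \<xi>) * ((2 * pi) ^ 3 * (C * schwartz_norm M h / (1 + norm \<xi>) ^ 4))"
      by (intro mult_left_mono) auto
    then show ?thesis by (simp add: A_def norm_mult norm_power mult_ac)
  qed
  have Ai: "integrable lborel (\<lambda>\<xi>. g \<xi> * A h \<xi>)" if h: "h \<in> schwartz" for h
  proof (rule Bochner_Integration.integrable_bound[OF integrable_mult_right[OF w, of "(2 * pi) ^ 3 * C * schwartz_norm M h"]])
    have [measurable]: "fourier h \<in> borel_measurable borel" by (intro schwartz_borel schwartz_fourier h)
    show "(\<lambda>\<xi>. g \<xi> * A h \<xi>) \<in> borel_measurable lborel" unfolding A_def by measurable
    show "AE \<xi> in lborel. norm (g \<xi> * A h \<xi>) \<le> norm ((2 * pi) ^ 3 * C * schwartz_norm M h * (norm (g \<xi>) / (1 + norm \<xi>) ^ 4))"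
      using bound[OF h] by (intro AE_I2) (metis abs_ge_self order_trans real_norm_def)
  qed
  have "S \<in> {T :: (real^3 \<Rightarrow> complex) \<Rightarrow> complex.
    (\<forall>f. f \<notin> schwartz \<longrightarrow> T f = 0) \<and>
    (\<forall>f\<in>schwartz. \<forall>g\<in>schwartz. T (\<lambda>x. f x + g x) = T f + T g) \<and>
    (\<forall>f\<in>schwartz. \<forall>a. T (\<lambda>x. a * f x) = a * T f) \<and>
    (\<exists>N C. \<forall>f\<in>schwartz. norm (T f) \<le> C * schwartz_norm N f)}"
  proof (intro CollectI conjI ballI allI impI)
    show "S f = 0" if "f \<notin> schwartz" for f using that by (simp add: S_def)
    show "S (\<lambda>x. f x + h x) = S f + S h" if "f \<in> schwartz" "h \<in> schwartz" for f h
    proof -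
      have "g \<xi> * A (\<lambda>x. f x + h x) \<xi> = g \<xi> * A f \<xi> + g \<xi> * A h \<xi>" for \<xi>
        unfolding A_def fourier_add[OF that] by (simp add: distrib_left)
      then show ?thesis using that Ai by (simp add: S_def schwartz_add)
    qed
    show "S (\<lambda>x. a * f x) = a * S f" if "f \<in> schwartz" for f a
    proof -
      have "g \<xi> * A (\<lambda>x. a * f x) \<xi> = a * (g \<xi> * A f \<xi>)" for \<xi>
        unfolding A_def fourier_cmult by (simp add: mult_ac)
      then have "(LINT \<xi>|lborel. g \<xi> * A (\<lambda>x. a * f x) \<xi>) = a * (LINT \<xi>|lborel. g \<xi> * A f \<xi>)"
        by (simp only: integral_mult_right_zero)
      then show ?thesis using that by (simp add: S_def schwartz_cmult)
    qed
    have "norm (S h) \<le> ((2 * pi) ^ 3 * C * (LINT \<xi>|lborel. norm (g \<xi>) / (1 + norm \<xi>) ^ 4)) * schwartz_norm M h" if h: "h \<in> schwartz" for h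
    proof -
      have "norm (S h) \<le> (LINT \<xi>|lborel. norm (g \<xi> * A h \<xi>))" using h by (simp add: S_def)
      also have "\<dots> \<le> (LINT \<xi>|lborel. (2 * pi) ^ 3 * C * schwartz_norm M h * (norm (g \<xi>) / (1 + norm \<xi>) ^ 4))"
        by (rule integral_mono[OF integrable_norm[OF Ai[OF h]] integrable_mult_right[OF w] bound[OF h]])
      also have "\<dots> = ((2 * pi) ^ 3 * C * (LINT \<xi>|lborel. norm (g \<xi>) / (1 + norm \<xi>) ^ 4)) * schwartz_norm M h"
        by (simp only: integral_mult_right_zero mult_ac)
      finally show ?thesis .
    qed
    then show "\<exists>N C. \<forall>f\<in>schwartz. norm (S f) \<le> C * schwartz_norm N f" by blast
  qed
  then have P: "pairing (Abs_tempered S) = S" by (rule Abs_tempered_inverse)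
  have "has_fourier_fun (Abs_tempered S) g"
  proof -
    have "A (fourier f) \<xi> = f \<xi>" if "f \<in> test_functions" for f \<xi>
      unfolding A_def by (rule fourier_fourier[OF test_schwartz[OF that]])
    then show ?thesis
      unfolding has_fourier_fun_def P using loc by (simp add: S_def schwartz_fourier test_schwartz)
  qed
  then show ?thesis by (rule that)
qed

subsection \<open>Weighted convolution inequality\<close>

lemma nn_integral_reflect:
  fixes f :: "real^3 \<Rightarrow> ennreal"
  assumes [measurable]: "f \<in> borel_measurable borel"
  shows "(\<integral>\<^sup>+x. f (c - x) \<partial>lborel) = (\<integral>\<^sup>+x. f x \<partial>lborel)"
proof -
  have "(\<integral>\<^sup>+x. f x \<partial>lborel) = (\<integral>\<^sup>+x. f x \<partial>density (distr lborel borel (\<lambda>x. c + (-1) *\<^sub>R x)) (\<lambda>_. ennreal (\<bar>-1\<bar> ^ 3)))"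
    using lborel_affine[of "-1" c] by simp
  also have "\<dots> = (\<integral>\<^sup>+x. f (c - x) \<partial>lborel)"
    by (simp add: nn_integral_density nn_integral_distr)
  finally show ?thesis ..
qed

lemma nn_integral_translate:
  fixes f :: "real^3 \<Rightarrow> ennreal"
  assumes [measurable]: "f \<in> borel_measurable borel"
  shows "(\<integral>\<^sup>+x. f (x - c) \<partial>lborel) = (\<integral>\<^sup>+x. f x \<partial>lborel)"
proof -
  have "(\<integral>\<^sup>+x. f x \<partial>lborel) = (\<integral>\<^sup>+x. f x \<partial>distr lborel borel ((+) (- c)))"
    by (simp add: lborel_distr_plus)
  also have "\<dots> = (\<integral>\<^sup>+x. f (x - c) \<partial>lborel)"
    by (subst nn_integral_distr) auto
  finally show ?thesis ..
qed

text \<open>The convolution of \<open>|\<cdot>|\<^sup>-\<^sup>\<sigma>\<close> with itself: near each singularity the other factor is comparable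
  to \<open>|\<xi>|\<^sup>-\<^sup>\<sigma>\<close>, and away from both of them the product is dominated by the sum of the squares.\<close>

lemma riesz_kernel_convolution:
  assumes s: "3 / 2 < \<sigma>" "\<sigma> < 3"
  shows "\<exists>C>0. \<forall>\<xi>::real^3. \<xi> \<noteq> 0 \<longrightarrow>
     (\<integral>\<^sup>+\<eta>. ennreal (norm (\<xi> - \<eta>) powr (-\<sigma>) * norm \<eta> powr (-\<sigma>)) \<partial>lborel) \<le> ennreal (C * norm \<xi> powr (3 - 2 * \<sigma>))"
proof -
  obtain C1 where C1: "0 \<le> C1" "\<And>R. R > 0 \<Longrightarrow>
      (\<integral>\<^sup>+(x::real^3). ennreal (indicator (cball 0 R) x * norm x powr (-\<sigma>)) \<partial>lborel) \<le> ennreal (C1 * R powr (3 - \<sigma>))"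
    using integral_singular_ball[of \<sigma>] s by auto
  obtain C2 where C2: "0 \<le> C2" "\<And>R. R > 0 \<Longrightarrow>
      (\<integral>\<^sup>+(x::real^3). ennreal (indicator {x. R \<le> norm x} x * norm x powr (-(2*\<sigma>))) \<partial>lborel) \<le> ennreal (C2 * R powr (3 - 2*\<sigma>))"
    using integral_decay_outside_ball[of "2 * \<sigma>"] s by auto
  \<comment> \<open>The factor \<open>(1 / 2) powr (3 - 2 * \<sigma>)\<close> comes from the radius
    \<open>R = norm \<xi> / 2\<close>, the 2 from the two singularities, and the summand 1 secures
    positivity.\<close>
  define C where "C = 2 * (C1 + C2) * (1 / 2) powr (3 - 2 * \<sigma>) + 1"
  have "C > 0" using C1 C2 by (simp add: C_def add_nonneg_pos)
  moreover have "(\<integral>\<^sup>+\<eta>. ennreal (norm (\<xi> - \<eta>) powr (-\<sigma>) * norm \<eta> powr (-\<sigma>)) \<partial>lborel) \<le> ennreal (C * norm \<xi> powr (3 - 2 * \<sigma>))"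
    if xi: "\<xi> \<noteq> 0" for \<xi> :: "real^3"
  proof -
    define R where "R = norm \<xi> / 2"
    have R: "R > 0" using xi by (simp add: R_def)
    define a where "a x = ennreal (indicator (cball 0 R) x * norm x powr (-\<sigma>))" for x :: "real^3"
    define b where "b x = ennreal (indicator {x. R \<le> norm x} x * norm x powr (-(2*\<sigma>)))" for x :: "real^3"
    have [measurable]: "a \<in> borel_measurable borel" "b \<in> borel_measurable borel"
      unfolding a_def b_def by measurable
    have pw: "ennreal (norm (\<xi> - \<eta>) powr (-\<sigma>) * norm \<eta> powr (-\<sigma>))
       \<le> (ennreal (R powr (-\<sigma>)) * a \<eta> + ennreal (R powr (-\<sigma>)) * a (\<xi> - \<eta>)) + (b \<eta> + b (\<xi> - \<eta>))" for \<eta>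
    proof -
      have tri: "2 * R \<le> norm \<eta> + norm (\<xi> - \<eta>)"
        using norm_triangle_ineq[of \<eta> "\<xi> - \<eta>"] by (simp add: R_def)
      consider "norm \<eta> \<le> R" | "norm (\<xi> - \<eta>) \<le> R" | "R < norm \<eta>" "R < norm (\<xi> - \<eta>)" by linarith
      then show ?thesis
      proof cases
        case 1
        then have "norm (\<xi> - \<eta>) powr (-\<sigma>) \<le> R powr (-\<sigma>)"
          using tri R s by (intro powr_mono2') auto
        then have "ennreal (norm (\<xi> - \<eta>) powr (-\<sigma>) * norm \<eta> powr (-\<sigma>)) \<le> ennreal (R powr (-\<sigma>) * norm \<eta> powr (-\<sigma>))"
          by (intro ennreal_leI mult_right_mono) auto
        also have "\<dots> = ennreal (R powr (-\<sigma>)) * a \<eta>" using 1 by (simp add: a_def ennreal_mult)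
        also have "\<dots> \<le> (ennreal (R powr (-\<sigma>)) * a \<eta> + ennreal (R powr (-\<sigma>)) * a (\<xi> - \<eta>)) + (b \<eta> + b (\<xi> - \<eta>))"
          by (simp add: add_increasing2 add.assoc)
        finally show ?thesis .
      next
        case 2
        then have "norm \<eta> powr (-\<sigma>) \<le> R powr (-\<sigma>)"
          using tri R s by (intro powr_mono2') auto
        then have "ennreal (norm (\<xi> - \<eta>) powr (-\<sigma>) * norm \<eta> powr (-\<sigma>)) \<le> ennreal (R powr (-\<sigma>) * norm (\<xi> - \<eta>) powr (-\<sigma>))"
          by (subst mult.commute) (intro ennreal_leI mult_right_mono, auto)
        also have "\<dots> = ennreal (R powr (-\<sigma>)) * a (\<xi> - \<eta>)" using 2 by (simp add: a_def ennreal_mult)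
        also have "\<dots> \<le> (ennreal (R powr (-\<sigma>)) * a \<eta> + ennreal (R powr (-\<sigma>)) * a (\<xi> - \<eta>)) + (b \<eta> + b (\<xi> - \<eta>))"
          by (simp add: add_increasing add_increasing2)
        finally show ?thesis .
      next
        case 3
        have "x * y \<le> x * x + y * y" if "0 \<le> x" "0 \<le> y" for x y :: real
        proof -
          have "2 * (x * y) \<le> x * x + y * y" using sum_squares_bound[of x y] by (simp add: power2_eq_square)
          moreover have "0 \<le> x * y" using that by simp
          ultimately show ?thesis by linarith
        qed
        moreover have "n powr (-\<sigma>) * n powr (-\<sigma>) = n powr (-(2*\<sigma>))" for n :: real
          by (simp add: powr_add[symmetric])
        ultimately have "norm (\<xi> - \<eta>) powr (-\<sigma>) * norm \<eta> powr (-\<sigma>) \<le> norm (\<xi> - \<eta>) powr (-(2*\<sigma>)) + norm \<eta> powr (-(2*\<sigma>))"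
          by (metis powr_ge_zero)
        then have "ennreal (norm (\<xi> - \<eta>) powr (-\<sigma>) * norm \<eta> powr (-\<sigma>)) \<le> ennreal (norm (\<xi> - \<eta>) powr (-(2*\<sigma>)) + norm \<eta> powr (-(2*\<sigma>)))"
          by (rule ennreal_leI)
        also have "\<dots> = b \<eta> + b (\<xi> - \<eta>)"
          using 3 by (simp add: b_def ennreal_plus[symmetric] add.commute del: ennreal_plus)
        also have "\<dots> \<le> (ennreal (R powr (-\<sigma>)) * a \<eta> + ennreal (R powr (-\<sigma>)) * a (\<xi> - \<eta>)) + (b \<eta> + b (\<xi> - \<eta>))"
          by (simp add: add_increasing)
        finally show ?thesis .
      qed
    qed
    have "(\<integral>\<^sup>+\<eta>. ennreal (norm (\<xi> - \<eta>) powr (-\<sigma>) * norm \<eta> powr (-\<sigma>)) \<partial>lborel)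
      \<le> (\<integral>\<^sup>+\<eta>. (ennreal (R powr (-\<sigma>)) * a \<eta> + ennreal (R powr (-\<sigma>)) * a (\<xi> - \<eta>)) + (b \<eta> + b (\<xi> - \<eta>)) \<partial>lborel)"
      by (intro nn_integral_mono pw)
    also have "\<dots> = (ennreal (R powr (-\<sigma>)) * integral\<^sup>N lborel a + ennreal (R powr (-\<sigma>)) * integral\<^sup>N lborel a)
        + (integral\<^sup>N lborel b + integral\<^sup>N lborel b)"
      by (simp add: nn_integral_add nn_integral_cmult nn_integral_reflect)
    also have "\<dots> \<le> (ennreal (R powr (-\<sigma>)) * ennreal (C1 * R powr (3 - \<sigma>)) + ennreal (R powr (-\<sigma>)) * ennreal (C1 * R powr (3 - \<sigma>)))
        + (ennreal (C2 * R powr (3 - 2*\<sigma>)) + ennreal (C2 * R powr (3 - 2*\<sigma>)))"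
      using C1(2)[OF R] C2(2)[OF R] unfolding a_def b_def
      by (intro add_mono mult_left_mono) auto
    also have "\<dots> = ennreal (2 * (C1 + C2) * R powr (3 - 2*\<sigma>))"
    proof -
      have "R powr (-\<sigma>) * (C1 * R powr (3 - \<sigma>)) = C1 * R powr (3 - 2 * \<sigma>)"
        by (simp add: powr_add[symmetric])
      then show ?thesis using C1(1) C2(1)
        by (simp add: ennreal_mult[symmetric] ennreal_plus[symmetric] algebra_simps del: ennreal_plus)
    qed
    also have "\<dots> \<le> ennreal (C * norm \<xi> powr (3 - 2*\<sigma>))"
    proof (rule ennreal_leI)
      have "R powr (3 - 2*\<sigma>) = (1/2) powr (3 - 2*\<sigma>) * norm \<xi> powr (3 - 2*\<sigma>)"
        unfolding R_def by (simp add: powr_mult[symmetric])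
      then show "2 * (C1 + C2) * R powr (3 - 2*\<sigma>) \<le> C * norm \<xi> powr (3 - 2*\<sigma>)"
        by (simp add: C_def distrib_right)
    qed
    finally show ?thesis .
  qed
  ultimately show ?thesis by blast
qed

section \<open>Hoelder's inequality and the weighted convolution estimate\<close>

lemma ennreal_powr_ennreal: "0 \<le> x \<Longrightarrow> ennreal_powr (ennreal x) a = ennreal (x powr a)"
  by (simp add: ennreal_powr_def)

lemma ennreal_powr_mono: "0 \<le> a \<Longrightarrow> x \<le> y \<Longrightarrow> ennreal_powr x a \<le> ennreal_powr y a"
  by (cases x; cases y) (auto simp: ennreal_powr_def top_unique intro!: powr_mono2)

text \<open>Hoelder's inequality raised to the power \<open>p\<close>, with the second integral
  allowed to be infinite. In the main case Young's inequality is applied to \<open>a x / u\<close>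
  and \<open>b x / w\<close>, where \<open>u\<close> and \<open>w\<close> normalise the power
  integrals to at most 1.\<close>

lemma holder_power:
  fixes a b :: "'a \<Rightarrow> real"
  assumes pq: "1 < p" "q = p / (p - 1)" and A: "0 < A"
    and ab: "\<And>x. 0 \<le> a x" "\<And>x. 0 \<le> b x"
    and [measurable]: "a \<in> borel_measurable M" "b \<in> borel_measurable M"
    and aA: "(\<integral>\<^sup>+x. ennreal (a x powr q) \<partial>M) \<le> ennreal A"
  shows "ennreal_powr (\<integral>\<^sup>+x. ennreal (a x * b x) \<partial>M) p \<le> ennreal (A powr (p / q)) * (\<integral>\<^sup>+x. ennreal (b x powr p) \<partial>M)"
proof -
  have q: "q > 1" unfolding pq(2) using pq(1) by (simp add: less_divide_eq)
  have conj: "1 / q + 1 / p = 1" unfolding pq(2) using pq(1) by (simp add: field_simps)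
  let ?I = "\<integral>\<^sup>+x. ennreal (b x powr p) \<partial>M"
  consider "?I = \<infinity>" | "?I = 0" | B where "?I = ennreal B" "B > 0"
    by (cases ?I) (auto simp: ennreal_eq_0_iff, force)
  then show ?thesis
  proof cases
    case 1
    then show ?thesis using A by (simp add: ennreal_mult_top)
  next
    case 2
    then have "AE x in M. ennreal (b x powr p) = 0" by (subst (asm) nn_integral_0_iff_AE) auto
    then have "AE x in M. ennreal (a x * b x) = 0" by eventually_elim (use ab in \<open>simp add: ennreal_eq_0_iff\<close>)
    then have "(\<integral>\<^sup>+x. ennreal (a x * b x) \<partial>M) = 0" by (subst nn_integral_0_iff_AE) auto
    then show ?thesis using pq by (simp add: ennreal_powr_def)
  next
    case 3
    define u where "u = A powr (1 / q)"
    define w where "w = B powr (1 / p)"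
    have u: "u > 0" "u powr q = A" using A q by (auto simp: u_def powr_powr)
    have w: "w > 0" "w powr p = B" using 3 pq by (auto simp: w_def powr_powr)
    have pw: "ennreal (a x * b x) \<le> ennreal (u * w / (q * A)) * ennreal (a x powr q) + ennreal (u * w / (p * B)) * ennreal (b x powr p)" for x
    proof -
      have "(a x / u) * (b x / w) \<le> (a x / u) powr q / q + (b x / w) powr p / p"
        using Youngs_inequality[of q p "a x / u" "b x / w"] q pq conj ab u w by simp
      also have "\<dots> = a x powr q / (q * A) + b x powr p / (p * B)"
        using ab u w by (simp add: powr_divide mult.commute)
      finally have "(u * w) * ((a x / u) * (b x / w)) \<le> (u * w) * (a x powr q / (q * A) + b x powr p / (p * B))"
        using u w by (intro mult_left_mono) auto
      then have "a x * b x \<le> u * w / (q * A) * a x powr q + u * w / (p * B) * b x powr p"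
        using u w by (simp add: distrib_left)
      then have "ennreal (a x * b x) \<le> ennreal (u * w / (q * A) * a x powr q + u * w / (p * B) * b x powr p)"
        by (rule ennreal_leI)
      also have "\<dots> = ennreal (u * w / (q * A)) * ennreal (a x powr q) + ennreal (u * w / (p * B)) * ennreal (b x powr p)"
        using u w A 3 q pq by (simp add: ennreal_mult[symmetric] ennreal_plus[symmetric] del: ennreal_plus)
      finally show ?thesis .
    qed
    have "(\<integral>\<^sup>+x. ennreal (a x * b x) \<partial>M) \<le> (\<integral>\<^sup>+x. ennreal (u * w / (q * A)) * ennreal (a x powr q) + ennreal (u * w / (p * B)) * ennreal (b x powr p) \<partial>M)"
      by (intro nn_integral_mono pw)
    also have "\<dots> = ennreal (u * w / (q * A)) * (\<integral>\<^sup>+x. ennreal (a x powr q) \<partial>M) + ennreal (u * w / (p * B)) * ?I"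
      by (simp add: nn_integral_add nn_integral_cmult)
    also have "\<dots> \<le> ennreal (u * w / (q * A)) * ennreal A + ennreal (u * w / (p * B)) * ennreal B"
      unfolding 3(1) by (intro add_mono mult_left_mono aA) auto
    also have "\<dots> = ennreal (u * w * (1 / q + 1 / p))"
      using u w A 3 q pq by (simp add: ennreal_mult[symmetric] ennreal_plus[symmetric] distrib_left del: ennreal_plus)
    also have "\<dots> = ennreal (u * w)" by (simp add: conj)
    finally have "ennreal_powr (\<integral>\<^sup>+x. ennreal (a x * b x) \<partial>M) p \<le> ennreal_powr (ennreal (u * w)) p"
      using pq by (intro ennreal_powr_mono) auto
    also have "\<dots> = ennreal (u powr p * w powr p)"
      using u w by (simp add: ennreal_powr_ennreal powr_mult)
    also have "u powr p = A powr (p / q)" by (simp add: u_def powr_powr)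
    also have "ennreal (A powr (p / q) * w powr p) = ennreal (A powr (p / q)) * ?I"
      using 3 by (simp add: w(2) ennreal_mult)
    finally show ?thesis .
  qed
qed

text \<open>The p-th power of the weighted norm. Without the root it is a plain integral of a
  nonnegative function, which is homogeneous of degree \<open>p\<close> and satisfies a
  quasi-triangle inequality.\<close>

definition wnorm :: "real \<Rightarrow> real \<Rightarrow> (real^3 \<Rightarrow> 'a :: real_normed_vector) \<Rightarrow> ennreal" where
  "wnorm s p v = (\<integral>\<^sup>+\<xi>. ennreal (norm \<xi> powr (s * p) * norm (v \<xi>) powr p) \<partial>lborel)"

definition nn_conv :: "(real^3 \<Rightarrow> real) \<Rightarrow> (real^3 \<Rightarrow> real) \<Rightarrow> real^3 \<Rightarrow> ennreal" where
  "nn_conv f g \<xi> = (\<integral>\<^sup>+\<eta>. ennreal (f (\<xi> - \<eta>) * g \<eta>) \<partial>lborel)"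

lemma nn_conv_borel [measurable]:
  assumes [measurable]: "f \<in> borel_measurable borel" "g \<in> borel_measurable borel"
  shows "nn_conv f g \<in> borel_measurable borel"
proof -
  have "(\<lambda>\<xi>. \<integral>\<^sup>+\<eta>. ennreal (f (\<xi> - \<eta>) * g \<eta>) \<partial>lborel) \<in> borel_measurable borel"
    by measurable
  then show ?thesis by (simp add: nn_conv_def[abs_def])
qed

text \<open>The exponent on the left is dictated by scaling.\<close>

theorem weighted_convolution_bound:
  assumes p: "1 < p" and s: "3 / 2 * (1 - 1 / p) < s" "s < 3 * (1 - 1 / p)"
  shows "\<exists>K>0. \<forall>f g. f \<in> borel_measurable borel \<longrightarrow> g \<in> borel_measurable borel \<longrightarrow> (\<forall>x. 0 \<le> f x) \<longrightarrow> (\<forall>x. 0 \<le> g x) \<longrightarrow>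
     (\<integral>\<^sup>+\<xi>. ennreal (norm \<xi> powr ((2 * s - 3 * (1 - 1 / p)) * p)) * ennreal_powr (nn_conv f g \<xi>) p \<partial>lborel)
       \<le> ennreal K * (wnorm s p f * wnorm s p g)"
proof -
  define q where "q = p / (p - 1)"
  have q: "q > 1" using p by (simp add: q_def field_simps)
  have q1: "1 - 1 / p = 1 / q" using p by (simp add: q_def field_simps)
  define \<sigma> where "\<sigma> = s * q"
  have sig: "3 / 2 < \<sigma>" "\<sigma> < 3" using s q unfolding q1 \<sigma>_def by (auto simp: field_simps)
  obtain C where C: "C > 0" "\<And>\<xi>::real^3. \<xi> \<noteq> 0 \<Longrightarrow>
     (\<integral>\<^sup>+\<eta>. ennreal (norm (\<xi> - \<eta>) powr (-\<sigma>) * norm \<eta> powr (-\<sigma>)) \<partial>lborel) \<le> ennreal (C * norm \<xi> powr (3 - 2 * \<sigma>))"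
    using riesz_kernel_convolution[OF sig] by blast
  define K where "K = C powr (p / q)"
  have "(\<integral>\<^sup>+\<xi>. ennreal (norm \<xi> powr ((2 * s - 3 * (1 - 1 / p)) * p)) * ennreal_powr (nn_conv f g \<xi>) p \<partial>lborel)
       \<le> ennreal K * (wnorm s p f * wnorm s p g)"
    if [measurable]: "f \<in> borel_measurable borel" "g \<in> borel_measurable borel" and nn: "\<And>x. 0 \<le> f x" "\<And>x. 0 \<le> g x" for f g
  proof -
    define F where "F x = norm x powr (s * p) * f x powr p" for x :: "real^3"
    define G where "G x = norm x powr (s * p) * g x powr p" for x :: "real^3"
    have [measurable]: "F \<in> borel_measurable borel" "G \<in> borel_measurable borel"
      unfolding F_def G_def by measurable
    have FG: "0 \<le> F x" "0 \<le> G x" for x by (auto simp: F_def G_def)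
    have pw: "ennreal (norm \<xi> powr ((2 * s - 3 * (1 - 1 / p)) * p)) * ennreal_powr (nn_conv f g \<xi>) p
       \<le> ennreal K * (\<integral>\<^sup>+\<eta>. ennreal (F (\<xi> - \<eta>)) * ennreal (G \<eta>) \<partial>lborel)" if xi: "\<xi> \<noteq> 0" for \<xi>
    proof -
      \<comment> \<open>Hoelder's inequality separates the inverse weights from the weighted
        functions: \<open>a powr q\<close> is the product of two Riesz kernels, and
        \<open>b powr p\<close> is a product of values of \<open>F\<close> and
        \<open>G\<close>.\<close>
      define a where "a \<eta> = norm (\<xi> - \<eta>) powr (-s) * norm \<eta> powr (-s)" for \<eta>
      define b where "b \<eta> = (norm (\<xi> - \<eta>) powr s * f (\<xi> - \<eta>)) * (norm \<eta> powr s * g \<eta>)" for \<eta>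
      have [measurable]: "a \<in> borel_measurable lborel" "b \<in> borel_measurable lborel"
        unfolding a_def b_def by measurable
      have "nn_conv f g \<xi> = (\<integral>\<^sup>+\<eta>. ennreal (a \<eta> * b \<eta>) \<partial>lborel)"
        unfolding nn_conv_def
      proof (rule nn_integral_cong_AE)
        \<comment> \<open>At \<open>\<eta> = 0\<close> and \<open>\<eta> = \<xi>\<close> the weights
          are 0 by convention and the factorisation can fail; these two points are
          discarded.\<close>
        show "AE \<eta> in lborel. ennreal (f (\<xi> - \<eta>) * g \<eta>) = ennreal (a \<eta> * b \<eta>)"
          using AE_lborel_singleton[of 0] AE_lborel_singleton[of \<xi>]
        proof eventually_elim
          case (elim \<eta>)
          have "norm (\<xi> - \<eta>) powr (-s) * norm (\<xi> - \<eta>) powr s = 1" "norm \<eta> powr (-s) * norm \<eta> powr s = 1"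
            using elim by (auto simp: powr_add[symmetric])
          moreover have "a \<eta> * b \<eta> = (norm (\<xi> - \<eta>) powr (-s) * norm (\<xi> - \<eta>) powr s)
              * (norm \<eta> powr (-s) * norm \<eta> powr s) * (f (\<xi> - \<eta>) * g \<eta>)"
            unfolding a_def b_def by (simp only: mult_ac)
          ultimately show ?case by simp
        qed
      qed
      moreover have "ennreal_powr (\<integral>\<^sup>+\<eta>. ennreal (a \<eta> * b \<eta>) \<partial>lborel) p
         \<le> ennreal ((C * norm \<xi> powr (3 - 2 * \<sigma>)) powr (p / q)) * (\<integral>\<^sup>+\<eta>. ennreal (b \<eta> powr p) \<partial>lborel)"
      proof (rule holder_power[OF p q_def])
        show "0 < C * norm \<xi> powr (3 - 2 * \<sigma>)" using C(1) xi by simp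
        show "0 \<le> a x" "0 \<le> b x" for x using nn by (auto simp: a_def b_def)
        have "a \<eta> powr q = norm (\<xi> - \<eta>) powr (-\<sigma>) * norm \<eta> powr (-\<sigma>)" for \<eta>
          by (simp add: a_def powr_mult powr_powr \<sigma>_def)
        then show "(\<integral>\<^sup>+x. ennreal (a x powr q) \<partial>lborel) \<le> ennreal (C * norm \<xi> powr (3 - 2 * \<sigma>))"
          using C(2)[OF xi] by simp
      qed measurable
      moreover have "(C * norm \<xi> powr (3 - 2 * \<sigma>)) powr (p / q) * norm \<xi> powr ((2 * s - 3 * (1 - 1 / p)) * p) = K"
      proof -
        \<comment> \<open>As \<open>\<sigma> = s * q\<close>, the power of \<open>norm \<xi>\<close>
          from the Riesz kernel cancels the outer weight exactly, and only the constant is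
          left.\<close>
        have "(3 - 2 * \<sigma>) * (p / q) + (2 * s - 3 * (1 - 1 / p)) * p = 0"
          unfolding q1 \<sigma>_def using q by (simp add: field_simps)
        then show ?thesis using C(1) xi
          by (simp add: powr_mult powr_powr K_def mult.assoc powr_add[symmetric])
      qed
      moreover have "ennreal (b \<eta> powr p) = ennreal (F (\<xi> - \<eta>)) * ennreal (G \<eta>)" for \<eta>
        using nn by (simp add: b_def F_def G_def powr_mult powr_powr ennreal_mult[symmetric])
      ultimately have "ennreal (norm \<xi> powr ((2 * s - 3 * (1 - 1 / p)) * p)) * ennreal_powr (nn_conv f g \<xi>) p
        \<le> ennreal (norm \<xi> powr ((2 * s - 3 * (1 - 1 / p)) * p)) * (ennreal ((C * norm \<xi> powr (3 - 2 * \<sigma>)) powr (p / q)) * (\<integral>\<^sup>+\<eta>. ennreal (F (\<xi> - \<eta>)) * ennreal (G \<eta>) \<partial>lborel))"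
        by (intro mult_left_mono) auto
      also have "\<dots> = ennreal ((C * norm \<xi> powr (3 - 2 * \<sigma>)) powr (p / q) * norm \<xi> powr ((2 * s - 3 * (1 - 1 / p)) * p)) * (\<integral>\<^sup>+\<eta>. ennreal (F (\<xi> - \<eta>)) * ennreal (G \<eta>) \<partial>lborel)"
        by (simp add: ennreal_mult mult_ac)
      finally show ?thesis
        unfolding \<open>(C * norm \<xi> powr (3 - 2 * \<sigma>)) powr (p / q) * norm \<xi> powr ((2 * s - 3 * (1 - 1 / p)) * p) = K\<close> .
    qed
    \<comment> \<open>What remains is the integral of a convolution of two nonnegative functions;
      Tonelli and translation invariance turn it into the product of their integrals.\<close>
    have "(\<integral>\<^sup>+\<xi>. ennreal (norm \<xi> powr ((2 * s - 3 * (1 - 1 / p)) * p)) * ennreal_powr (nn_conv f g \<xi>) p \<partial>lborel)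
       \<le> (\<integral>\<^sup>+\<xi>. ennreal K * (\<integral>\<^sup>+\<eta>. ennreal (F (\<xi> - \<eta>)) * ennreal (G \<eta>) \<partial>lborel) \<partial>lborel)"
      by (intro nn_integral_mono_AE eventually_mono[OF AE_lborel_singleton[of 0]] pw)
    also have "\<dots> = ennreal K * (\<integral>\<^sup>+\<xi>. (\<integral>\<^sup>+\<eta>. ennreal (F (\<xi> - \<eta>)) * ennreal (G \<eta>) \<partial>lborel) \<partial>lborel)"
      by (rule nn_integral_cmult) measurable
    also have "(\<integral>\<^sup>+\<xi>. (\<integral>\<^sup>+\<eta>. ennreal (F (\<xi> - \<eta>)) * ennreal (G \<eta>) \<partial>lborel) \<partial>lborel)
       = (\<integral>\<^sup>+\<eta>. (\<integral>\<^sup>+\<xi>. ennreal (F (\<xi> - \<eta>)) * ennreal (G \<eta>) \<partial>lborel) \<partial>lborel)"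
      by (rule lborel_pair.Fubini') measurable
    also have "\<dots> = (\<integral>\<^sup>+\<eta>. wnorm s p f * ennreal (G \<eta>) \<partial>lborel)"
    proof (rule nn_integral_cong)
      fix \<eta>
      have "(\<integral>\<^sup>+\<xi>. ennreal (F (\<xi> - \<eta>)) * ennreal (G \<eta>) \<partial>lborel) = (\<integral>\<^sup>+\<xi>. ennreal (F (\<xi> - \<eta>)) \<partial>lborel) * ennreal (G \<eta>)"
        by (rule nn_integral_multc) measurable
      also have "(\<integral>\<^sup>+\<xi>. ennreal (F (\<xi> - \<eta>)) \<partial>lborel) = (\<integral>\<^sup>+\<xi>. ennreal (F \<xi>) \<partial>lborel)"
        by (rule nn_integral_translate) measurable
      finally show "(\<integral>\<^sup>+\<xi>. ennreal (F (\<xi> - \<eta>)) * ennreal (G \<eta>) \<partial>lborel) = wnorm s p f * ennreal (G \<eta>)"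
        using nn by (simp add: wnorm_def F_def)
    qed
    also have "\<dots> = wnorm s p f * wnorm s p g"
      using nn by (subst nn_integral_cmult) (auto simp: wnorm_def G_def)
    finally show ?thesis .
  qed
  moreover have "K > 0" using C(1) by (simp add: K_def)
  ultimately show ?thesis by blast
qed

subsection \<open>Fourier-Besov norms as weighted Lebesgue norms\<close>

lemma borel_vec_componentI:
  fixes v :: "'a \<Rightarrow> complex^3"
  assumes "\<And>m. (\<lambda>x. v x $ m) \<in> borel_measurable M"
  shows "v \<in> borel_measurable M"
proof (subst borel_measurable_euclidean_space, intro ballI)
  fix b :: "complex^3" assume "b \<in> Basis"
  then obtain m u where b: "b = axis m u" by (auto simp: Basis_vec_def)
  have [measurable]: "(\<lambda>x. v x $ m) \<in> borel_measurable M" by (rule assms)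
  have "(\<lambda>x. v x $ m \<bullet> u) \<in> borel_measurable M" by measurable
  then show "(\<lambda>x. v x \<bullet> b) \<in> borel_measurable M" by (simp add: b inner_axis)
qed

lemma borel_vec_component [measurable (raw)]:
  fixes v :: "'a \<Rightarrow> complex^3"
  assumes [measurable]: "v \<in> borel_measurable M"
  shows "(\<lambda>x. v x $ m) \<in> borel_measurable M"
proof -
  have "(\<lambda>w :: complex^3. w $ m) \<in> borel_measurable borel"
    by (intro borel_measurable_continuous_onI continuous_intros)
  from measurable_compose[OF assms this] show ?thesis by simp
qed

lemma norm_vector_smult: "norm (a *s v) = norm a * norm (v :: complex^3)"
  by (simp add: norm_vec_def norm_mult L2_set_right_distrib)

lemma ennreal_powr_inverse:
  assumes "p > 0"
  shows "ennreal_powr (ennreal_powr x (1 / p)) p = x" "ennreal_powr (ennreal_powr x p) (1 / p) = x"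
  using assms by (cases x; simp add: ennreal_powr_def powr_powr)+

lemma ennreal_powr_cmult:
  assumes "p > 0" "c > 0"
  shows "ennreal_powr (ennreal c * x) p = ennreal (c powr p) * ennreal_powr x p"
  using assms
  by (cases x) (auto simp: ennreal_powr_def ennreal_mult_top ennreal_mult_eq_top_iff ennreal_mult[symmetric] powr_mult)

section \<open>Overlap of the dyadic annuli\<close>

lemma powr_ratio_bounds:
  fixes x a :: real
  assumes "1 / 3 \<le> x" "x \<le> 3"
  shows "x powr a \<le> 3 powr \<bar>a\<bar>" "3 powr (- \<bar>a\<bar>) \<le> x powr a"
proof -
  have "\<bar>ln x\<bar> \<le> ln 3"
    using assms ln_le_cancel_iff[of x 3] ln_le_cancel_iff[of "1 / 3" x] by (simp add: ln_div abs_le_iff)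
  then have "\<bar>a * ln x\<bar> \<le> \<bar>a\<bar> * ln 3" by (simp add: abs_mult mult_left_mono)
  then show "x powr a \<le> 3 powr \<bar>a\<bar>" "3 powr (- \<bar>a\<bar>) \<le> x powr a"
    using assms by (auto simp: powr_def abs_le_iff)
qed

lemma littlewood_paley_support:
  assumes "littlewood_paley \<phi>" "\<phi> x \<noteq> 0"
  shows "3 / 4 \<le> norm x" "norm x \<le> 8 / 3"
proof -
  have "\<forall>x. \<phi> x \<noteq> 0 \<longrightarrow> 3 / 4 \<le> norm x \<and> norm x \<le> 8 / 3"
    using assms(1) unfolding littlewood_paley_def by (elim conjE)
  with assms(2) show "3 / 4 \<le> norm x" "norm x \<le> 8 / 3" by blast+
qed

lemma norm_dyadic_scaling: "norm ((2 powi (- j)) *\<^sub>R (\<xi> :: real^3)) = 2 powr (- real_of_int j) * norm \<xi>"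
proof -
  have "2 powr (real_of_int (- j)) = (2::real) powi (- j)" by (rule powr_real_of_int') auto
  then show ?thesis unfolding norm_scaleR by (metis abs_of_nonneg of_int_minus powr_ge_zero)
qed

text \<open>The ratio of the radii of the annulus is \<open>32 / 9 < 4\<close>, so dilates by two or
  more powers of 2 are disjoint.\<close>

lemma dyadic_nonzero_neighbours:
  assumes lp: "littlewood_paley \<phi>" and jk: "dyadic \<phi> j \<xi> \<noteq> 0" "dyadic \<phi> k \<xi> \<noteq> 0"
  shows "\<bar>j - k\<bar> \<le> 1"
proof (rule ccontr)
  have *: "3 / 4 \<le> 2 powr (- real_of_int i) * norm \<xi> \<and> 2 powr (- real_of_int i) * norm \<xi> \<le> 8 / 3" if "dyadic \<phi> i \<xi> \<noteq> 0" for i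
    using littlewood_paley_support[OF lp that[unfolded dyadic_def]] unfolding norm_dyadic_scaling by simp
  have aux: False if "dyadic \<phi> i \<xi> \<noteq> 0" "dyadic \<phi> i' \<xi> \<noteq> 0" "i + 2 \<le> i'" for i i'
  proof -
    have "2 powr (- real_of_int i) = 2 powr (real_of_int i' - real_of_int i) * 2 powr (- real_of_int i')"
      by (simp add: powr_add[symmetric])
    moreover have "(2::real) powr 2 \<le> 2 powr (real_of_int i' - real_of_int i)"
      using that(3) by (intro powr_mono) auto
    then have "4 \<le> (2::real) powr (real_of_int i' - real_of_int i)" by simp
    then have "4 * (2 powr (- real_of_int i') * norm \<xi>) \<le> 2 powr (real_of_int i' - real_of_int i) * (2 powr (- real_of_int i') * norm \<xi>)"
      by (intro mult_right_mono) auto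
    ultimately have "4 * (2 powr (- real_of_int i') * norm \<xi>) \<le> 2 powr (- real_of_int i) * norm \<xi>"
      by (simp add: mult.assoc)
    with *[OF that(1)] *[OF that(2)] show False by linarith
  qed
  assume "\<not> \<bar>j - k\<bar> \<le> 1"
  then have "j + 2 \<le> k \<or> k + 2 \<le> j" by linarith
  then show False using aux jk by blast
qed

text \<open>The annulus gives the bounds 3/8 and 4/3. They are relaxed to 1/3 and 3, which are
  symmetric under inversion, so that \<open>powr_ratio_bounds\<close> can treat exponents of either
  sign alike.\<close>

lemma dyadic_scale:
  assumes lp: "littlewood_paley \<phi>" and j: "dyadic \<phi> j \<xi> \<noteq> 0"
  shows "1 / 3 \<le> 2 powr (real_of_int j) / norm \<xi>" "2 powr (real_of_int j) / norm \<xi> \<le> 3" "\<xi> \<noteq> 0"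
proof -
  have *: "3 / 4 \<le> norm \<xi> / 2 powr (real_of_int j)" "norm \<xi> / 2 powr (real_of_int j) \<le> 8 / 3"
    using littlewood_paley_support[OF lp j[unfolded dyadic_def]] unfolding norm_dyadic_scaling
    by (simp_all add: powr_minus_divide)
  then show "\<xi> \<noteq> 0" by auto
  then show "1 / 3 \<le> 2 powr (real_of_int j) / norm \<xi>" "2 powr (real_of_int j) / norm \<xi> \<le> 3"
    using * by (simp_all add: divide_simps)
qed

text \<open>At most the indices \<open>k - 1\<close>, \<open>k\<close> and \<open>k + 1\<close>
  contribute to a sum equal to 1, so one of these terms has modulus at least 1/3; this pigeonhole
  argument allows complex values. The window is centred at that term instead of \<open>k\<close>,
  hence the width 2 on each side.\<close>

lemma dyadic_large:
  assumes lp: "littlewood_paley \<phi>" and xi: "\<xi> \<noteq> 0"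
  obtains j where "1 / 3 \<le> norm (dyadic \<phi> j \<xi>)" "\<And>i. dyadic \<phi> i \<xi> \<noteq> 0 \<Longrightarrow> i \<in> {j - 2..j + 2}"
proof -
  have hs: "((\<lambda>j. dyadic \<phi> j \<xi>) has_sum 1) UNIV" using lp xi by (simp add: littlewood_paley_def)
  have "\<exists>j. dyadic \<phi> j \<xi> \<noteq> 0"
  proof (rule ccontr)
    assume "\<not> ?thesis"
    then have "((\<lambda>j. dyadic \<phi> j \<xi>) has_sum 0) UNIV" by (intro has_sum_0) auto
    with hs show False using has_sum_unique by fastforce
  qed
  then obtain k where k: "dyadic \<phi> k \<xi> \<noteq> 0" by blast
  have near: "i \<in> {k - 1..k + 1}" if "dyadic \<phi> i \<xi> \<noteq> 0" for i
    using dyadic_nonzero_neighbours[OF lp that k] by auto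
  have "((\<lambda>j. dyadic \<phi> j \<xi>) has_sum 1) {k - 1..k + 1}"
    by (rule has_sum_cong_neutral[THEN iffD1, OF _ _ _ hs]) (use near in auto)
  moreover have "((\<lambda>j. dyadic \<phi> j \<xi>) has_sum (\<Sum>j\<in>{k - 1..k + 1}. dyadic \<phi> j \<xi>)) {k - 1..k + 1}"
    by (intro has_sum_finite) auto
  ultimately have sum1: "(\<Sum>j\<in>{k - 1..k + 1}. dyadic \<phi> j \<xi>) = 1" by (rule has_sum_unique[symmetric])
  have "\<exists>j\<in>{k - 1..k + 1}. 1 / 3 \<le> norm (dyadic \<phi> j \<xi>)"
  proof (rule ccontr)
    assume "\<not> ?thesis"
    then have "norm (dyadic \<phi> j \<xi>) < 1 / 3" if "j \<in> {k - 1..k + 1}" for j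
      using that by (meson not_le)
    then have "(\<Sum>j\<in>{k - 1..k + 1}. norm (dyadic \<phi> j \<xi>)) < (\<Sum>j\<in>{k - 1..k + 1}. 1 / 3)"
      by (intro sum_strict_mono) (simp_all add: atLeastatMost_empty_iff)
    also have "\<dots> = 1" by simp
    finally show False using norm_sum[of "\<lambda>j. dyadic \<phi> j \<xi>" "{k - 1..k + 1}"] by (simp add: sum1)
  qed
  then obtain j where "j \<in> {k - 1..k + 1}" "1 / 3 \<le> norm (dyadic \<phi> j \<xi>)" by blast
  with near that[of j] show ?thesis by fastforce
qed

text \<open>The weight that appears when the sum over \<open>j\<close> is carried out inside the
  integral over \<xi>.\<close>

definition fb_weight :: "(real^3 \<Rightarrow> complex) \<Rightarrow> real \<Rightarrow> real \<Rightarrow> real^3 \<Rightarrow> ennreal" where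
  "fb_weight \<phi> s p \<xi> = (\<integral>\<^sup>+j. ennreal (2 powr (real_of_int j * s * p) * norm (dyadic \<phi> j \<xi>) powr p) \<partial>count_space UNIV)"

lemma fb_weight_bounds:
  assumes lp: "littlewood_paley \<phi>" and p: "p > 0"
  shows "\<exists>a>0. \<exists>b>0. \<forall>\<xi>. \<xi> \<noteq> 0 \<longrightarrow>
     ennreal (a * norm \<xi> powr (s * p)) \<le> fb_weight \<phi> s p \<xi> \<and> fb_weight \<phi> s p \<xi> \<le> ennreal (b * norm \<xi> powr (s * p))"
proof -
  have phi: "\<phi> \<in> schwartz" using lp by (simp add: littlewood_paley_def)
  define B where "B = schwartz_norm 0 \<phi> + 1"
  have B: "norm (dyadic \<phi> j \<xi>) \<le> B" "B > 0" for j \<xi>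
    using schwartz_bounded[OF phi, of "(2 powi (- j)) *\<^sub>R \<xi>"] schwartz_norm_nonneg[OF phi, of 0] by (auto simp: B_def dyadic_def)
  define K where "K = 3 powr \<bar>s * p\<bar>"
  have K: "K > 0" by (simp add: K_def)
  have scale: "2 powr (real_of_int j * s * p) \<le> K * norm \<xi> powr (s * p)"
    "inverse K * norm \<xi> powr (s * p) \<le> 2 powr (real_of_int j * s * p)" if "dyadic \<phi> j \<xi> \<noteq> 0" for j \<xi>
  proof -
    note d = dyadic_scale[OF lp that]
    have "(2 powr (real_of_int j) / norm \<xi>) powr (s * p) = 2 powr (real_of_int j * s * p) / norm \<xi> powr (s * p)"
      by (simp add: powr_divide powr_powr mult.assoc)
    moreover have "0 < norm \<xi> powr (s * p)" using d(3) by simp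
    ultimately show "2 powr (real_of_int j * s * p) \<le> K * norm \<xi> powr (s * p)"
       "inverse K * norm \<xi> powr (s * p) \<le> 2 powr (real_of_int j * s * p)"
      using powr_ratio_bounds[OF d(1,2), of "s * p"] by (simp_all add: K_def powr_minus field_simps)
  qed
  \<comment> \<open>\<open>a\<close> retains the single large term found by
    \<open>dyadic_large\<close>; the 5 in \<open>b\<close> counts the indices in its window.\<close>
  define a where "a = inverse K * (1 / 3) powr p"
  define b where "b = 5 * (K * B powr p)"
  have "ennreal (a * norm \<xi> powr (s * p)) \<le> fb_weight \<phi> s p \<xi>"
    "fb_weight \<phi> s p \<xi> \<le> ennreal (b * norm \<xi> powr (s * p))" if xi: "\<xi> \<noteq> 0" for \<xi>
  proof -
    obtain j where j: "1 / 3 \<le> norm (dyadic \<phi> j \<xi>)" and near: "\<And>i. dyadic \<phi> i \<xi> \<noteq> 0 \<Longrightarrow> i \<in> {j - 2..j + 2}"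
      using dyadic_large[OF lp xi] by blast
    have j0: "dyadic \<phi> j \<xi> \<noteq> 0" using j by auto
    have "(inverse K * norm \<xi> powr (s * p)) * (1 / 3) powr p \<le> 2 powr (real_of_int j * s * p) * norm (dyadic \<phi> j \<xi>) powr p"
      using j j0 p K scale(2)[of j \<xi>] by (intro mult_mono powr_mono2) auto
    then have "ennreal (a * norm \<xi> powr (s * p)) \<le> ennreal (2 powr (real_of_int j * s * p) * norm (dyadic \<phi> j \<xi>) powr p)"
      by (intro ennreal_leI) (simp add: a_def mult_ac)
    also have "\<dots> \<le> fb_weight \<phi> s p \<xi>" unfolding fb_weight_def by (rule nn_integral_ge_point) simp
    finally show "ennreal (a * norm \<xi> powr (s * p)) \<le> fb_weight \<phi> s p \<xi>" .
    have "fb_weight \<phi> s p \<xi> = (\<Sum>i\<in>{j - 2..j + 2}. ennreal (2 powr (real_of_int i * s * p) * norm (dyadic \<phi> i \<xi>) powr p))"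
      unfolding fb_weight_def
    proof (rule nn_integral_count_space')
      fix i assume "i \<notin> {j - 2..j + 2}"
      then have "dyadic \<phi> i \<xi> = 0" using near by blast
      then show "ennreal (2 powr (real_of_int i * s * p) * norm (dyadic \<phi> i \<xi>) powr p) = 0" using p by simp
    qed auto
    also have "\<dots> \<le> (\<Sum>i\<in>{j - 2..j + 2}. ennreal ((K * norm \<xi> powr (s * p)) * B powr p))"
    proof (intro sum_mono ennreal_leI)
      fix i
      show "2 powr (real_of_int i * s * p) * norm (dyadic \<phi> i \<xi>) powr p \<le> (K * norm \<xi> powr (s * p)) * B powr p"
      proof (cases "dyadic \<phi> i \<xi> = 0")
        case False
        then show ?thesis using scale(1)[of i \<xi>] B p K by (intro mult_mono powr_mono2) auto
      qed (use p K in simp)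
    qed
    also have "\<dots> = ennreal (b * norm \<xi> powr (s * p))"
      using K by (simp add: b_def ennreal_of_nat_eq_real_of_nat ennreal_mult[symmetric] mult_ac flip: ennreal_numeral)
    finally show "fb_weight \<phi> s p \<xi> \<le> ennreal (b * norm \<xi> powr (s * p))" .
  qed
  moreover have "a > 0" "b > 0" using K B(2) by (auto simp: a_def b_def)
  ultimately show ?thesis by blast
qed

lemma fb_norm_eq:
  assumes lp: "littlewood_paley \<phi>" and p: "p > 0" and [measurable]: "fourier_fun f \<in> borel_measurable borel"
  shows "fb_norm \<phi> s p p f = ennreal_powr (\<integral>\<^sup>+\<xi>. fb_weight \<phi> s p \<xi> * ennreal (norm (fourier_fun f \<xi>) powr p) \<partial>lborel) (1 / p)"
proof -
  have phi [measurable]: "\<phi> \<in> borel_measurable borel"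
    using lp by (intro schwartz_borel) (simp add: littlewood_paley_def)
  have [measurable]: "dyadic \<phi> j \<in> borel_measurable borel" for j
    unfolding dyadic_def[abs_def] by measurable
  let ?v = "fourier_fun f"
  have "ennreal_powr (ennreal (2 powr (of_int j * s)) * Lp_norm lborel p (\<lambda>\<xi>. ennreal (norm (dyadic \<phi> j \<xi> *s ?v \<xi>)))) p
     = (\<integral>\<^sup>+\<xi>. ennreal (2 powr (of_int j * s * p) * norm (dyadic \<phi> j \<xi>) powr p) * ennreal (norm (?v \<xi>) powr p) \<partial>lborel)" for j
  proof -
    have "ennreal_powr (ennreal (2 powr (of_int j * s)) * Lp_norm lborel p (\<lambda>\<xi>. ennreal (norm (dyadic \<phi> j \<xi> *s ?v \<xi>)))) p
      = ennreal (2 powr (of_int j * s * p)) * (\<integral>\<^sup>+\<xi>. ennreal_powr (ennreal (norm (dyadic \<phi> j \<xi> *s ?v \<xi>))) p \<partial>lborel)"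
      using p by (simp add: Lp_norm_def ennreal_powr_cmult ennreal_powr_inverse powr_powr)
    also have "\<dots> = (\<integral>\<^sup>+\<xi>. ennreal (2 powr (of_int j * s * p)) * ennreal (norm (dyadic \<phi> j \<xi>) powr p * norm (?v \<xi>) powr p) \<partial>lborel)"
      by (simp add: ennreal_powr_ennreal norm_vector_smult powr_mult nn_integral_cmult)
    finally show ?thesis by (simp add: ennreal_mult mult.assoc)
  qed
  then have "fb_norm \<phi> s p p f = ennreal_powr (\<integral>\<^sup>+j. (\<integral>\<^sup>+\<xi>. ennreal (2 powr (of_int j * s * p) * norm (dyadic \<phi> j \<xi>) powr p) * ennreal (norm (?v \<xi>) powr p) \<partial>lborel) \<partial>count_space UNIV) (1 / p)"
    by (simp add: fb_norm_def Lp_norm_def[of "count_space UNIV"])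
  also have "(\<integral>\<^sup>+j. (\<integral>\<^sup>+\<xi>. ennreal (2 powr (of_int j * s * p) * norm (dyadic \<phi> j \<xi>) powr p) * ennreal (norm (?v \<xi>) powr p) \<partial>lborel) \<partial>count_space UNIV)
     = (\<integral>\<^sup>+\<xi>. (\<integral>\<^sup>+j. ennreal (2 powr (of_int j * s * p) * norm (dyadic \<phi> j \<xi>) powr p) * ennreal (norm (?v \<xi>) powr p) \<partial>count_space UNIV) \<partial>lborel)"
    by (rule nn_integral_count_space_nn_integral[symmetric]) auto
  also have "\<dots> = (\<integral>\<^sup>+\<xi>. fb_weight \<phi> s p \<xi> * ennreal (norm (?v \<xi>) powr p) \<partial>lborel)"
    by (simp add: fb_weight_def nn_integral_multc)
  finally show ?thesis .
qed

text \<open>The lower bound converts assumptions in Fourier-Besov norms into weighted estimates, and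
  the upper bound returns the constructed solution to the Fourier-Besov space. Powers are compared
  because \<open>wnorm\<close> carries no root.\<close>

theorem fb_norm_wnorm:
  assumes lp: "littlewood_paley \<phi>" and p: "p > 0"
  shows "\<exists>a>0. \<exists>b>0. \<forall>f. fourier_fun f \<in> borel_measurable borel \<longrightarrow>
     ennreal a * wnorm s p (fourier_fun f) \<le> ennreal_powr (fb_norm \<phi> s p p f) p \<and>
     ennreal_powr (fb_norm \<phi> s p p f) p \<le> ennreal b * wnorm s p (fourier_fun f)"
proof -
  obtain a b where ab: "a > 0" "b > 0" and bd: "\<And>\<xi>. \<xi> \<noteq> 0 \<Longrightarrow> ennreal (a * norm \<xi> powr (s * p)) \<le> fb_weight \<phi> s p \<xi>"
     "\<And>\<xi>. \<xi> \<noteq> 0 \<Longrightarrow> fb_weight \<phi> s p \<xi> \<le> ennreal (b * norm \<xi> powr (s * p))"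
    using fb_weight_bounds[OF lp p, of s] by blast
  have "ennreal a * wnorm s p (fourier_fun f) \<le> ennreal_powr (fb_norm \<phi> s p p f) p \<and>
     ennreal_powr (fb_norm \<phi> s p p f) p \<le> ennreal b * wnorm s p (fourier_fun f)"
    if [measurable]: "fourier_fun f \<in> borel_measurable borel" for f
  proof -
    let ?v = "fourier_fun f"
    have eq: "ennreal_powr (fb_norm \<phi> s p p f) p = (\<integral>\<^sup>+\<xi>. fb_weight \<phi> s p \<xi> * ennreal (norm (?v \<xi>) powr p) \<partial>lborel)"
      using p by (simp add: fb_norm_eq[OF lp p that] ennreal_powr_inverse)
    have c: "ennreal c * wnorm s p ?v = (\<integral>\<^sup>+\<xi>. ennreal (c * norm \<xi> powr (s * p)) * ennreal (norm (?v \<xi>) powr p) \<partial>lborel)" if "c > 0" for c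
      unfolding wnorm_def using that
      by (subst nn_integral_cmult[symmetric]) (auto simp: ennreal_mult mult.assoc)
    show ?thesis unfolding eq c[OF ab(1)] c[OF ab(2)]
      using bd by (auto intro!: nn_integral_mono_AE eventually_mono[OF AE_lborel_singleton[of 0]] mult_right_mono)
  qed
  with ab show ?thesis by blast
qed

section \<open>Vector fields of distributions and their Fourier functions\<close>

lemma fourier_fun_has:
  assumes "\<And>m. \<exists>g. has_fourier_fun (f $ m) g"
  shows "has_fourier_fun (f $ m) (\<lambda>\<xi>. fourier_fun f \<xi> $ m)"
proof -
  have "has_fourier_fun (f $ m) (SOME g. has_fourier_fun (f $ m) g)"
    using assms by (rule someI_ex)
  then show ?thesis by (simp add: fourier_fun_def)
qed

lemma fourier_fun_borel:
  assumes "\<And>m. \<exists>g. has_fourier_fun (f $ m) g"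
  shows "fourier_fun f \<in> borel_measurable borel"
  using fourier_fun_has[OF assms] by (intro borel_vec_componentI locally_integrable_borel) (auto simp: has_fourier_fun_def)

lemma fourier_fun_AE_unique:
  assumes "\<And>m. has_fourier_fun (f $ m) (\<lambda>\<xi>. v \<xi> $ m)"
  shows "AE \<xi> in lborel. fourier_fun f \<xi> = v \<xi>"
proof -
  have "AE \<xi> in lborel. fourier_fun f \<xi> $ m = v \<xi> $ m" for m
    using has_fourier_fun_unique[OF fourier_fun_has assms] assms by blast
  then have "AE \<xi> in lborel. \<forall>m\<in>UNIV. fourier_fun f \<xi> $ m = v \<xi> $ m"
    by (intro AE_finite_allI) auto
  then show ?thesis by eventually_elim (simp add: vec_eq_iff)
qed

lemma tempered_vector_eqI:
  fixes u u' :: "tempered^3"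
  assumes "\<And>m. \<exists>g. has_fourier_fun (u $ m) g" "\<And>m. \<exists>g. has_fourier_fun (u' $ m) g"
    and ae: "AE \<xi> in lborel. fourier_fun u \<xi> = fourier_fun u' \<xi>"
  shows "u = u'"
proof (subst vec_eq_iff, rule allI)
  fix m
  show "u $ m = u' $ m"
    by (rule tempered_eq_if_fourier_AE_eq[OF fourier_fun_has fourier_fun_has])
       (use assms in \<open>auto elim!: eventually_mono\<close>)
qed

text \<open>Young's inequality splits \<open>norm (v \<xi>)\<close> times the decay factor into the
  integrand of \<open>wnorm\<close> and a term with \<open>norm \<xi> powr (-(s * q))\<close>. The
  latter is integrable at the origin because \<open>s * q < 3\<close>, which is the upper bound on
  \<open>s\<close>, and at infinity thanks to the decay factor. Thus \<open>tempered_exists\<close>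
  applies to each component.\<close>

theorem tempered_vector_exists:
  fixes v :: "real^3 \<Rightarrow> complex^3"
  assumes [measurable]: "v \<in> borel_measurable borel" and p: "1 < p" and s: "0 < s" "s < 3 * (1 - 1 / p)"
    and fin: "wnorm s p v < \<infinity>"
  obtains u :: "tempered^3" where "\<And>m. has_fourier_fun (u $ m) (\<lambda>\<xi>. v \<xi> $ m)"
proof -
  define q where "q = p / (p - 1)"
  have q: "q > 1" using p by (simp add: q_def less_divide_eq)
  have conj: "1 / p + 1 / q = 1" using p by (simp add: q_def field_simps)
  have q1: "1 - 1 / p = 1 / q" using conj by simp
  have sq: "0 \<le> s * q" "s * q < 3" using s q unfolding q1 by (auto simp: field_simps)
  obtain C where "\<forall>R>0. (\<integral>\<^sup>+(x::real^3). ennreal (indicator (cball 0 R) x * norm x powr (-(s * q))) \<partial>lborel)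
      \<le> ennreal (C * R powr (3 - s * q))"
    using integral_singular_ball[OF sq] by blast
  from this[rule_format, of 1]
  have C: "(\<integral>\<^sup>+(x::real^3). ennreal (indicator (cball 0 1) x * norm x powr (-(s * q))) \<partial>lborel) \<le> ennreal C"
    by simp
  have pw: "ennreal (norm (v \<xi>) / (1 + norm \<xi>) ^ 4) \<le> ennreal (norm \<xi> powr (s * p) * norm (v \<xi>) powr p)
      + (ennreal (indicator (cball 0 1) \<xi> * norm \<xi> powr (-(s * q))) + ennreal (1 / (1 + norm \<xi>) ^ 4))" if xi: "\<xi> \<noteq> 0" for \<xi>
  proof -
    define w where "w = 1 / (1 + norm \<xi>) ^ 4"
    have "0 < (1 + norm \<xi>) ^ 4" by (intro zero_less_power) (simp add: add_pos_nonneg)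
    then have w: "0 < w" "w \<le> 1"
      using one_le_power[of "1 + norm \<xi>" 4] unfolding w_def by (simp_all add: divide_le_eq)
    let ?a = "norm \<xi> powr s * norm (v \<xi>)" and ?b = "norm \<xi> powr (-s) * w"
    have "?a * ?b = (norm \<xi> powr s * norm \<xi> powr (-s)) * (norm (v \<xi>) * w)" by (simp only: mult_ac)
    also have "\<dots> = norm (v \<xi>) / (1 + norm \<xi>) ^ 4" using xi by (simp add: powr_add[symmetric] w_def)
    finally have "norm (v \<xi>) / (1 + norm \<xi>) ^ 4 = ?a * ?b" ..
    also have "\<dots> \<le> ?a powr p / p + ?b powr q / q"
      using Youngs_inequality[of p q ?a ?b] p q conj w by simp
    also have "\<dots> \<le> ?a powr p + ?b powr q"
      using p q by (intro add_mono) (auto simp: divide_le_eq mult_le_cancel_left1 intro: order_trans)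
    also have "?a powr p = norm \<xi> powr (s * p) * norm (v \<xi>) powr p"
      by (simp add: powr_mult powr_powr)
    also have "?b powr q = norm \<xi> powr (-(s * q)) * w powr q"
      using w by (simp add: powr_mult powr_powr)
    also have "\<dots> \<le> indicator (cball 0 1) \<xi> * norm \<xi> powr (-(s * q)) + w"
    proof (cases "norm \<xi> \<le> 1")
      case True
      have "norm \<xi> powr (-(s * q)) * w powr q \<le> norm \<xi> powr (-(s * q)) * 1"
        using w q by (intro mult_left_mono powr_le1) auto
      then show ?thesis using True w by simp
    next
      case False
      have "norm \<xi> powr (-(s * q)) \<le> 1"
        using False powr_mono2'[of "-(s*q)" 1 "norm \<xi>"] sq by simp
      moreover have "w powr q \<le> w powr 1" using w q by (intro powr_mono') auto
      ultimately have "norm \<xi> powr (-(s * q)) * w powr q \<le> 1 * w"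
        using w by (intro mult_mono) auto
      then show ?thesis using False by simp
    qed
    finally have "ennreal (norm (v \<xi>) / (1 + norm \<xi>) ^ 4) \<le> ennreal (norm \<xi> powr (s * p) * norm (v \<xi>) powr p +
        (indicator (cball 0 1) \<xi> * norm \<xi> powr (-(s * q)) + w))"
      by (intro ennreal_leI) simp
    also have "\<dots> = ennreal (norm \<xi> powr (s * p) * norm (v \<xi>) powr p)
      + (ennreal (indicator (cball 0 1) \<xi> * norm \<xi> powr (-(s * q))) + ennreal w)"
      using w by (simp add: ennreal_plus)
    finally show ?thesis by (simp add: w_def)
  qed
  have "(\<integral>\<^sup>+\<xi>. ennreal (norm (v \<xi>) / (1 + norm \<xi>) ^ 4) \<partial>lborel) \<le> (\<integral>\<^sup>+\<xi>. ennreal (norm \<xi> powr (s * p) * norm (v \<xi>) powr p)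
      + (ennreal (indicator (cball 0 1) \<xi> * norm \<xi> powr (-(s * q))) + ennreal (1 / (1 + norm \<xi>) ^ 4)) \<partial>lborel)"
    by (intro nn_integral_mono_AE eventually_mono[OF AE_lborel_singleton[of 0]] pw)
  also have "\<dots> = wnorm s p v + ((\<integral>\<^sup>+(\<xi>::real^3). ennreal (indicator (cball 0 1) \<xi> * norm \<xi> powr (-(s * q))) \<partial>lborel)
      + (\<integral>\<^sup>+(\<xi>::real^3). ennreal (1 / (1 + norm \<xi>) ^ 4) \<partial>lborel))"
    by (simp add: nn_integral_add wnorm_def)
  also have "\<dots> < \<infinity>"
  proof -
    have "(\<integral>\<^sup>+(\<xi>::real^3). ennreal (1 / (1 + norm \<xi>) ^ 4) \<partial>lborel) < \<infinity>"
      using integrableD(2)[OF integrable_decay4] by (simp add: less_top)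
    moreover have "(\<integral>\<^sup>+(\<xi>::real^3). ennreal (indicator (cball 0 1) \<xi> * norm \<xi> powr (-(s * q))) \<partial>lborel) < \<infinity>"
      by (rule le_less_trans[OF C]) simp
    ultimately show ?thesis using fin by (simp add: less_top[symmetric])
  qed
  finally have fin': "(\<integral>\<^sup>+\<xi>. ennreal (norm (v \<xi>) / (1 + norm \<xi>) ^ 4) \<partial>lborel) < \<infinity>" .
  have "\<exists>T. has_fourier_fun T (\<lambda>\<xi>. v \<xi> $ m)" for m
  proof -
    have "(\<integral>\<^sup>+\<xi>. ennreal (norm (v \<xi> $ m) / (1 + norm \<xi>) ^ 4) \<partial>lborel) \<le> (\<integral>\<^sup>+\<xi>. ennreal (norm (v \<xi>) / (1 + norm \<xi>) ^ 4) \<partial>lborel)"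
      by (intro nn_integral_mono ennreal_leI divide_right_mono Finite_Cartesian_Product.norm_nth_le) auto
    with fin' have "(\<integral>\<^sup>+\<xi>. ennreal (norm (v \<xi> $ m) / (1 + norm \<xi>) ^ 4) \<partial>lborel) < \<infinity>" by (rule le_less_trans[rotated])
    then show ?thesis using tempered_exists[of "\<lambda>\<xi>. v \<xi> $ m"] by auto
  qed
  then have "\<forall>m. \<exists>T. has_fourier_fun T (\<lambda>\<xi>. v \<xi> $ m)" by blast
  from choice[OF this] obtain T where "\<And>m. has_fourier_fun (T m) (\<lambda>\<xi>. v \<xi> $ m)" by blast
  then show ?thesis using that[of "\<chi> m. T m"] by simp
qed

subsection \<open>The semigroup and its resolvent\<close>

text \<open>Counts three rows and three columns. The constants below stem from this: 9 for
  \<open>R_matrix\<close>, 18 for the Leray projector, whose entries are at most 2, and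
  \<open>10 = 1 + 9\<close> for the semigroup.\<close>

lemma matrix_vector_bound:
  fixes A :: "complex^3^3"
  assumes A: "\<And>i j. norm (A $ i $ j) \<le> c"
  shows "norm (A *v w) \<le> 9 * c * norm w"
proof -
  have comp: "norm ((A *v w) $ i) \<le> 3 * (c * norm w)" for i
  proof -
    have "norm ((A *v w) $ i) \<le> (\<Sum>j\<in>UNIV. norm (A $ i $ j * w $ j))"
      unfolding matrix_vector_mult_def by (simp add: norm_sum)
    also have "\<dots> \<le> (\<Sum>j\<in>(UNIV :: 3 set). c * norm w)"
      unfolding norm_mult using order_trans[OF norm_ge_zero A]
      by (intro sum_mono mult_mono A Finite_Cartesian_Product.norm_nth_le) auto
    finally show ?thesis by simp
  qed
  have "norm (A *v w) \<le> (\<Sum>i\<in>UNIV. norm ((A *v w) $ i))"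
    unfolding norm_vec_def by (rule L2_set_le_sum) simp
  also have "\<dots> \<le> (\<Sum>i\<in>(UNIV :: 3 set). 3 * (c * norm w))" by (intro sum_mono comp)
  finally show ?thesis by simp
qed

lemma scaleR_matrix_vector: "(c *\<^sub>R A) *v w = c *\<^sub>R (A *v w)" for A :: "complex^3^3"
  by (simp add: vec_eq_iff matrix_vector_mult_def scaleR_sum_right)

lemma matrix_vector_scaleR: "A *v (c *\<^sub>R w) = c *\<^sub>R (A *v w)" for A :: "complex^3^3"
  by (simp add: vec_eq_iff matrix_vector_mult_def scaleR_sum_right)

definition div_free :: "real^3 \<Rightarrow> complex^3 \<Rightarrow> bool" where
  "div_free \<xi> w \<longleftrightarrow> (\<Sum>k\<in>UNIV. of_real (\<xi> $ k) * w $ k) = 0"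

lemma R_matrix_apply:
  "(R_matrix \<xi> *v w) $ 1 = (of_real (\<xi> $ 3) * w $ 2 - of_real (\<xi> $ 2) * w $ 3) / of_real (norm \<xi>)"
  "(R_matrix \<xi> *v w) $ 2 = (of_real (\<xi> $ 1) * w $ 3 - of_real (\<xi> $ 3) * w $ 1) / of_real (norm \<xi>)"
  "(R_matrix \<xi> *v w) $ 3 = (of_real (\<xi> $ 2) * w $ 1 - of_real (\<xi> $ 1) * w $ 2) / of_real (norm \<xi>)"
  unfolding R_matrix_def scaleR_matrix_vector
  by (simp_all add: matrix_vector_mult_def sum_3 scaleR_conv_of_real[where 'a=complex])

lemma norm_squared_components: "(norm \<xi>)\<^sup>2 = \<xi> $ 1 * \<xi> $ 1 + \<xi> $ 2 * \<xi> $ 2 + \<xi> $ 3 * \<xi> $ 3" for \<xi> :: "real^3"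
  by (simp add: power2_norm_eq_inner inner_vec_def sum_3)

text \<open>On divergence-free vectors \<open>R\<close> is the rotation by a right angle around \<open>\<xi>\<close>.\<close>

lemma R_matrix_squared:
  assumes xi: "\<xi> \<noteq> 0" and w: "div_free \<xi> w"
  shows "R_matrix \<xi> *v (R_matrix \<xi> *v w) = - w"
proof -
  define n where "n = complex_of_real (norm \<xi>)"
  have n: "n \<noteq> 0" using xi by (simp add: n_def)
  define x y z where xyz: "x = complex_of_real (\<xi> $ 1)" "y = complex_of_real (\<xi> $ 2)" "z = complex_of_real (\<xi> $ 3)"
  have nn: "n * n = x * x + y * y + z * z"
    using arg_cong[OF norm_squared_components[of \<xi>], of complex_of_real] by (simp add: n_def xyz power2_eq_square)
  have d: "x * w $ 1 + y * w $ 2 + z * w $ 3 = 0" using w by (simp add: div_free_def sum_3 xyz)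
  have quot: "(c * (X / n) - e * (Y / n)) / n = (c * X - e * Y) / (n * n)" for c X e Y
    by (simp add: diff_divide_distrib)
  note comps = R_matrix_apply[of \<xi>, folded n_def, folded xyz]
  have 1: "(z * ((x * w $ 3 - z * w $ 1) / n) - y * ((y * w $ 1 - x * w $ 2) / n)) / n = - w $ 1"
  proof -
    have "z * (x * w $ 3 - z * w $ 1) - y * (y * w $ 1 - x * w $ 2) = x * (x * w $ 1 + y * w $ 2 + z * w $ 3) - (n * n) * w $ 1"
      unfolding nn by (simp add: algebra_simps)
    then have "z * (x * w $ 3 - z * w $ 1) - y * (y * w $ 1 - x * w $ 2) = - (n * n) * w $ 1" unfolding d by simp
    then show ?thesis unfolding quot using n by simp
  qed
  have 2: "(x * ((y * w $ 1 - x * w $ 2) / n) - z * ((z * w $ 2 - y * w $ 3) / n)) / n = - w $ 2"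
  proof -
    have "x * (y * w $ 1 - x * w $ 2) - z * (z * w $ 2 - y * w $ 3) = y * (x * w $ 1 + y * w $ 2 + z * w $ 3) - (n * n) * w $ 2"
      unfolding nn by (simp add: algebra_simps)
    then have "x * (y * w $ 1 - x * w $ 2) - z * (z * w $ 2 - y * w $ 3) = - (n * n) * w $ 2" unfolding d by simp
    then show ?thesis unfolding quot using n by simp
  qed
  have 3: "(y * ((z * w $ 2 - y * w $ 3) / n) - x * ((x * w $ 3 - z * w $ 1) / n)) / n = - w $ 3"
  proof -
    have "y * (z * w $ 2 - y * w $ 3) - x * (x * w $ 3 - z * w $ 1) = z * (x * w $ 1 + y * w $ 2 + z * w $ 3) - (n * n) * w $ 3"
      unfolding nn by (simp add: algebra_simps)
    then have "y * (z * w $ 2 - y * w $ 3) - x * (x * w $ 3 - z * w $ 1) = - (n * n) * w $ 3" unfolding d by simp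
    then show ?thesis unfolding quot using n by simp
  qed
  show ?thesis
    unfolding vec_eq_iff forall_3 comps using 1 2 3 by simp
qed

lemma R_matrix_norm: "norm (R_matrix \<xi> *v w) \<le> 9 * norm w"
proof -
  have "norm (R_matrix \<xi> $ i $ j) \<le> 1" for i j
  proof -
    have "\<bar>\<xi> $ k\<bar> / norm \<xi> \<le> 1" for k
      using component_le_norm_cart[of \<xi> k] by (simp add: divide_le_eq)
    then have "\<forall>i j. norm (R_matrix \<xi> $ i $ j) \<le> 1"
      unfolding forall_3 R_matrix_def by simp
    then show ?thesis by blast
  qed
  from matrix_vector_bound[of "R_matrix \<xi>", OF this] show ?thesis by simp
qed

lemma leray_norm: "norm (leray_symbol \<xi> *v w) \<le> 18 * norm w"
proof -
  have "norm (leray_symbol \<xi> $ i $ j) \<le> 2" for i j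
  proof -
    have "\<bar>\<xi> $ i * \<xi> $ j\<bar> \<le> norm \<xi> * norm \<xi>"
      unfolding abs_mult by (intro mult_mono component_le_norm_cart) auto
    then have "\<bar>\<xi> $ i * \<xi> $ j / (norm \<xi>)\<^sup>2\<bar> \<le> 1"
      unfolding abs_divide power2_eq_square by (simp add: divide_le_eq del: abs_mult)
    moreover have "\<bar>u\<bar> \<le> 1 \<Longrightarrow> \<bar>(if i = j then 1 else 0) - u\<bar> \<le> 2" for u :: real by auto
    ultimately have "\<bar>(if i = j then 1 else 0) - \<xi> $ i * \<xi> $ j / (norm \<xi>)\<^sup>2\<bar> \<le> 2" by blast
    then show ?thesis
      unfolding leray_symbol_def vec_lambda_beta norm_of_real .
  qed
  from matrix_vector_bound[of "leray_symbol \<xi>", OF this] show ?thesis by simp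
qed

lemma leray_div_free:
  assumes xi: "\<xi> \<noteq> 0"
  shows "div_free \<xi> (leray_symbol \<xi> *v w)"
proof -
  define n where "n = complex_of_real (norm \<xi>)"
  have n: "n \<noteq> 0" using xi by (simp add: n_def)
  define x y z where xyz: "x = complex_of_real (\<xi> $ 1)" "y = complex_of_real (\<xi> $ 2)" "z = complex_of_real (\<xi> $ 3)"
  have nn: "n * n = x * x + y * y + z * z"
    using arg_cong[OF norm_squared_components[of \<xi>], of complex_of_real] by (simp add: n_def xyz power2_eq_square)
  define d where "d = x * w $ 1 + y * w $ 2 + z * w $ 3"
  have c: "(leray_symbol \<xi> *v w) $ 1 = w $ 1 - x * d / (n * n)"
    "(leray_symbol \<xi> *v w) $ 2 = w $ 2 - y * d / (n * n)"
    "(leray_symbol \<xi> *v w) $ 3 = w $ 3 - z * d / (n * n)"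
    by (simp_all add: leray_symbol_def matrix_vector_mult_def sum_3 d_def n_def xyz power2_eq_square
        left_diff_distrib distrib_left add_divide_distrib mult.assoc)
  have "x * (w $ 1 - x * d / (n * n)) + y * (w $ 2 - y * d / (n * n)) + z * (w $ 3 - z * d / (n * n))
    = d - (x * x + y * y + z * z) * d / (n * n)"
    by (simp add: d_def algebra_simps add_divide_distrib)
  also have "\<dots> = 0" unfolding nn[symmetric] using n by simp
  finally show ?thesis by (simp add: div_free_def sum_3 c xyz)
qed

text \<open>With the rates \<open>a\<close> and \<open>b\<close> defined here and
  \<open>R^2 = -1\<close> on divergence-free vectors, the semigroup there is
  \<open>exp(-t (a - b R))\<close>. Its integral over the half-line is therefore the inverse of
  \<open>a - b R\<close>, that is \<open>(a + b R) / (a^2 + b^2)\<close>.\<close>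

definition heat_rate :: "real \<Rightarrow> real \<Rightarrow> real^3 \<Rightarrow> real" where
  "heat_rate \<nu> \<alpha> \<xi> = \<nu> * norm \<xi> powr (2 * \<alpha>)"

definition coriolis_rate :: "real \<Rightarrow> real^3 \<Rightarrow> real" where
  "coriolis_rate \<Omega> \<xi> = \<Omega> * (\<xi> $ 3 / norm \<xi>)"

text \<open>The time integral of the semigroup over the half-line, on divergence-free vectors.\<close>

definition resolvent :: "real \<Rightarrow> real \<Rightarrow> real \<Rightarrow> real^3 \<Rightarrow> complex^3 \<Rightarrow> complex^3" where
  "resolvent \<nu> \<alpha> \<Omega> \<xi> w = (1 / ((heat_rate \<nu> \<alpha> \<xi>)\<^sup>2 + (coriolis_rate \<Omega> \<xi>)\<^sup>2)) *\<^sub>R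
     (heat_rate \<nu> \<alpha> \<xi> *\<^sub>R w + coriolis_rate \<Omega> \<xi> *\<^sub>R (R_matrix \<xi> *v w))"

lemma semigroup_apply:
  "semigroup_symbol \<nu> \<alpha> \<Omega> t \<xi> *v x = exp (- (heat_rate \<nu> \<alpha> \<xi> * t)) *\<^sub>R
     (cos (coriolis_rate \<Omega> \<xi> * t) *\<^sub>R x + sin (coriolis_rate \<Omega> \<xi> * t) *\<^sub>R (R_matrix \<xi> *v x))"
  unfolding semigroup_symbol_def heat_rate_def coriolis_rate_def
  by (simp add: scaleR_matrix_vector matrix_vector_mult_add_rdistrib)

lemma semigroup_norm:
  "norm (semigroup_symbol \<nu> \<alpha> \<Omega> t \<xi> *v x) \<le> exp (- (heat_rate \<nu> \<alpha> \<xi> * t)) * (10 * norm x)"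
proof -
  let ?c = "cos (coriolis_rate \<Omega> \<xi> * t)" and ?s = "sin (coriolis_rate \<Omega> \<xi> * t)"
  have "norm (?c *\<^sub>R x + ?s *\<^sub>R (R_matrix \<xi> *v x)) \<le> \<bar>?c\<bar> * norm x + \<bar>?s\<bar> * norm (R_matrix \<xi> *v x)"
    by (rule order_trans[OF norm_triangle_ineq]) simp
  also have "\<dots> \<le> 1 * norm x + 1 * (9 * norm x)"
    by (intro add_mono mult_mono R_matrix_norm) auto
  finally show ?thesis by (simp add: semigroup_apply mult_left_mono)
qed

lemma semigroup_diff: "semigroup_symbol \<nu> \<alpha> \<Omega> t \<xi> *v (x - y) = semigroup_symbol \<nu> \<alpha> \<Omega> t \<xi> *v x - semigroup_symbol \<nu> \<alpha> \<Omega> t \<xi> *v y"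
  by (rule matrix_vector_mult_diff_distrib)

lemma resolvent_diff: "resolvent \<nu> \<alpha> \<Omega> \<xi> (x - y) = resolvent \<nu> \<alpha> \<Omega> \<xi> x - resolvent \<nu> \<alpha> \<Omega> \<xi> y"
  by (simp add: resolvent_def matrix_vector_mult_diff_distrib algebra_simps)

text \<open>Differentiation in time produces the operator \<open>-(a - b R)\<close>, which the
  resolvent inverts; \<open>e1\<close> and \<open>e2\<close> express this for the components along
  \<open>x\<close> and \<open>R x\<close>. The affine time \<open>c + d * \<tau>\<close> covers both
  \<open>S \<tau>\<close> and \<open>S (t - \<tau>)\<close> in the mild equation.\<close>

lemma semigroup_resolvent_derivative:
  assumes xi: "\<xi> \<noteq> 0" and nu: "\<nu> > 0" and w: "div_free \<xi> w"
  shows "((\<lambda>\<tau>. semigroup_symbol \<nu> \<alpha> \<Omega> (c + d * \<tau>) \<xi> *v resolvent \<nu> \<alpha> \<Omega> \<xi> w) has_vector_derivative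
      (- d) *\<^sub>R (semigroup_symbol \<nu> \<alpha> \<Omega> (c + d * \<tau>) \<xi> *v w)) (at \<tau> within X)"
proof -
  define a where "a = heat_rate \<nu> \<alpha> \<xi>"
  define b where "b = coriolis_rate \<Omega> \<xi>"
  define x where "x = resolvent \<nu> \<alpha> \<Omega> \<xi> w"
  define y where "y = R_matrix \<xi> *v x"
  have ab: "a\<^sup>2 + b\<^sup>2 > 0" using xi nu by (simp add: a_def heat_rate_def add_pos_nonneg)
  define k where "k = 1 / (a\<^sup>2 + b\<^sup>2)"
  have x: "x = k *\<^sub>R (a *\<^sub>R w + b *\<^sub>R (R_matrix \<xi> *v w))"
    by (simp add: x_def resolvent_def a_def b_def k_def)
  have y: "y = k *\<^sub>R (a *\<^sub>R (R_matrix \<xi> *v w) - b *\<^sub>R w)"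
    unfolding y_def x by (simp add: matrix_vector_scaleR matrix_vector_right_distrib R_matrix_squared[OF xi w])
  have k: "k * (a\<^sup>2 + b\<^sup>2) = 1" using ab by (auto simp: k_def)
  have e1: "a *\<^sub>R x - b *\<^sub>R y = w"
  proof -
    have "a *\<^sub>R x - b *\<^sub>R y = (k * (a\<^sup>2 + b\<^sup>2)) *\<^sub>R w"
      unfolding x y by (simp add: algebra_simps power2_eq_square)
    then show ?thesis by (simp add: k)
  qed
  have e2: "a *\<^sub>R y + b *\<^sub>R x = R_matrix \<xi> *v w"
  proof -
    have "a *\<^sub>R y + b *\<^sub>R x = (k * (a\<^sup>2 + b\<^sup>2)) *\<^sub>R (R_matrix \<xi> *v w)"
      unfolding x y by (simp add: algebra_simps power2_eq_square)
    then show ?thesis by (simp add: k)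
  qed
  define s where "s = c + d * \<tau>"
  define E where "E = exp (- (a * s))"
  have e: "((\<lambda>\<tau>. exp (- (a * (c + d * \<tau>)))) has_real_derivative - (a * d) * E) (at \<tau> within X)"
    by (auto intro!: derivative_eq_intros simp: E_def s_def)
  have "((\<lambda>\<tau>. cos (b * (c + d * \<tau>))) has_real_derivative - (b * d) * sin (b * s)) (at \<tau> within X)"
    by (auto intro!: derivative_eq_intros simp: s_def)
  from has_vector_derivative_scaleR[OF this has_vector_derivative_const[of x]]
  have c: "((\<lambda>\<tau>. cos (b * (c + d * \<tau>)) *\<^sub>R x) has_vector_derivative (- (b * d) * sin (b * s)) *\<^sub>R x) (at \<tau> within X)" by simp
  have "((\<lambda>\<tau>. sin (b * (c + d * \<tau>))) has_real_derivative (b * d) * cos (b * s)) (at \<tau> within X)"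
    by (auto intro!: derivative_eq_intros simp: s_def)
  from has_vector_derivative_scaleR[OF this has_vector_derivative_const[of y]]
  have "((\<lambda>\<tau>. sin (b * (c + d * \<tau>)) *\<^sub>R y) has_vector_derivative ((b * d) * cos (b * s)) *\<^sub>R y) (at \<tau> within X)" by simp
  note cs = has_vector_derivative_add[OF c this]
  have "((\<lambda>\<tau>. exp (- (a * (c + d * \<tau>))) *\<^sub>R (cos (b * (c + d * \<tau>)) *\<^sub>R x + sin (b * (c + d * \<tau>)) *\<^sub>R y)) has_vector_derivative
     E *\<^sub>R ((- (b * d) * sin (b * s)) *\<^sub>R x + ((b * d) * cos (b * s)) *\<^sub>R y) + (- (a * d) * E) *\<^sub>R (cos (b * s) *\<^sub>R x + sin (b * s) *\<^sub>R y)) (at \<tau> within X)"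
    using has_vector_derivative_scaleR[OF e cs] unfolding s_def[symmetric] E_def[symmetric] .
  moreover have "E *\<^sub>R ((- (b * d) * sin (b * s)) *\<^sub>R x + ((b * d) * cos (b * s)) *\<^sub>R y) + (- (a * d) * E) *\<^sub>R (cos (b * s) *\<^sub>R x + sin (b * s) *\<^sub>R y)
     = (- d) *\<^sub>R (E *\<^sub>R (cos (b * s) *\<^sub>R (a *\<^sub>R x - b *\<^sub>R y) + sin (b * s) *\<^sub>R (a *\<^sub>R y + b *\<^sub>R x)))"
    by (simp add: algebra_simps)
  ultimately show ?thesis
    unfolding semigroup_apply e1 e2 a_def[symmetric] b_def[symmetric] x_def[symmetric] y_def[symmetric] s_def[symmetric] E_def[symmetric]
    by (simp add: s_def)
qed

lemma semigroup_continuous: "continuous_on X (\<lambda>\<tau>. semigroup_symbol \<nu> \<alpha> \<Omega> (c + d * \<tau>) \<xi> *v w)"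
  unfolding semigroup_apply by (intro continuous_intros)

text \<open>The integral over the half-line minus its tail. The two integrals agree, since they
  differ by a reversal of time.\<close>

lemma semigroup_integral:
  assumes xi: "\<xi> \<noteq> 0" and nu: "\<nu> > 0" and w: "div_free \<xi> w" and t: "0 \<le> t"
  shows "(LINT \<tau>:{0..t}|lborel. semigroup_symbol \<nu> \<alpha> \<Omega> \<tau> \<xi> *v w)
      = resolvent \<nu> \<alpha> \<Omega> \<xi> w - semigroup_symbol \<nu> \<alpha> \<Omega> t \<xi> *v resolvent \<nu> \<alpha> \<Omega> \<xi> w"
    and "(LINT \<tau>:{0..t}|lborel. semigroup_symbol \<nu> \<alpha> \<Omega> (t - \<tau>) \<xi> *v w)
      = resolvent \<nu> \<alpha> \<Omega> \<xi> w - semigroup_symbol \<nu> \<alpha> \<Omega> t \<xi> *v resolvent \<nu> \<alpha> \<Omega> \<xi> w"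
proof -
  let ?S = "semigroup_symbol \<nu> \<alpha> \<Omega>" and ?x = "resolvent \<nu> \<alpha> \<Omega> \<xi> w"
  have S0: "?S 0 \<xi> *v z = z" for z by (simp add: semigroup_apply)
  have "(LINT \<tau>|lborel. indicator {0..t} \<tau> *\<^sub>R (?S (0 + 1 * \<tau>) \<xi> *v w)) = - (?S (0 + 1 * t) \<xi> *v ?x) - (- (?S (0 + 1 * 0) \<xi> *v ?x))"
  proof (rule integral_FTC_atLeastAtMost[OF t])
    fix \<tau> assume "0 \<le> \<tau>" "\<tau> \<le> t"
    show "((\<lambda>\<tau>. - (?S (0 + 1 * \<tau>) \<xi> *v ?x)) has_vector_derivative ?S (0 + 1 * \<tau>) \<xi> *v w) (at \<tau> within {0..t})"
      using has_vector_derivative_minus[OF semigroup_resolvent_derivative[OF xi nu w, of \<alpha> \<Omega> 0 1 \<tau> "{0..t}"]] by simp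
  qed (rule semigroup_continuous)
  then show "(LINT \<tau>:{0..t}|lborel. ?S \<tau> \<xi> *v w) = ?x - ?S t \<xi> *v ?x"
    by (simp add: set_lebesgue_integral_def S0)
  have "(LINT \<tau>|lborel. indicator {0..t} \<tau> *\<^sub>R (?S (t + (- 1) * \<tau>) \<xi> *v w)) = ?S (t + (- 1) * t) \<xi> *v ?x - ?S (t + (- 1) * 0) \<xi> *v ?x"
  proof (rule integral_FTC_atLeastAtMost[OF t])
    fix \<tau> assume "0 \<le> \<tau>" "\<tau> \<le> t"
    show "((\<lambda>\<tau>. ?S (t + (- 1) * \<tau>) \<xi> *v ?x) has_vector_derivative ?S (t + (- 1) * \<tau>) \<xi> *v w) (at \<tau> within {0..t})"
      using semigroup_resolvent_derivative[OF xi nu w, of \<alpha> \<Omega> t "- 1" \<tau> "{0..t}"] by simp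
  qed (rule semigroup_continuous)
  then show "(LINT \<tau>:{0..t}|lborel. ?S (t - \<tau>) \<xi> *v w) = ?x - ?S t \<xi> *v ?x"
    by (simp add: set_lebesgue_integral_def S0)
qed

text \<open>The exponential decay of the semigroup, used along natural times only.\<close>

lemma semigroup_fixed_point:
  assumes xi: "\<xi> \<noteq> 0" and nu: "\<nu> > 0" and fixed: "\<And>n :: nat. n > 0 \<Longrightarrow> z = semigroup_symbol \<nu> \<alpha> \<Omega> (real n) \<xi> *v z"
  shows "z = 0"
proof -
  define a where "a = heat_rate \<nu> \<alpha> \<xi>"
  have a: "a > 0" using xi nu by (simp add: a_def heat_rate_def)
  have "norm z \<le> exp (- a) ^ n * (10 * norm z)" if "n > 0" for n
    using semigroup_norm[of \<nu> \<alpha> \<Omega> "real n" \<xi> z] fixed[OF that] by (simp add: a_def exp_of_nat_mult[symmetric] mult.commute)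
  moreover have "(\<lambda>n. exp (- a) ^ n * (10 * norm z)) \<longlonglongrightarrow> 0 * (10 * norm z)"
    using a by (intro tendsto_intros LIMSEQ_power_zero) auto
  ultimately have "norm z \<le> 0"
    by (intro tendsto_lowerbound[of "\<lambda>n. exp (- a) ^ n * (10 * norm z)" 0 sequentially])
       (auto intro!: eventually_sequentiallyI[of 1])
  then show ?thesis by simp
qed

text \<open>Let \<open>m\<close> be the resolvent expression. After evaluation of the time
  integrals, the equation at time \<open>t\<close> reads \<open>v - m = S t (v - m)\<close>, so that
  decay of the semigroup leaves only \<open>v = m\<close>. The exceptional null set may depend on
  \<open>t\<close>; restricting to natural times keeps the union of these sets null.\<close>

theorem mild_iff_resolvent:
  fixes v D G :: "real^3 \<Rightarrow> complex^3"
  assumes nu: "\<nu> > 0"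
  shows "(\<forall>t>0. AE \<xi> in lborel.
           v \<xi> = semigroup_symbol \<nu> \<alpha> \<Omega> t \<xi> *v v \<xi>
             - (LINT \<tau>:{0..t}|lborel. semigroup_symbol \<nu> \<alpha> \<Omega> (t - \<tau>) \<xi> *v (leray_symbol \<xi> *v D \<xi>))
             + (LINT \<tau>:{0..t}|lborel. semigroup_symbol \<nu> \<alpha> \<Omega> \<tau> \<xi> *v (leray_symbol \<xi> *v G \<xi>)))
     \<longleftrightarrow> (AE \<xi> in lborel. v \<xi> = resolvent \<nu> \<alpha> \<Omega> \<xi> (leray_symbol \<xi> *v G \<xi>) - resolvent \<nu> \<alpha> \<Omega> \<xi> (leray_symbol \<xi> *v D \<xi>))"
    (is "?L \<longleftrightarrow> ?R")
proof -
  let ?S = "\<lambda>t \<xi> z. semigroup_symbol \<nu> \<alpha> \<Omega> t \<xi> *v z"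
  define m where "m \<xi> = resolvent \<nu> \<alpha> \<Omega> \<xi> (leray_symbol \<xi> *v G \<xi>) - resolvent \<nu> \<alpha> \<Omega> \<xi> (leray_symbol \<xi> *v D \<xi>)" for \<xi>
  have step: "?S t \<xi> (v \<xi>) - (LINT \<tau>:{0..t}|lborel. ?S (t - \<tau>) \<xi> (leray_symbol \<xi> *v D \<xi>))
             + (LINT \<tau>:{0..t}|lborel. ?S \<tau> \<xi> (leray_symbol \<xi> *v G \<xi>)) = m \<xi> + ?S t \<xi> (v \<xi> - m \<xi>)"
    if "\<xi> \<noteq> 0" "t > 0" for t \<xi>
    using that nu by (simp add: semigroup_integral leray_div_free m_def semigroup_diff)
  show ?thesis
  proof
    assume L: ?L
    have "AE \<xi> in lborel. \<forall>n::nat. n > 0 \<longrightarrow> v \<xi> = m \<xi> + ?S (real n) \<xi> (v \<xi> - m \<xi>)"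
    proof (subst AE_all_countable, rule allI)
      fix n :: nat
      show "AE \<xi> in lborel. n > 0 \<longrightarrow> v \<xi> = m \<xi> + ?S (real n) \<xi> (v \<xi> - m \<xi>)"
      proof (cases "n > 0")
        case True
        then have "AE \<xi> in lborel. v \<xi> = ?S (real n) \<xi> (v \<xi>) - (LINT \<tau>:{0..real n}|lborel. ?S (real n - \<tau>) \<xi> (leray_symbol \<xi> *v D \<xi>))
             + (LINT \<tau>:{0..real n}|lborel. ?S \<tau> \<xi> (leray_symbol \<xi> *v G \<xi>))"
          using L by simp
        with AE_lborel_singleton[of 0] show ?thesis
          by eventually_elim (use True step in auto)
      qed simp
    qed
    with AE_lborel_singleton[of 0] have "AE \<xi> in lborel. v \<xi> = m \<xi>"
    proof eventually_elim
      case (elim \<xi>)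
      have "v \<xi> - m \<xi> = 0"
      proof (rule semigroup_fixed_point[OF elim(1) nu])
        fix n :: nat assume "n > 0"
        with elim(2) show "v \<xi> - m \<xi> = ?S (real n) \<xi> (v \<xi> - m \<xi>)"
          by (metis add_diff_cancel_left')
      qed
      then show ?case by simp
    qed
    then show ?R by (simp add: m_def)
  next
    assume R: ?R
    show ?L
    proof (intro allI impI)
      fix t :: real assume t: "t > 0"
      show "AE \<xi> in lborel. v \<xi> = ?S t \<xi> (v \<xi>) - (LINT \<tau>:{0..t}|lborel. ?S (t - \<tau>) \<xi> (leray_symbol \<xi> *v D \<xi>))
             + (LINT \<tau>:{0..t}|lborel. ?S \<tau> \<xi> (leray_symbol \<xi> *v G \<xi>))"
        using R AE_lborel_singleton[of 0]
      proof eventually_elim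
        case (elim \<xi>)
        then have "v \<xi> = m \<xi>" by (simp add: m_def)
        then show ?case using step[OF elim(2) t] by simp
      qed
    qed
  qed
qed

text \<open>The first bound ignores rotation and is uniform in \<Omega>; it serves the nonlinearity
  and provides the majorant for the force. The second ignores diffusion and yields the decay for
  large \<Omega>.\<close>

lemma resolvent_norm:
  assumes xi: "\<xi> \<noteq> 0" and nu: "\<nu> > 0"
  shows "norm (resolvent \<nu> \<alpha> \<Omega> \<xi> w) \<le> 20 / heat_rate \<nu> \<alpha> \<xi> * norm w"
    and "coriolis_rate \<Omega> \<xi> \<noteq> 0 \<Longrightarrow> norm (resolvent \<nu> \<alpha> \<Omega> \<xi> w) \<le> 20 / \<bar>coriolis_rate \<Omega> \<xi>\<bar> * norm w"
proof -
  define a where "a = heat_rate \<nu> \<alpha> \<xi>"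
  define b where "b = \<bar>coriolis_rate \<Omega> \<xi>\<bar>"
  have a: "a > 0" using xi nu by (simp add: a_def heat_rate_def)
  have b: "b \<ge> 0" by (simp add: b_def)
  have b2: "(coriolis_rate \<Omega> \<xi>)\<^sup>2 = b\<^sup>2" by (simp add: b_def)
  have pos: "a\<^sup>2 + b\<^sup>2 > 0" using a by (simp add: add_pos_nonneg)
  have main: "norm (resolvent \<nu> \<alpha> \<Omega> \<xi> w) \<le> ((a + b) / (a\<^sup>2 + b\<^sup>2)) * (10 * norm w)"
  proof -
    have "norm (a *\<^sub>R w + coriolis_rate \<Omega> \<xi> *\<^sub>R (R_matrix \<xi> *v w)) \<le> a * norm w + b * norm (R_matrix \<xi> *v w)"
      using a by (intro order_trans[OF norm_triangle_ineq]) (simp add: b_def)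
    also have "\<dots> \<le> a * (10 * norm w) + b * (10 * norm w)"
      using a b by (intro add_mono mult_left_mono order_trans[OF R_matrix_norm]) auto
    finally have *: "norm (a *\<^sub>R w + coriolis_rate \<Omega> \<xi> *\<^sub>R (R_matrix \<xi> *v w)) \<le> (a + b) * (10 * norm w)" by (simp add: distrib_right)
    have "norm (resolvent \<nu> \<alpha> \<Omega> \<xi> w) = (1 / (a\<^sup>2 + b\<^sup>2)) * norm (a *\<^sub>R w + coriolis_rate \<Omega> \<xi> *\<^sub>R (R_matrix \<xi> *v w))"
      unfolding resolvent_def norm_scaleR a_def[symmetric] b2 using pos by simp
    also have "\<dots> \<le> (1 / (a\<^sup>2 + b\<^sup>2)) * ((a + b) * (10 * norm w))"
      using pos * by (intro mult_left_mono) auto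
    finally show ?thesis by simp
  qed
  have key: "(x + y) / (x\<^sup>2 + y\<^sup>2) \<le> 2 / x" if "x > 0" "y \<ge> 0" for x y :: real
  proof -
    have "x * y \<le> x\<^sup>2 + 2 * y\<^sup>2"
    proof -
      have "0 \<le> x * y" using that by simp
      then show ?thesis using sum_squares_bound[of x y] zero_le_power2[of y] by linarith
    qed
    then have "x * (x + y) \<le> 2 * (x\<^sup>2 + y\<^sup>2)" by (simp add: power2_eq_square algebra_simps)
    moreover have "x\<^sup>2 + y\<^sup>2 > 0" using that by (simp add: add_pos_nonneg)
    moreover have "0 < D \<Longrightarrow> x * (x + y) \<le> 2 * D \<Longrightarrow> (x + y) / D \<le> 2 / x" for D
      using that(1) by (simp add: field_simps)
    ultimately show ?thesis by blast
  qed
  have "((a + b) / (a\<^sup>2 + b\<^sup>2)) * (10 * norm w) \<le> (2 / a) * (10 * norm w)"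
    using key[OF a b] by (intro mult_right_mono) auto
  with main show "norm (resolvent \<nu> \<alpha> \<Omega> \<xi> w) \<le> 20 / heat_rate \<nu> \<alpha> \<xi> * norm w" by (simp add: a_def)
  assume "coriolis_rate \<Omega> \<xi> \<noteq> 0"
  then have "b > 0" by (simp add: b_def)
  then have "((a + b) / (a\<^sup>2 + b\<^sup>2)) * (10 * norm w) \<le> (2 / b) * (10 * norm w)"
    using key[of b a] a by (intro mult_right_mono) (auto simp: add.commute)
  with main show "norm (resolvent \<nu> \<alpha> \<Omega> \<xi> w) \<le> 20 / \<bar>coriolis_rate \<Omega> \<xi>\<bar> * norm w" by (simp add: b_def)
qed

subsection \<open>Completeness\<close>

lemma wnorm_cong_AE:
  "AE \<xi> in lborel. norm (v \<xi>) = norm (w \<xi>) \<Longrightarrow> wnorm s p v = wnorm s p w"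
  unfolding wnorm_def by (intro nn_integral_cong_AE) (auto elim!: eventually_mono)

lemma wnorm_mono_AE:
  "0 \<le> p \<Longrightarrow> AE \<xi> in lborel. norm (v \<xi>) \<le> norm (w \<xi>) \<Longrightarrow> wnorm s p v \<le> wnorm s p w"
  unfolding wnorm_def by (intro nn_integral_mono_AE) (auto elim!: eventually_mono intro!: ennreal_leI mult_left_mono powr_mono2)

lemma powr_add_le:
  fixes a b p :: real
  assumes "0 \<le> a" "0 \<le> b" "0 \<le> p"
  shows "(a + b) powr p \<le> 2 powr p * (a powr p + b powr p)"
proof -
  have "(a + b) powr p \<le> (2 * max a b) powr p" using assms by (intro powr_mono2) auto
  also have "\<dots> = 2 powr p * max a b powr p" using assms by (simp add: powr_mult)
  also have "\<dots> \<le> 2 powr p * (a powr p + b powr p)" by (intro mult_left_mono) (auto simp: max_def)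
  finally show ?thesis .
qed

text \<open>The substitute for Minkowski's inequality. Its loss \<open>2 powr p\<close> is what the
  smallness conditions in \<open>fixed_point_exists\<close> have to absorb.\<close>

lemma wnorm_triangle:
  fixes u v w :: "real^3 \<Rightarrow> 'a :: real_normed_vector"
  assumes p: "0 \<le> p" and le: "AE \<xi> in lborel. norm (u \<xi>) \<le> norm (v \<xi>) + norm (w \<xi>)"
    and [measurable]: "(\<lambda>\<xi>. norm (v \<xi>)) \<in> borel_measurable borel" "(\<lambda>\<xi>. norm (w \<xi>)) \<in> borel_measurable borel"
  shows "wnorm s p u \<le> ennreal (2 powr p) * (wnorm s p v + wnorm s p w)"
proof -
  have "wnorm s p u \<le> (\<integral>\<^sup>+\<xi>. ennreal (2 powr p) * (ennreal (norm \<xi> powr (s * p) * norm (v \<xi>) powr p) + ennreal (norm \<xi> powr (s * p) * norm (w \<xi>) powr p)) \<partial>lborel)"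
    unfolding wnorm_def
  proof (rule nn_integral_mono_AE)
    show "AE \<xi> in lborel. ennreal (norm \<xi> powr (s * p) * norm (u \<xi>) powr p) \<le>
       ennreal (2 powr p) * (ennreal (norm \<xi> powr (s * p) * norm (v \<xi>) powr p) + ennreal (norm \<xi> powr (s * p) * norm (w \<xi>) powr p))"
      using le
    proof eventually_elim
      case (elim \<xi>)
      have "norm (u \<xi>) powr p \<le> (norm (v \<xi>) + norm (w \<xi>)) powr p" using elim p by (intro powr_mono2) auto
      also have "\<dots> \<le> 2 powr p * (norm (v \<xi>) powr p + norm (w \<xi>) powr p)" using p by (intro powr_add_le) auto
      finally have "norm \<xi> powr (s * p) * norm (u \<xi>) powr p \<le> norm \<xi> powr (s * p) * (2 powr p * (norm (v \<xi>) powr p + norm (w \<xi>) powr p))"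
        by (intro mult_left_mono) auto
      also have "\<dots> = 2 powr p * (norm \<xi> powr (s * p) * norm (v \<xi>) powr p + norm \<xi> powr (s * p) * norm (w \<xi>) powr p)"
        by (simp only: distrib_left mult_ac)
      finally have "ennreal (norm \<xi> powr (s * p) * norm (u \<xi>) powr p) \<le> ennreal (2 powr p * (norm \<xi> powr (s * p) * norm (v \<xi>) powr p + norm \<xi> powr (s * p) * norm (w \<xi>) powr p))"
        by (rule ennreal_leI)
      then show ?case by (simp add: ennreal_mult ennreal_plus)
    qed
  qed
  also have "\<dots> = ennreal (2 powr p) * (wnorm s p v + wnorm s p w)"
    unfolding wnorm_def by (subst nn_integral_cmult, measurable) (simp add: nn_integral_add)
  finally show ?thesis .
qed

lemma wnorm_eq_0D:
  assumes "wnorm s p v = 0" and [measurable]: "v \<in> borel_measurable borel"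
  shows "AE \<xi> in lborel. v \<xi> = (0 :: complex^3)"
proof -
  have "AE \<xi> in lborel. ennreal (norm \<xi> powr (s * p) * norm (v \<xi>) powr p) = 0"
    using assms(1) unfolding wnorm_def by (subst (asm) nn_integral_0_iff_AE) auto
  with AE_lborel_singleton[of 0] show ?thesis
    by eventually_elim (auto simp: ennreal_eq_0_iff mult_le_0_iff)
qed

lemma geometric_Cauchy:
  fixes x :: "nat \<Rightarrow> 'a :: banach"
  assumes d: "\<And>n. norm (x (Suc n) - x n) \<le> C * (1 / 2) ^ n"
  shows "convergent x" "norm (lim x - x n) \<le> 2 * C * (1 / 2) ^ n"
proof -
  have C: "0 \<le> C" using order_trans[OF norm_ge_zero d[of 0]] by simp
  have b: "norm (x (n + k) - x n) \<le> 2 * C * (1 / 2) ^ n" for n k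
  proof -
    \<comment> \<open>The finite geometric sum is kept exact here; the weaker bound without the last
      factor would not survive the induction.\<close>
    have "norm (x (n + k) - x n) \<le> 2 * C * (1 / 2) ^ n * (1 - (1 / 2) ^ k)"
    proof (induction k)
      case (Suc k)
      have "norm (x (n + Suc k) - x n) \<le> norm (x (Suc (n + k)) - x (n + k)) + norm (x (n + k) - x n)"
        using norm_triangle_ineq[of "x (Suc (n + k)) - x (n + k)" "x (n + k) - x n"] by simp
      also have "\<dots> \<le> C * (1 / 2) ^ (n + k) + 2 * C * (1 / 2) ^ n * (1 - (1 / 2) ^ k)"
        by (intro add_mono d Suc.IH)
      also have "\<dots> = 2 * C * (1 / 2) ^ n * (1 - (1 / 2) ^ Suc k)"
        by (simp add: power_add algebra_simps)
      finally show ?case .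
    qed simp
    also have "\<dots> \<le> 2 * C * (1 / 2) ^ n * 1" using C by (intro mult_left_mono) auto
    finally show ?thesis by simp
  qed
  have "Cauchy x"
  proof (rule metric_CauchyI)
    fix e :: real assume e: "e > 0"
    have "(\<lambda>n. 4 * C * (1 / 2) ^ n) \<longlonglongrightarrow> 4 * C * 0" by (intro tendsto_intros LIMSEQ_power_zero) auto
    then have "\<forall>\<^sub>F n in sequentially. 4 * C * (1 / 2) ^ n < e" using e by (intro order_tendstoD(2)) auto
    then obtain N where N: "4 * C * (1 / 2) ^ N < e" by (auto simp: eventually_sequentially)
    have "dist (x m) (x n) < e" if "m \<ge> N" "n \<ge> N" for m n
    proof -
      have "dist (x m) (x n) \<le> norm (x m - x N) + norm (x n - x N)"
        by (metis dist_norm dist_triangle2)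
      also have "\<dots> \<le> 2 * C * (1 / 2) ^ N + 2 * C * (1 / 2) ^ N"
        using b[of N "m - N"] b[of N "n - N"] that by (intro add_mono) auto
      finally show ?thesis using N by simp
    qed
    then show "\<exists>M. \<forall>m\<ge>M. \<forall>n\<ge>M. dist (x m) (x n) < e" by blast
  qed
  then show conv: "convergent x" by (rule Cauchy_convergent)
  have "(\<lambda>k. norm (x (n + k) - x n)) \<longlonglongrightarrow> norm (lim x - x n)"
    using conv by (intro tendsto_intros) (simp add: add.commute convergent_LIMSEQ_iff LIMSEQ_ignore_initial_segment)
  then show "norm (lim x - x n) \<le> 2 * C * (1 / 2) ^ n"
    by (rule tendsto_upperbound) (auto intro!: b always_eventually)
qed

text \<open>The function \<open>S\<close> dominates \<open>2\<^sup>p\<^sup>n |v\<^sub>n\<^sub>+\<^sub>1 - v\<^sub>n|\<^sup>p\<close> for all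
  \<open>n\<close> at once, so that no Minkowski inequality is needed.\<close>

theorem wnorm_complete:
  fixes v :: "nat \<Rightarrow> real^3 \<Rightarrow> complex^3"
  assumes [measurable]: "\<And>n. v n \<in> borel_measurable borel" and p: "p > 0" and \<delta>: "0 \<le> \<delta>"
    and d: "\<And>n. wnorm s p (\<lambda>\<xi>. v (Suc n) \<xi> - v n \<xi>) \<le> ennreal (\<delta> * (4 powr (- p)) ^ n)"
  obtains u where "u \<in> borel_measurable borel" "(\<lambda>n. wnorm s p (\<lambda>\<xi>. u \<xi> - v n \<xi>)) \<longlonglongrightarrow> 0"
proof -
  define t where "t n \<xi> = ennreal ((2 powr p) ^ n * (norm \<xi> powr (s * p) * norm (v (Suc n) \<xi> - v n \<xi>) powr p))" for n \<xi>
  define S where "S \<xi> = (\<Sum>n. t n \<xi>)" for \<xi>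
  \<comment> \<open>After the increments are weighted by \<open>(2 powr p) ^ n\<close>, their decay
    \<open>(4 powr (- p)) ^ n\<close> still leaves \<open>\<rho> ^ n\<close> with
    \<open>\<rho> < 1\<close>, so that \<open>S\<close> is integrable.\<close>
  define \<rho> where "\<rho> = (2::real) powr (- p)"
  have rho: "0 < \<rho>" "\<rho> < 1" using p by (auto simp: \<rho>_def powr_less_one)
  have [measurable]: "t n \<in> borel_measurable borel" for n unfolding t_def by measurable
  have [measurable]: "S \<in> borel_measurable borel" unfolding S_def by measurable
  have tn: "(\<integral>\<^sup>+\<xi>. t n \<xi> \<partial>lborel) \<le> ennreal (\<delta> * \<rho> ^ n)" for n
  proof -
    have "(\<integral>\<^sup>+\<xi>. t n \<xi> \<partial>lborel) = ennreal ((2 powr p) ^ n) * wnorm s p (\<lambda>\<xi>. v (Suc n) \<xi> - v n \<xi>)"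
      unfolding t_def wnorm_def by (subst nn_integral_cmult[symmetric]) (auto simp: ennreal_mult)
    also have "\<dots> \<le> ennreal ((2 powr p) ^ n) * ennreal (\<delta> * (4 powr (- p)) ^ n)"
      by (intro mult_left_mono d) auto
    also have "\<dots> = ennreal (\<delta> * ((2 powr p) ^ n * (4 powr (- p)) ^ n))"
      using \<delta> by (simp add: ennreal_mult[symmetric] mult_ac)
    also have "(2 powr p) ^ n * (4 powr (- p)) ^ n = \<rho> ^ n"
    proof -
      have "(4::real) powr (- p) = 2 powr (- p) * 2 powr (- p)"
        by (simp add: powr_mult[symmetric])
      then have "(2::real) powr p * 4 powr (- p) = \<rho>" by (simp add: \<rho>_def powr_minus field_simps)
      then show ?thesis by (simp add: power_mult_distrib[symmetric])
    qed
    finally show ?thesis .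
  qed
  have "(\<integral>\<^sup>+\<xi>. S \<xi> \<partial>lborel) = (\<Sum>n. \<integral>\<^sup>+\<xi>. t n \<xi> \<partial>lborel)"
    unfolding S_def by (rule nn_integral_suminf) measurable
  also have "\<dots> \<le> (\<Sum>n. ennreal (\<delta> * \<rho> ^ n))" by (intro suminf_le tn) auto
  also have "\<dots> = ennreal (\<delta> * (1 / (1 - \<rho>)))"
    using rho \<delta> by (intro suminf_ennreal_eq sums_mult geometric_sums) auto
  finally have S: "(\<integral>\<^sup>+\<xi>. S \<xi> \<partial>lborel) \<le> ennreal (\<delta> * (1 / (1 - \<rho>)))" .
  then have "(\<integral>\<^sup>+\<xi>. S \<xi> \<partial>lborel) \<noteq> \<infinity>" by (auto simp: top_unique)
  then have Sfin: "AE \<xi> in lborel. S \<xi> \<noteq> \<infinity>" by (intro nn_integral_PInf_AE) auto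
  \<comment> \<open>\<open>lim\<close> also takes some value where the sequence diverges, which
    happens only on a null set.\<close>
  define u where "u \<xi> = lim (\<lambda>n. v n \<xi>)" for \<xi>
  have [measurable]: "u \<in> borel_measurable borel" unfolding u_def by measurable
  have pw: "ennreal (norm \<xi> powr (s * p) * norm (u \<xi> - v n \<xi>) powr p) \<le> ennreal (2 powr p * \<rho> ^ n) * S \<xi>"
    if xi: "\<xi> \<noteq> 0" and fin: "S \<xi> \<noteq> \<infinity>" for \<xi> n
  proof -
    obtain \<sigma> where sg: "S \<xi> = ennreal \<sigma>" "0 \<le> \<sigma>" using fin by (cases "S \<xi>") auto
    define W where "W = norm \<xi> powr (s * p)"
    have W: "W > 0" using xi by (simp add: W_def)
    \<comment> \<open>Taking p-th roots in \<open>t n \<xi> \<le> S \<xi>\<close> gives increments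
      of at most \<open>C * (1 / 2) ^ n\<close>, as \<open>geometric_Cauchy\<close>
      requires.\<close>
    define C where "C = (\<sigma> / W) powr (1 / p)"
    have C: "C powr p = \<sigma> / W" "0 \<le> C" using p sg W by (auto simp: C_def powr_powr)
    have halfpow: "((1 / 2 :: real) ^ n) powr p = \<rho> ^ n" for n
    proof -
      have "\<rho> = (1 / 2) powr p" by (simp add: \<rho>_def powr_minus_divide powr_divide)
      then show ?thesis by (simp add: powr_realpow[symmetric] powr_powr mult.commute)
    qed
    have "norm (v (Suc n) \<xi> - v n \<xi>) \<le> C * (1 / 2) ^ n" for n
    proof -
      let ?x = "norm (v (Suc n) \<xi> - v n \<xi>)"
      have "t n \<xi> \<le> ennreal \<sigma>" unfolding sg(1)[symmetric] S_def by (rule suminf_term_le)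
      then have "(2 powr p) ^ n * (W * ?x powr p) \<le> \<sigma>" using sg(2) by (simp add: t_def W_def)
      then have "?x powr p \<le> (\<sigma> / W) * \<rho> ^ n"
        using W by (simp add: \<rho>_def powr_minus power_inverse field_simps)
      also have "\<dots> = (C * (1 / 2) ^ n) powr p" using C by (simp add: powr_mult halfpow)
      finally have le: "?x powr p \<le> (C * (1 / 2) ^ n) powr p" .
      show ?thesis
      proof (rule ccontr)
        assume "\<not> ?thesis"
        then have "(C * (1 / 2) ^ n) powr p < ?x powr p" using p C by (intro powr_less_mono2) auto
        with le show False by simp
      qed
    qed
    from geometric_Cauchy(2)[of "\<lambda>n. v n \<xi>", OF this, of n]
    have "norm (u \<xi> - v n \<xi>) powr p \<le> (2 * C * (1 / 2) ^ n) powr p"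
      using p by (intro powr_mono2) (auto simp: u_def)
    also have "\<dots> = 2 powr p * (\<sigma> / W) * \<rho> ^ n" using C by (simp add: powr_mult halfpow)
    finally have "W * norm (u \<xi> - v n \<xi>) powr p \<le> W * (2 powr p * (\<sigma> / W) * \<rho> ^ n)"
      using W by (intro mult_left_mono) auto
    also have "\<dots> = 2 powr p * \<rho> ^ n * \<sigma>" using W by simp
    finally have "ennreal (W * norm (u \<xi> - v n \<xi>) powr p) \<le> ennreal (2 powr p * \<rho> ^ n * \<sigma>)" by (rule ennreal_leI)
    then show ?thesis using sg rho by (simp add: W_def ennreal_mult)
  qed
  have bound: "wnorm s p (\<lambda>\<xi>. u \<xi> - v n \<xi>) \<le> ennreal (2 powr p * \<delta> * (1 / (1 - \<rho>)) * \<rho> ^ n)" for n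
  proof -
    have "wnorm s p (\<lambda>\<xi>. u \<xi> - v n \<xi>) \<le> (\<integral>\<^sup>+\<xi>. ennreal (2 powr p * \<rho> ^ n) * S \<xi> \<partial>lborel)"
      unfolding wnorm_def
    proof (rule nn_integral_mono_AE)
      show "AE \<xi> in lborel. ennreal (norm \<xi> powr (s * p) * norm (u \<xi> - v n \<xi>) powr p) \<le> ennreal (2 powr p * \<rho> ^ n) * S \<xi>"
        using AE_lborel_singleton[of 0] Sfin by eventually_elim (rule pw)
    qed
    also have "\<dots> = ennreal (2 powr p * \<rho> ^ n) * (\<integral>\<^sup>+\<xi>. S \<xi> \<partial>lborel)" by (rule nn_integral_cmult) measurable
    also have "\<dots> \<le> ennreal (2 powr p * \<rho> ^ n) * ennreal (\<delta> * (1 / (1 - \<rho>)))" by (intro mult_left_mono S) auto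
    also have "\<dots> = ennreal (2 powr p * \<delta> * (1 / (1 - \<rho>)) * \<rho> ^ n)"
      using rho \<delta> by (simp add: ennreal_mult[symmetric] mult_ac)
    finally show ?thesis .
  qed
  have "(\<lambda>n. ennreal (2 powr p * \<delta> * (1 / (1 - \<rho>)) * \<rho> ^ n)) \<longlonglongrightarrow> ennreal (2 powr p * \<delta> * (1 / (1 - \<rho>)) * 0)"
    using rho by (intro tendsto_intros LIMSEQ_power_zero) auto
  then have lim: "(\<lambda>n. ennreal (2 powr p * \<delta> * (1 / (1 - \<rho>)) * \<rho> ^ n)) \<longlonglongrightarrow> 0" by simp
  have "(\<lambda>n. wnorm s p (\<lambda>\<xi>. u \<xi> - v n \<xi>)) \<longlonglongrightarrow> 0"
    by (rule tendsto_sandwich[OF _ _ tendsto_const lim]) (use bound in \<open>auto intro!: always_eventually\<close>)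
  then show ?thesis by (rule that[rotated]) measurable
qed

section \<open>Measurability of the operators in the equation\<close>

lemma conv_borel [measurable]:
  assumes [measurable]: "f \<in> borel_measurable borel" "g \<in> borel_measurable borel"
  shows "conv f g \<in> borel_measurable borel"
proof -
  have "(\<lambda>\<xi>. LINT \<eta>|lborel. f (\<xi> - \<eta>) * g \<eta>) \<in> borel_measurable borel" by measurable
  then show ?thesis by (simp add: conv_def[abs_def])
qed

lemma div_tensor_borel [measurable]:
  assumes [measurable]: "v \<in> borel_measurable borel"
  shows "div_tensor v \<in> borel_measurable borel"
  by (rule borel_vec_componentI) (simp add: div_tensor_def)

lemma matrix_apply_borel:
  fixes A :: "real^3 \<Rightarrow> complex^3^3"
  assumes A: "\<And>i j. (\<lambda>\<xi>. A \<xi> $ i $ j) \<in> borel_measurable borel" and [measurable]: "w \<in> borel_measurable borel"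
  shows "(\<lambda>\<xi>. A \<xi> *v w \<xi>) \<in> borel_measurable borel"
proof (rule borel_vec_componentI)
  note A[measurable]
  show "(\<lambda>\<xi>. (A \<xi> *v w \<xi>) $ m) \<in> borel_measurable borel" for m
    unfolding matrix_vector_mult_def vec_lambda_beta by measurable
qed

lemma real_component_borel [measurable]: "(\<lambda>\<xi>::real^3. \<xi> $ k) \<in> borel_measurable borel"
  by (intro borel_measurable_continuous_onI continuous_intros)

lemma leray_borel [measurable]:
  "w \<in> borel_measurable borel \<Longrightarrow> (\<lambda>\<xi>. leray_symbol \<xi> *v w \<xi>) \<in> borel_measurable borel"
  by (rule matrix_apply_borel) (simp_all add: leray_symbol_def)

lemma resolvent_borel [measurable]:
  assumes [measurable]: "w \<in> borel_measurable borel"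
  shows "(\<lambda>\<xi>. resolvent \<nu> \<alpha> \<Omega> \<xi> (w \<xi>)) \<in> borel_measurable borel"
proof -
  have [measurable]: "(\<lambda>\<xi>. R_matrix \<xi> *v w \<xi>) \<in> borel_measurable borel"
  proof (rule borel_vec_componentI)
    have "\<forall>m. (\<lambda>\<xi>. (R_matrix \<xi> *v w \<xi>) $ m) \<in> borel_measurable borel"
      unfolding forall_3 R_matrix_apply by (intro conjI) measurable
    then show "(\<lambda>\<xi>. (R_matrix \<xi> *v w \<xi>) $ m) \<in> borel_measurable borel" for m by blast
  qed
  show ?thesis unfolding resolvent_def heat_rate_def coriolis_rate_def by measurable
qed

subsection \<open>Estimates for the nonlinearity and the force\<close>

definition mag :: "(real^3 \<Rightarrow> complex^3) \<Rightarrow> real^3 \<Rightarrow> real" where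
  "mag v \<xi> = norm (v \<xi>)"

lemma mag_borel [measurable]: "v \<in> borel_measurable borel \<Longrightarrow> mag v \<in> borel_measurable borel"
  unfolding mag_def[abs_def] by measurable

lemma wnorm_mag [simp]: "wnorm s p (mag v) = wnorm s p v"
  by (simp add: wnorm_def mag_def)

text \<open>Supplies the almost everywhere existence of the convolutions that is part of the notion
  of solution. A finite weighted integral forces finiteness wherever the weight is positive, that
  is, off the origin.\<close>

lemma nn_conv_finite_AE:
  assumes p: "1 < p" and s: "3 / 2 * (1 - 1 / p) < s" "s < 3 * (1 - 1 / p)"
    and [measurable]: "f \<in> borel_measurable borel" "g \<in> borel_measurable borel"
    and nn: "\<And>x. 0 \<le> f x" "\<And>x. 0 \<le> g x" and fin: "wnorm s p f < \<infinity>" "wnorm s p g < \<infinity>"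
  shows "AE \<xi> in lborel. nn_conv f g \<xi> < \<infinity>"
proof -
  let ?W = "\<lambda>\<xi>::real^3. norm \<xi> powr ((2 * s - 3 * (1 - 1 / p)) * p)"
  have [measurable]: "(\<lambda>\<xi>. ennreal_powr (nn_conv f g \<xi>) p) \<in> borel_measurable borel"
    unfolding ennreal_powr_def by measurable
  obtain K where "\<forall>f g. f \<in> borel_measurable borel \<longrightarrow> g \<in> borel_measurable borel \<longrightarrow> (\<forall>x. 0 \<le> f x) \<longrightarrow> (\<forall>x. 0 \<le> g x) \<longrightarrow>
     (\<integral>\<^sup>+\<xi>. ennreal (?W \<xi>) * ennreal_powr (nn_conv f g \<xi>) p \<partial>lborel) \<le> ennreal K * (wnorm s p f * wnorm s p g)"
    using weighted_convolution_bound[OF p s] by blast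
  then have K: "(\<integral>\<^sup>+\<xi>. ennreal (?W \<xi>) * ennreal_powr (nn_conv f g \<xi>) p \<partial>lborel) \<le> ennreal K * (wnorm s p f * wnorm s p g)"
    using assms(4,5) nn by blast
  have "ennreal K * (wnorm s p f * wnorm s p g) < \<infinity>" using fin by (simp add: ennreal_mult_less_top)
  with K have "(\<integral>\<^sup>+\<xi>. ennreal (?W \<xi>) * ennreal_powr (nn_conv f g \<xi>) p \<partial>lborel) \<noteq> \<infinity>" by (metis leD)
  then have "AE \<xi> in lborel. ennreal (?W \<xi>) * ennreal_powr (nn_conv f g \<xi>) p \<noteq> \<infinity>"
    by (intro nn_integral_PInf_AE) auto
  with AE_lborel_singleton[of 0] show ?thesis
  proof eventually_elim
    case (elim \<xi>)
    have "0 < ?W \<xi>" using elim(1) by simp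
    then show ?case using elim(2) by (auto simp: ennreal_powr_def ennreal_mult_top less_top[symmetric])
  qed
qed

lemma conv_integrable_component:
  fixes v w :: "real^3 \<Rightarrow> complex^3"
  assumes [measurable]: "v \<in> borel_measurable borel" "w \<in> borel_measurable borel"
    and fin: "nn_conv (mag v) (mag w) \<xi> < \<infinity>"
  shows "conv_integrable_at (\<lambda>\<eta>. v \<eta> $ m) (\<lambda>\<eta>. w \<eta> $ k) \<xi>"
  unfolding conv_integrable_at_def
proof (rule integrableI_bounded)
  have "(\<integral>\<^sup>+\<eta>. ennreal (norm (v (\<xi> - \<eta>) $ m * w \<eta> $ k)) \<partial>lborel) \<le> nn_conv (mag v) (mag w) \<xi>"
    unfolding nn_conv_def mag_def norm_mult
    by (intro nn_integral_mono ennreal_leI mult_mono Finite_Cartesian_Product.norm_nth_le) auto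
  then show "(\<integral>\<^sup>+\<eta>. ennreal (norm (v (\<xi> - \<eta>) $ m * w \<eta> $ k)) \<partial>lborel) < \<infinity>"
    using fin by (rule le_less_trans)
qed measurable

lemma nn_conv_integral:
  assumes [measurable]: "f \<in> borel_measurable borel" "g \<in> borel_measurable borel"
    and nn: "\<And>x. 0 \<le> f x" "\<And>x. 0 \<le> g x" and fin: "nn_conv f g \<xi> < \<infinity>"
  shows "integrable lborel (\<lambda>\<eta>. f (\<xi> - \<eta>) * g \<eta>)"
    and "(LINT \<eta>|lborel. f (\<xi> - \<eta>) * g \<eta>) = enn2real (nn_conv f g \<xi>)"
proof -
  show "integrable lborel (\<lambda>\<eta>. f (\<xi> - \<eta>) * g \<eta>)"
    using fin nn by (intro integrableI_nonneg) (auto simp: nn_conv_def)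
  show "(LINT \<eta>|lborel. f (\<xi> - \<eta>) * g \<eta>) = enn2real (nn_conv f g \<xi>)"
    unfolding nn_conv_def using nn by (intro integral_eq_nn_integral) auto
qed

text \<open>Bilinearity in the form \<open>v v' - w w' = (v - w) v' + w (v' - w')\<close>. Both
  \<open>v\<close> and \<open>w\<close> are majorised by \<open>u\<close>, which makes the bound the
  same for all components; 9 counts three components with three summands each.\<close>

lemma div_tensor_difference:
  fixes v w :: "real^3 \<Rightarrow> complex^3"
  defines "d \<equiv> mag (\<lambda>\<xi>. v \<xi> - w \<xi>)" and "u \<equiv> \<lambda>\<xi>. mag v \<xi> + mag w \<xi>"
  assumes [measurable]: "v \<in> borel_measurable borel" "w \<in> borel_measurable borel"
    and fin: "nn_conv (mag v) (mag v) \<xi> < \<infinity>" "nn_conv (mag w) (mag w) \<xi> < \<infinity>"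
      "nn_conv d u \<xi> < \<infinity>" "nn_conv u d \<xi> < \<infinity>"
  shows "norm (div_tensor v \<xi> - div_tensor w \<xi>) \<le> 9 * norm \<xi> * (enn2real (nn_conv d u \<xi>) + enn2real (nn_conv u d \<xi>))"
proof -
  let ?J = "enn2real (nn_conv d u \<xi>) + enn2real (nn_conv u d \<xi>)"
  have [measurable]: "d \<in> borel_measurable borel" "u \<in> borel_measurable borel"
    unfolding d_def u_def by measurable
  have nn: "0 \<le> d x" "0 \<le> u x" for x by (auto simp: d_def u_def mag_def)
  have J: "0 \<le> ?J" by simp
  note i1 = nn_conv_integral[OF \<open>d \<in> _\<close> \<open>u \<in> _\<close> nn fin(3)]
  note i2 = nn_conv_integral[OF \<open>u \<in> _\<close> \<open>d \<in> _\<close> nn(2,1) fin(4)]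
  have comp: "norm (conv (\<lambda>\<eta>. v \<eta> $ m) (\<lambda>\<eta>. v \<eta> $ k) \<xi> - conv (\<lambda>\<eta>. w \<eta> $ m) (\<lambda>\<eta>. w \<eta> $ k) \<xi>) \<le> ?J" for m k
  proof -
    have iv: "integrable lborel (\<lambda>\<eta>. v (\<xi> - \<eta>) $ m * v \<eta> $ k)" "integrable lborel (\<lambda>\<eta>. w (\<xi> - \<eta>) $ m * w \<eta> $ k)"
      using conv_integrable_component[of v v \<xi> m k] conv_integrable_component[of w w \<xi> m k] fin
      by (auto simp: conv_integrable_at_def)
    have "norm (conv (\<lambda>\<eta>. v \<eta> $ m) (\<lambda>\<eta>. v \<eta> $ k) \<xi> - conv (\<lambda>\<eta>. w \<eta> $ m) (\<lambda>\<eta>. w \<eta> $ k) \<xi>)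
       = norm (LINT \<eta>|lborel. v (\<xi> - \<eta>) $ m * v \<eta> $ k - w (\<xi> - \<eta>) $ m * w \<eta> $ k)"
      using iv by (simp add: conv_def)
    also have "\<dots> \<le> (LINT \<eta>|lborel. norm (v (\<xi> - \<eta>) $ m * v \<eta> $ k - w (\<xi> - \<eta>) $ m * w \<eta> $ k))"
      by (rule integral_norm_bound)
    also have "\<dots> \<le> (LINT \<eta>|lborel. d (\<xi> - \<eta>) * u \<eta> + u (\<xi> - \<eta>) * d \<eta>)"
    proof (rule integral_mono)
      fix \<eta>
      have "v (\<xi> - \<eta>) $ m * v \<eta> $ k - w (\<xi> - \<eta>) $ m * w \<eta> $ k
         = (v (\<xi> - \<eta>) - w (\<xi> - \<eta>)) $ m * v \<eta> $ k + w (\<xi> - \<eta>) $ m * (v \<eta> - w \<eta>) $ k"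
        by (simp add: algebra_simps)
      also have "norm \<dots> \<le> norm ((v (\<xi> - \<eta>) - w (\<xi> - \<eta>)) $ m) * norm (v \<eta> $ k) + norm (w (\<xi> - \<eta>) $ m) * norm ((v \<eta> - w \<eta>) $ k)"
        by (rule order_trans[OF norm_triangle_ineq]) (simp add: norm_mult)
      also have "\<dots> \<le> d (\<xi> - \<eta>) * u \<eta> + u (\<xi> - \<eta>) * d \<eta>"
      proof (intro add_mono mult_mono)
        show "norm ((v (\<xi> - \<eta>) - w (\<xi> - \<eta>)) $ m) \<le> d (\<xi> - \<eta>)" "norm ((v \<eta> - w \<eta>) $ k) \<le> d \<eta>"
          unfolding d_def mag_def by (rule Finite_Cartesian_Product.norm_nth_le)+
        show "norm (v \<eta> $ k) \<le> u \<eta>" "norm (w (\<xi> - \<eta>) $ m) \<le> u (\<xi> - \<eta>)"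
          unfolding u_def mag_def
          by (rule order_trans[OF Finite_Cartesian_Product.norm_nth_le], simp)+
      qed (use nn in auto)
      finally show "norm (v (\<xi> - \<eta>) $ m * v \<eta> $ k - w (\<xi> - \<eta>) $ m * w \<eta> $ k) \<le> d (\<xi> - \<eta>) * u \<eta> + u (\<xi> - \<eta>) * d \<eta>" .
    qed (use iv i1(1) i2(1) in auto)
    also have "\<dots> = ?J" using i1 i2 by simp
    finally show ?thesis .
  qed
  have row: "norm ((div_tensor v \<xi> - div_tensor w \<xi>) $ m) \<le> 3 * (norm \<xi> * ?J)" for m
  proof -
    have "(div_tensor v \<xi> - div_tensor w \<xi>) $ m = (\<Sum>k\<in>UNIV. \<i> * of_real (\<xi> $ k) *
        (conv (\<lambda>\<eta>. v \<eta> $ m) (\<lambda>\<eta>. v \<eta> $ k) \<xi> - conv (\<lambda>\<eta>. w \<eta> $ m) (\<lambda>\<eta>. w \<eta> $ k) \<xi>))"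
      by (simp add: div_tensor_def sum_subtractf right_diff_distrib)
    also have "norm \<dots> \<le> (\<Sum>k\<in>UNIV. norm (\<i> * of_real (\<xi> $ k) *
        (conv (\<lambda>\<eta>. v \<eta> $ m) (\<lambda>\<eta>. v \<eta> $ k) \<xi> - conv (\<lambda>\<eta>. w \<eta> $ m) (\<lambda>\<eta>. w \<eta> $ k) \<xi>)))"
      by (rule norm_sum)
    also have "\<dots> \<le> (\<Sum>k\<in>(UNIV :: 3 set). norm \<xi> * ?J)"
      unfolding norm_mult norm_of_real norm_ii mult_1
      by (intro sum_mono mult_mono component_le_norm_cart comp) auto
    finally show ?thesis by simp
  qed
  have "norm (div_tensor v \<xi> - div_tensor w \<xi>) \<le> (\<Sum>m\<in>UNIV. norm ((div_tensor v \<xi> - div_tensor w \<xi>) $ m))"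
    unfolding norm_vec_def[of "div_tensor v \<xi> - div_tensor w \<xi>"] by (rule L2_set_le_sum) simp
  also have "\<dots> \<le> (\<Sum>m\<in>(UNIV :: 3 set). 3 * (norm \<xi> * ?J))" by (intro sum_mono row)
  finally show ?thesis by simp
qed

definition nonlinear :: "real \<Rightarrow> real \<Rightarrow> real \<Rightarrow> (real^3 \<Rightarrow> complex^3) \<Rightarrow> real^3 \<Rightarrow> complex^3" where
  "nonlinear \<nu> \<alpha> \<Omega> v \<xi> = resolvent \<nu> \<alpha> \<Omega> \<xi> (leray_symbol \<xi> *v div_tensor v \<xi>)"

lemma nonlinear_borel [measurable]:
  "v \<in> borel_measurable borel \<Longrightarrow> nonlinear \<nu> \<alpha> \<Omega> v \<in> borel_measurable borel"
  unfolding nonlinear_def[abs_def] by measurable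

text \<open>\<open>L\<close> is chosen before \<Omega>, as only the diffusive bound for the
  resolvent enters; this makes \<epsilon> independent of the Coriolis parameter. By
  \<open>scaling\<close>, the multiplier \<open>norm \<xi> powr (1 - 2 * \<alpha>)\<close> left by
  divergence and resolvent shifts the weight exactly to the one in
  \<open>weighted_convolution_bound\<close>.\<close>

theorem nonlinear_difference:
  assumes p: "1 < p" and nu: "0 < \<nu>" and s: "3 / 2 * (1 - 1 / p) < s" "s < 3 * (1 - 1 / p)"
    and scaling: "s + (1 - 2 * \<alpha>) = 2 * s - 3 * (1 - 1 / p)"
  shows "\<exists>L>0. \<forall>\<Omega> v w. v \<in> borel_measurable borel \<longrightarrow> w \<in> borel_measurable borel \<longrightarrow>
     wnorm s p v < \<infinity> \<longrightarrow> wnorm s p w < \<infinity> \<longrightarrow>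
     wnorm s p (\<lambda>\<xi>. nonlinear \<nu> \<alpha> \<Omega> v \<xi> - nonlinear \<nu> \<alpha> \<Omega> w \<xi>)
       \<le> ennreal L * (wnorm s p (\<lambda>\<xi>. v \<xi> - w \<xi>) * (wnorm s p v + wnorm s p w))"
proof -
  obtain K where K: "K > 0" and KB: "\<And>f g. f \<in> borel_measurable borel \<Longrightarrow> g \<in> borel_measurable borel \<Longrightarrow> (\<And>x. 0 \<le> f x) \<Longrightarrow> (\<And>x. 0 \<le> g x) \<Longrightarrow>
     (\<integral>\<^sup>+\<xi>. ennreal (norm \<xi> powr ((2 * s - 3 * (1 - 1 / p)) * p)) * ennreal_powr (nn_conv f g \<xi>) p \<partial>lborel)
       \<le> ennreal K * (wnorm s p f * wnorm s p g)"
    using weighted_convolution_bound[OF p s] by blast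
  \<comment> \<open>20 from the resolvent, 18 from the Leray projector, 9 from
    \<open>div_tensor_difference\<close>.\<close>
  define A where "A = 20 * 18 * 9 / \<nu>"
  have A: "A > 0" using nu by (simp add: A_def)
  \<comment> \<open>The first \<open>2 powr p\<close> comes from splitting \<open>j1 + j2\<close>,
    the factor 2 from the two convolutions, and the last \<open>2 powr p\<close> from the bound
    \<open>Nu\<close> for the sum of the magnitudes.\<close>
  define L where "L = 2 powr p * (A powr p * K * 2) * 2 powr p"
  have "L > 0" using A K by (simp add: L_def)
  moreover have "wnorm s p (\<lambda>\<xi>. nonlinear \<nu> \<alpha> \<Omega> v \<xi> - nonlinear \<nu> \<alpha> \<Omega> w \<xi>)
       \<le> ennreal L * (wnorm s p (\<lambda>\<xi>. v \<xi> - w \<xi>) * (wnorm s p v + wnorm s p w))"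
    if [measurable]: "v \<in> borel_measurable borel" "w \<in> borel_measurable borel"
      and fin: "wnorm s p v < \<infinity>" "wnorm s p w < \<infinity>" for \<Omega> v w
  proof -
    define d where "d = mag (\<lambda>\<xi>. v \<xi> - w \<xi>)"
    define u where "u = (\<lambda>\<xi>. mag v \<xi> + mag w \<xi>)"
    have [measurable]: "d \<in> borel_measurable borel" "u \<in> borel_measurable borel"
      unfolding d_def u_def by measurable
    have nn: "0 \<le> d x" "0 \<le> u x" "0 \<le> mag v x" "0 \<le> mag w x" for x by (auto simp: d_def u_def mag_def)
    have Nu: "wnorm s p u \<le> ennreal (2 powr p) * (wnorm s p v + wnorm s p w)"
    proof -
      have "wnorm s p u \<le> ennreal (2 powr p) * (wnorm s p (mag v) + wnorm s p (mag w))"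
        using p by (intro wnorm_triangle) (auto simp: u_def mag_def)
      then show ?thesis by simp
    qed
    have Nd: "wnorm s p d \<le> ennreal (2 powr p) * (wnorm s p v + wnorm s p w)"
      unfolding d_def wnorm_mag using p by (intro wnorm_triangle) (auto simp: norm_triangle_ineq4)
    have f2: "ennreal (2 powr p) * (wnorm s p v + wnorm s p w) < \<infinity>" using fin by (simp add: ennreal_mult_less_top)
    have fu: "wnorm s p u < \<infinity>" and fd: "wnorm s p d < \<infinity>"
      using le_less_trans[OF Nu f2] le_less_trans[OF Nd f2] by auto
    define j1 where "j1 \<xi> = A * norm \<xi> powr (1 - 2 * \<alpha>) * enn2real (nn_conv d u \<xi>)" for \<xi>
    define j2 where "j2 \<xi> = A * norm \<xi> powr (1 - 2 * \<alpha>) * enn2real (nn_conv u d \<xi>)" for \<xi>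
    have [measurable]: "j1 \<in> borel_measurable borel" "j2 \<in> borel_measurable borel"
      unfolding j1_def j2_def by measurable
    note fc = nn_conv_finite_AE[OF p s]
    have fvv: "AE \<xi> in lborel. nn_conv (mag v) (mag v) \<xi> < \<infinity>" "AE \<xi> in lborel. nn_conv (mag w) (mag w) \<xi> < \<infinity>"
      by (rule fc; use nn fin in simp)+
    have fdu: "AE \<xi> in lborel. nn_conv d u \<xi> < \<infinity>" "AE \<xi> in lborel. nn_conv u d \<xi> < \<infinity>"
      by (rule fc; use nn fu fd in simp)+
    have "wnorm s p (\<lambda>\<xi>. nonlinear \<nu> \<alpha> \<Omega> v \<xi> - nonlinear \<nu> \<alpha> \<Omega> w \<xi>) \<le> wnorm s p (\<lambda>\<xi>. j1 \<xi> + j2 \<xi>)"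
    proof (rule wnorm_mono_AE)
      show "AE \<xi> in lborel. norm (nonlinear \<nu> \<alpha> \<Omega> v \<xi> - nonlinear \<nu> \<alpha> \<Omega> w \<xi>) \<le> norm (j1 \<xi> + j2 \<xi>)"
        using fvv fdu AE_lborel_singleton[of 0]
      proof eventually_elim
        case (elim \<xi>)
        let ?J = "enn2real (nn_conv d u \<xi>) + enn2real (nn_conv u d \<xi>)"
        have n: "norm \<xi> > 0" using elim by simp
        have h: "heat_rate \<nu> \<alpha> \<xi> > 0" using n nu by (simp add: heat_rate_def)
        have "nonlinear \<nu> \<alpha> \<Omega> v \<xi> - nonlinear \<nu> \<alpha> \<Omega> w \<xi> = resolvent \<nu> \<alpha> \<Omega> \<xi> (leray_symbol \<xi> *v (div_tensor v \<xi> - div_tensor w \<xi>))"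
          by (simp add: nonlinear_def resolvent_diff matrix_vector_mult_diff_distrib)
        also have "norm \<dots> \<le> 20 / heat_rate \<nu> \<alpha> \<xi> * norm (leray_symbol \<xi> *v (div_tensor v \<xi> - div_tensor w \<xi>))"
          using elim nu by (intro resolvent_norm) auto
        also have "\<dots> \<le> 20 / heat_rate \<nu> \<alpha> \<xi> * (18 * norm (div_tensor v \<xi> - div_tensor w \<xi>))"
          using h by (intro mult_left_mono leray_norm) auto
        also have "\<dots> \<le> 20 / heat_rate \<nu> \<alpha> \<xi> * (18 * (9 * norm \<xi> * ?J))"
          using h elim unfolding d_def u_def by (intro mult_left_mono div_tensor_difference) auto
        also have "\<dots> = j1 \<xi> + j2 \<xi>"
        proof -
          have "norm \<xi> / norm \<xi> powr (2 * \<alpha>) = norm \<xi> powr (1 - 2 * \<alpha>)"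
            using n by (simp add: powr_diff)
          moreover have "20 / heat_rate \<nu> \<alpha> \<xi> * (18 * (9 * norm \<xi> * J)) = A * (norm \<xi> / norm \<xi> powr (2 * \<alpha>)) * J" for J
            by (simp add: heat_rate_def A_def)
          ultimately have "20 / heat_rate \<nu> \<alpha> \<xi> * (18 * (9 * norm \<xi> * ?J)) = A * norm \<xi> powr (1 - 2 * \<alpha>) * ?J"
            by simp
          then show ?thesis by (simp add: j1_def j2_def distrib_left)
        qed
        finally show ?case by simp
      qed
    qed (use p in simp)
    also have "\<dots> \<le> ennreal (2 powr p) * (wnorm s p j1 + wnorm s p j2)"
      using p by (intro wnorm_triangle) (auto simp: norm_triangle_ineq)
    also have "\<dots> \<le> ennreal (2 powr p) * (ennreal (A powr p) * (ennreal K * (wnorm s p d * wnorm s p u)) + ennreal (A powr p) * (ennreal K * (wnorm s p d * wnorm s p u)))"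
    proof -
      \<comment> \<open>One estimate for both orders of the convolution. \<open>enn2real\<close>
        keeps the value because the convolution is finite almost everywhere.\<close>
      have j: "wnorm s p (\<lambda>\<xi>. A * norm \<xi> powr (1 - 2 * \<alpha>) * enn2real (nn_conv f g \<xi>)) \<le> ennreal (A powr p) * (ennreal K * (wnorm s p f * wnorm s p g))"
        if [measurable]: "f \<in> borel_measurable borel" "g \<in> borel_measurable borel" and "\<And>x. 0 \<le> f x" "\<And>x. 0 \<le> g x" and fin: "AE \<xi> in lborel. nn_conv f g \<xi> < \<infinity>" for f g
      proof -
        have [measurable]: "(\<lambda>\<xi>. ennreal_powr (nn_conv f g \<xi>) p) \<in> borel_measurable borel"
          unfolding ennreal_powr_def by measurable
        have "wnorm s p (\<lambda>\<xi>. A * norm \<xi> powr (1 - 2 * \<alpha>) * enn2real (nn_conv f g \<xi>)) =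
           (\<integral>\<^sup>+\<xi>. ennreal (A powr p) * (ennreal (norm \<xi> powr ((2 * s - 3 * (1 - 1 / p)) * p)) * ennreal_powr (nn_conv f g \<xi>) p) \<partial>lborel)"
          unfolding wnorm_def
        proof (rule nn_integral_cong_AE)
          show "AE \<xi> in lborel. ennreal (norm \<xi> powr (s * p) * norm (A * norm \<xi> powr (1 - 2 * \<alpha>) * enn2real (nn_conv f g \<xi>)) powr p) =
             ennreal (A powr p) * (ennreal (norm \<xi> powr ((2 * s - 3 * (1 - 1 / p)) * p)) * ennreal_powr (nn_conv f g \<xi>) p)"
            using fin
          proof eventually_elim
            case (elim \<xi>)
            then obtain J where J: "nn_conv f g \<xi> = ennreal J" "0 \<le> J" by (cases "nn_conv f g \<xi>") auto
            have "norm \<xi> powr (s * p) * (A * norm \<xi> powr (1 - 2 * \<alpha>) * J) powr p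
                = A powr p * ((norm \<xi> powr (s * p) * norm \<xi> powr ((1 - 2 * \<alpha>) * p)) * J powr p)"
              using A J by (simp add: powr_mult powr_powr mult_ac)
            also have "norm \<xi> powr (s * p) * norm \<xi> powr ((1 - 2 * \<alpha>) * p) = norm \<xi> powr ((2 * s - 3 * (1 - 1 / p)) * p)"
              unfolding scaling[symmetric] by (simp only: powr_add[symmetric] distrib_right)
            finally show ?case using J A by (simp add: ennreal_powr_ennreal ennreal_mult)
          qed
        qed
        also have "\<dots> = ennreal (A powr p) * (\<integral>\<^sup>+\<xi>. ennreal (norm \<xi> powr ((2 * s - 3 * (1 - 1 / p)) * p)) * ennreal_powr (nn_conv f g \<xi>) p \<partial>lborel)"
          by (rule nn_integral_cmult) measurable
        also have "\<dots> \<le> ennreal (A powr p) * (ennreal K * (wnorm s p f * wnorm s p g))"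
          using that by (intro mult_left_mono KB) auto
        finally show ?thesis .
      qed
      have "wnorm s p j1 \<le> ennreal (A powr p) * (ennreal K * (wnorm s p d * wnorm s p u))"
        unfolding j1_def using nn fdu by (intro j) auto
      moreover have "wnorm s p j2 \<le> ennreal (A powr p) * (ennreal K * (wnorm s p u * wnorm s p d))"
        unfolding j2_def using nn fdu by (intro j) auto
      ultimately show ?thesis
        by (intro mult_left_mono add_mono) (auto simp: mult.commute[of "wnorm s p u"])
    qed
    also have "\<dots> = ennreal (2 powr p * (A powr p * K * 2)) * (wnorm s p d * wnorm s p u)"
      using K by (simp add: ennreal_mult mult_2[symmetric] mult_ac)
    also have "\<dots> \<le> ennreal (2 powr p * (A powr p * K * 2)) * (wnorm s p d * (ennreal (2 powr p) * (wnorm s p v + wnorm s p w)))"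
      by (intro mult_left_mono Nu) auto
    also have "\<dots> = ennreal L * (wnorm s p (\<lambda>\<xi>. v \<xi> - w \<xi>) * (wnorm s p v + wnorm s p w))"
      using K by (simp add: L_def d_def ennreal_mult mult_ac)
    finally show ?thesis .
  qed
  ultimately show ?thesis by blast
qed

section \<open>Decay of the linear response under strong rotation\<close>

lemma AE_coordinate_nonzero: "AE \<xi> in lborel. (\<xi> :: real^3) $ k \<noteq> 0"
proof -
  have "negligible {x :: real^3. x $ k = 0}" by (rule negligible_standard_hyperplane_cart)
  moreover have "closed {x :: real^3. x $ k = 0}"
    by (intro closed_Collect_eq continuous_intros)
  ultimately have "{x :: real^3. x $ k = 0} \<in> null_sets lborel"
    by (simp add: negligible_iff_null_sets null_sets_completion_iff borel_closed)
  then show ?thesis by (rule AE_I'[of _ lborel]) auto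
qed

text \<open>The resolvent applied to the force tends to \<open>0\<close> wherever \<open>\<xi>\<^sub>3 \<noteq> 0\<close>.\<close>

theorem force_small:
  fixes G :: "real^3 \<Rightarrow> complex^3"
  assumes p: "1 < p" and nu: "0 < \<nu>" and [measurable]: "G \<in> borel_measurable borel"
    and fin: "wnorm (s - 2 * \<alpha>) p G < \<infinity>" and \<eta>: "0 < \<eta>"
  shows "\<exists>\<Omega>\<^sub>0>0. \<forall>\<Omega>. \<bar>\<Omega>\<bar> \<ge> \<Omega>\<^sub>0 \<longrightarrow>
     wnorm s p (\<lambda>\<xi>. resolvent \<nu> \<alpha> \<Omega> \<xi> (leray_symbol \<xi> *v G \<xi>)) \<le> ennreal \<eta>"
proof -
  \<comment> \<open>The smaller of the two bounds in \<open>resolvent_norm\<close>, with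
    \<open>Suc k\<close> as a lower bound for the modulus of \<Omega>. The first entry makes the
    functions \<open>g k\<close> dominated uniformly in \<open>k\<close>, the second makes them tend
    to 0 off the plane \<open>\<xi> $ 3 = 0\<close>.\<close>
  define b where "b k \<xi> = min (20 / heat_rate \<nu> \<alpha> \<xi>) (20 * norm \<xi> / (real (Suc k) * \<bar>\<xi> $ 3\<bar>))" for k :: nat and \<xi> :: "real^3"
  define g where "g k \<xi> = b k \<xi> * (18 * norm (G \<xi>))" for k \<xi>
  have [measurable]: "b k \<in> borel_measurable borel" for k
    unfolding b_def heat_rate_def by measurable
  have [measurable]: "g k \<in> borel_measurable borel" for k unfolding g_def by measurable
  have b0: "0 \<le> b k \<xi>" for k \<xi> using nu by (auto simp: b_def heat_rate_def)
  define u where "u k \<xi> = ennreal (norm \<xi> powr (s * p) * norm (g k \<xi>) powr p)" for k \<xi>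
  define w where "w \<xi> = ennreal ((360 / \<nu>) powr p) * ennreal (norm \<xi> powr ((s - 2 * \<alpha>) * p) * norm (G \<xi>) powr p)" for \<xi>
  have "(\<lambda>k. \<integral>\<^sup>+\<xi>. u k \<xi> \<partial>lborel) \<longlonglongrightarrow> (\<integral>\<^sup>+(\<xi>::real^3). 0 \<partial>lborel)"
  proof (rule nn_integral_dominated_convergence[where w=w])
    show "u k \<in> borel_measurable lborel" for k unfolding u_def by measurable
    show "w \<in> borel_measurable lborel" unfolding w_def by measurable
    have "(\<integral>\<^sup>+\<xi>. w \<xi> \<partial>lborel) = ennreal ((360 / \<nu>) powr p) * wnorm (s - 2 * \<alpha>) p G"
      unfolding w_def wnorm_def by (rule nn_integral_cmult) measurable
    also have "\<dots> < \<infinity>" using fin by (simp add: ennreal_mult_less_top)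
    finally show "(\<integral>\<^sup>+\<xi>. w \<xi> \<partial>lborel) < \<infinity>" .
    show "AE \<xi> in lborel. u k \<xi> \<le> w \<xi>" for k
      using AE_lborel_singleton[of 0]
    proof eventually_elim
      case (elim \<xi>)
      have "norm (g k \<xi>) = b k \<xi> * (18 * norm (G \<xi>))" using b0[of k \<xi>] by (simp add: g_def)
      also have "\<dots> \<le> 20 / heat_rate \<nu> \<alpha> \<xi> * (18 * norm (G \<xi>))"
        by (intro mult_right_mono) (auto simp: b_def)
      also have "\<dots> = (360 / \<nu>) * norm \<xi> powr (- (2 * \<alpha>)) * norm (G \<xi>)"
        by (simp add: heat_rate_def powr_minus divide_inverse)
      finally have "norm (g k \<xi>) powr p \<le> ((360 / \<nu>) * norm \<xi> powr (- (2 * \<alpha>)) * norm (G \<xi>)) powr p"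
        using p by (intro powr_mono2) auto
      also have "\<dots> = (360 / \<nu>) powr p * norm \<xi> powr (- (2 * \<alpha>) * p) * norm (G \<xi>) powr p"
      proof -
        have "(c * X * Y) powr p = c powr p * X powr p * Y powr p" if "0 \<le> c" "0 \<le> X" "0 \<le> Y" for c X Y :: real
          using that by (simp add: powr_mult)
        from this[of "360 / \<nu>" "norm \<xi> powr (- (2 * \<alpha>))" "norm (G \<xi>)"] show ?thesis
          using nu unfolding powr_powr by simp
      qed
      finally have "norm \<xi> powr (s * p) * norm (g k \<xi>) powr p \<le> norm \<xi> powr (s * p) * ((360 / \<nu>) powr p * norm \<xi> powr (- (2 * \<alpha>) * p) * norm (G \<xi>) powr p)"
        by (intro mult_left_mono) auto
      also have "\<dots> = (360 / \<nu>) powr p * ((norm \<xi> powr (s * p) * norm \<xi> powr (- (2 * \<alpha>) * p)) * norm (G \<xi>) powr p)"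
        by (simp only: mult_ac)
      also have "norm \<xi> powr (s * p) * norm \<xi> powr (- (2 * \<alpha>) * p) = norm \<xi> powr ((s - 2 * \<alpha>) * p)"
        by (simp add: powr_add[symmetric] left_diff_distrib)
      finally show ?case unfolding u_def w_def
        by (subst ennreal_mult[symmetric]) (auto intro!: ennreal_leI)
    qed
    show "AE \<xi> in lborel. (\<lambda>k. u k \<xi>) \<longlonglongrightarrow> 0"
      using AE_coordinate_nonzero[of 3]
    proof eventually_elim
      case (elim \<xi>)
      have le: "b k \<xi> \<le> (20 * norm \<xi> / \<bar>\<xi> $ 3\<bar>) * (1 / real (Suc k))" for k
        unfolding b_def by (rule order_trans[OF min.cobounded2]) (simp add: mult.commute)
      have "(\<lambda>k. (20 * norm \<xi> / \<bar>\<xi> $ 3\<bar>) * (1 / real (Suc k))) \<longlonglongrightarrow> (20 * norm \<xi> / \<bar>\<xi> $ 3\<bar>) * 0"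
        by (intro tendsto_intros LIMSEQ_Suc[OF lim_1_over_n])
      then have "(\<lambda>k. (20 * norm \<xi> / \<bar>\<xi> $ 3\<bar>) * (1 / real (Suc k))) \<longlonglongrightarrow> 0" by simp
      then have "(\<lambda>k. b k \<xi>) \<longlonglongrightarrow> 0"
        by (rule tendsto_sandwich[OF _ _ tendsto_const, rotated 2]) (intro always_eventually allI b0 le)+
      then have "(\<lambda>k. g k \<xi>) \<longlonglongrightarrow> 0 * (18 * norm (G \<xi>))" unfolding g_def by (intro tendsto_intros)
      then have "(\<lambda>k. g k \<xi>) \<longlonglongrightarrow> 0" by simp
      then have "(\<lambda>k. norm (g k \<xi>)) \<longlonglongrightarrow> 0" by (rule tendsto_norm_zero)
      then have "(\<lambda>k. norm (g k \<xi>) powr p) \<longlonglongrightarrow> 0 powr p"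
        using p by (intro tendsto_powr') auto
      then have "(\<lambda>k. norm \<xi> powr (s * p) * norm (g k \<xi>) powr p) \<longlonglongrightarrow> norm \<xi> powr (s * p) * 0"
        using p by (intro tendsto_intros) auto
      from tendsto_ennrealI[OF this] show ?case by (simp add: u_def)
    qed
  qed auto
  then have "(\<lambda>k. wnorm s p (g k)) \<longlonglongrightarrow> 0" by (simp add: u_def wnorm_def)
  then have "\<forall>\<^sub>F k in sequentially. wnorm s p (g k) < ennreal \<eta>"
    using \<eta> by (intro order_tendstoD(2)) auto
  then obtain k where k: "wnorm s p (g k) < ennreal \<eta>" by (auto simp: eventually_sequentially)
  \<comment> \<open>The single function \<open>g k\<close> majorises the response for every \<Omega>
    of modulus at least \<open>Suc k\<close>, so the limit along natural numbers settles all real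
    \<Omega>.\<close>
  have "wnorm s p (\<lambda>\<xi>. resolvent \<nu> \<alpha> \<Omega> \<xi> (leray_symbol \<xi> *v G \<xi>)) \<le> ennreal \<eta>" if Om: "\<bar>\<Omega>\<bar> \<ge> real (Suc k)" for \<Omega>
  proof -
    have "wnorm s p (\<lambda>\<xi>. resolvent \<nu> \<alpha> \<Omega> \<xi> (leray_symbol \<xi> *v G \<xi>)) \<le> wnorm s p (g k)"
    proof (rule wnorm_mono_AE)
      show "AE \<xi> in lborel. norm (resolvent \<nu> \<alpha> \<Omega> \<xi> (leray_symbol \<xi> *v G \<xi>)) \<le> norm (g k \<xi>)"
        using AE_coordinate_nonzero[of 3]
      proof eventually_elim
        case (elim \<xi>)
        then have xi: "\<xi> \<noteq> 0" by auto
        have c: "\<bar>coriolis_rate \<Omega> \<xi>\<bar> = \<bar>\<Omega>\<bar> * \<bar>\<xi> $ 3\<bar> / norm \<xi>" by (simp add: coriolis_rate_def abs_mult)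
        have c0: "coriolis_rate \<Omega> \<xi> \<noteq> 0" using elim xi Om by (auto simp: coriolis_rate_def)
        let ?w = "leray_symbol \<xi> *v G \<xi>"
        have "real (Suc k) * \<bar>\<xi> $ 3\<bar> / norm \<xi> \<le> \<bar>coriolis_rate \<Omega> \<xi>\<bar>"
          unfolding c using Om by (intro divide_right_mono mult_right_mono) auto
        moreover have "0 < real (Suc k) * \<bar>\<xi> $ 3\<bar> / norm \<xi>" using elim xi by (intro divide_pos_pos mult_pos_pos) auto
        ultimately have "20 / \<bar>coriolis_rate \<Omega> \<xi>\<bar> \<le> 20 / (real (Suc k) * \<bar>\<xi> $ 3\<bar> / norm \<xi>)"
          by (intro divide_left_mono mult_pos_pos) auto
        then have "20 / \<bar>coriolis_rate \<Omega> \<xi>\<bar> * norm ?w \<le> 20 * norm \<xi> / (real (Suc k) * \<bar>\<xi> $ 3\<bar>) * norm ?w"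
          by (intro mult_right_mono) auto
        then have "norm (resolvent \<nu> \<alpha> \<Omega> \<xi> ?w) \<le> b k \<xi> * norm ?w"
          using resolvent_norm(1)[OF xi nu, where w="?w" and \<alpha>=\<alpha> and \<Omega>=\<Omega>]
            resolvent_norm(2)[OF xi nu c0, where w="?w" and \<alpha>=\<alpha>] unfolding b_def min_def by auto
        also have "\<dots> \<le> g k \<xi>" unfolding g_def by (intro mult_left_mono leray_norm b0)
        also have "\<dots> \<le> norm (g k \<xi>)" by simp
        finally show ?case .
      qed
    qed (use p in simp)
    with k show ?thesis by simp
  qed
  then show ?thesis by (intro exI[of _ "real (Suc k)"]) auto
qed

subsection \<open>Fixed points\<close>

lemma nonlinear_zero: "nonlinear \<nu> \<alpha> \<Omega> (\<lambda>_. 0) = (\<lambda>_. 0)"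
proof
  fix \<xi>
  have "div_tensor (\<lambda>_. 0) \<xi> = 0" by (simp add: div_tensor_def conv_def vec_eq_iff)
  then show "nonlinear \<nu> \<alpha> \<Omega> (\<lambda>_. 0) \<xi> = 0" by (simp add: nonlinear_def resolvent_def)
qed

lemma wnorm_zero: "p > 0 \<Longrightarrow> wnorm s p (\<lambda>_. 0) = 0"
  by (simp add: wnorm_def)

context
  fixes p s L \<nu> \<alpha> \<Omega> :: real
  assumes p: "1 < p" and L: "0 < L"
    and Q: "\<And>v w. v \<in> borel_measurable borel \<Longrightarrow> w \<in> borel_measurable borel \<Longrightarrow>
     wnorm s p v < \<infinity> \<Longrightarrow> wnorm s p w < \<infinity> \<Longrightarrow>
     wnorm s p (\<lambda>\<xi>. nonlinear \<nu> \<alpha> \<Omega> v \<xi> - nonlinear \<nu> \<alpha> \<Omega> w \<xi>)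
       \<le> ennreal L * (wnorm s p (\<lambda>\<xi>. v \<xi> - w \<xi>) * (wnorm s p v + wnorm s p w))"
begin

text \<open>The two radii are kept apart because the limit of the iteration is controlled only in a
  larger ball than the iterates.\<close>

lemma nonlinear_contraction:
  assumes "v \<in> borel_measurable borel" "w \<in> borel_measurable borel"
    and le: "wnorm s p v \<le> ennreal c" "wnorm s p w \<le> ennreal d" and c: "0 \<le> c" "0 \<le> d"
  shows "wnorm s p (\<lambda>\<xi>. nonlinear \<nu> \<alpha> \<Omega> v \<xi> - nonlinear \<nu> \<alpha> \<Omega> w \<xi>)
       \<le> ennreal (L * (c + d)) * wnorm s p (\<lambda>\<xi>. v \<xi> - w \<xi>)"
proof -
  have "wnorm s p v < \<infinity>" "wnorm s p w < \<infinity>"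
    using le by (auto intro: le_less_trans)
  from Q[OF assms(1,2) this]
  have "wnorm s p (\<lambda>\<xi>. nonlinear \<nu> \<alpha> \<Omega> v \<xi> - nonlinear \<nu> \<alpha> \<Omega> w \<xi>)
       \<le> ennreal L * (wnorm s p (\<lambda>\<xi>. v \<xi> - w \<xi>) * (wnorm s p v + wnorm s p w))" .
  also have "\<dots> \<le> ennreal L * (wnorm s p (\<lambda>\<xi>. v \<xi> - w \<xi>) * (ennreal c + ennreal d))"
    by (intro mult_left_mono add_mono le) auto
  also have "\<dots> = ennreal (L * (c + d)) * wnorm s p (\<lambda>\<xi>. v \<xi> - w \<xi>)"
    using c L by (simp add: ennreal_mult ennreal_plus mult_ac)
  finally show ?thesis .
qed

text \<open>The difference of two solutions equals, up to sign, the difference of their nonlinear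
  terms, and in the given ball this is at most half of the original difference in
  \<open>wnorm\<close>.\<close>

lemma fixed_point_unique:
  assumes [measurable]: "v \<in> borel_measurable borel" "w \<in> borel_measurable borel"
    and le: "wnorm s p v \<le> ennreal c" "wnorm s p w \<le> ennreal c" and c: "0 \<le> c" "L * (2 * c) \<le> 1 / 2"
    and v: "AE \<xi> in lborel. v \<xi> = y \<xi> - nonlinear \<nu> \<alpha> \<Omega> v \<xi>"
    and w: "AE \<xi> in lborel. w \<xi> = y \<xi> - nonlinear \<nu> \<alpha> \<Omega> w \<xi>"
  shows "AE \<xi> in lborel. v \<xi> = w \<xi>"
proof -
  let ?N = "wnorm s p (\<lambda>\<xi>. v \<xi> - w \<xi>)"
  have "?N = wnorm s p (\<lambda>\<xi>. nonlinear \<nu> \<alpha> \<Omega> v \<xi> - nonlinear \<nu> \<alpha> \<Omega> w \<xi>)"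
  proof (rule wnorm_cong_AE)
    show "AE \<xi> in lborel. norm (v \<xi> - w \<xi>) = norm (nonlinear \<nu> \<alpha> \<Omega> v \<xi> - nonlinear \<nu> \<alpha> \<Omega> w \<xi>)"
      using v w
    proof eventually_elim
      case (elim \<xi>)
      have "v \<xi> - w \<xi> = - (nonlinear \<nu> \<alpha> \<Omega> v \<xi> - nonlinear \<nu> \<alpha> \<Omega> w \<xi>)"
        by (subst elim(1), subst elim(2)) simp
      then show ?case by (simp only: norm_minus_cancel)
    qed
  qed
  also have "\<dots> \<le> ennreal (L * (c + c)) * ?N"
    by (rule nonlinear_contraction) (use le c in auto)
  also have "\<dots> \<le> ennreal (1 / 2) * ?N"
    using c by (intro mult_right_mono ennreal_leI) auto
  finally have half: "?N \<le> ennreal (1 / 2) * ?N" .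
  \<comment> \<open>The inequality \<open>half\<close> is also satisfied by infinity; the distance
    has to be finite before it can be cancelled.\<close>
  have "?N \<le> ennreal (2 powr p) * (wnorm s p v + wnorm s p w)"
    using p by (intro wnorm_triangle) (auto simp: norm_triangle_ineq4)
  also have "\<dots> < \<infinity>" using le by (auto simp: ennreal_mult_less_top intro: le_less_trans)
  finally obtain n where n: "?N = ennreal n" "0 \<le> n" by (cases ?N) auto
  have "n \<le> 1 / 2 * n" using half n by (simp add: ennreal_mult[symmetric] del: ennreal_half)
  then have "?N = 0" using n by simp
  then have "AE \<xi> in lborel. v \<xi> - w \<xi> = 0" by (rule wnorm_eq_0D) measurable
  then show ?thesis by simp
qed

text \<open>Picard iteration from 0. After the loss in the triangle inequality, \<open>y\<close>
  uses up \<delta> / 2 and the quadratic term at most the other half, so the iterates stay in the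
  ball of radius \<delta>. The Lipschitz factor \<open>4 powr (- p)\<close> in \<open>small\<close>
  is the rate that \<open>wnorm_complete\<close> demands. One more triangle inequality for the limit
  accounts for \<open>2 powr p * \<delta>\<close>.\<close>

lemma fixed_point_exists:
  assumes [measurable]: "y \<in> borel_measurable borel" and \<delta>: "0 < \<delta>" and small: "L * (2 * \<delta>) \<le> 4 powr (- p)"
    and y: "wnorm s p y \<le> ennreal (\<delta> / (2 * 2 powr p))"
  obtains v where "v \<in> borel_measurable borel" "wnorm s p v \<le> ennreal (2 powr p * \<delta>)"
    "AE \<xi> in lborel. v \<xi> = y \<xi> - nonlinear \<nu> \<alpha> \<Omega> v \<xi>"
proof -
  define \<Phi> where "\<Phi> v \<xi> = y \<xi> - nonlinear \<nu> \<alpha> \<Omega> v \<xi>" for v \<xi>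
  define x where "x n = (\<Phi> ^^ n) (\<lambda>_. 0)" for n
  have x0: "x 0 = (\<lambda>_. 0)" and xS: "x (Suc n) = \<Phi> (x n)" for n by (simp_all add: x_def)
  have \<Phi>b [measurable]: "v \<in> borel_measurable borel \<Longrightarrow> \<Phi> v \<in> borel_measurable borel" for v
    unfolding \<Phi>_def[abs_def] by measurable
  have xb [measurable]: "x n \<in> borel_measurable borel" for n
    by (induction n) (simp_all add: x0 xS)
  have \<Phi>d: "wnorm s p (\<lambda>\<xi>. \<Phi> v \<xi> - \<Phi> w \<xi>) = wnorm s p (\<lambda>\<xi>. nonlinear \<nu> \<alpha> \<Omega> v \<xi> - nonlinear \<nu> \<alpha> \<Omega> w \<xi>)" for v w
    by (rule wnorm_cong_AE) (simp add: \<Phi>_def norm_minus_commute)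
  have swap: "wnorm s p (\<lambda>\<xi>. f \<xi> - g \<xi>) = wnorm s p (\<lambda>\<xi>. g \<xi> - f \<xi>)" for f g :: "real^3 \<Rightarrow> complex^3"
    by (rule wnorm_cong_AE) (simp add: norm_minus_commute)
  have two: "2 powr p * 4 powr (- p) \<le> (1 :: real)"
  proof -
    have "2 powr p * 4 powr (- p) \<le> 4 powr p * 4 powr (- p :: real)" using p by (intro mult_right_mono powr_mono2) auto
    then show ?thesis by (simp add: powr_add[symmetric])
  qed
  have xn: "wnorm s p (x n) \<le> ennreal \<delta>" for n
  proof (induction n)
    case 0
    show ?case using p by (simp add: x0 wnorm_zero)
  next
    case (Suc n)
    have "wnorm s p (nonlinear \<nu> \<alpha> \<Omega> (x n)) = wnorm s p (\<lambda>\<xi>. nonlinear \<nu> \<alpha> \<Omega> (x n) \<xi> - nonlinear \<nu> \<alpha> \<Omega> (\<lambda>_. 0) \<xi>)"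
      by (simp add: nonlinear_zero)
    also have "\<dots> \<le> ennreal (L * (\<delta> + 0)) * wnorm s p (\<lambda>\<xi>. x n \<xi> - 0)"
      by (rule nonlinear_contraction) (use Suc \<delta> p in \<open>auto simp: wnorm_zero\<close>)
    also have "\<dots> \<le> ennreal (L * (\<delta> + 0)) * ennreal \<delta>" using Suc by (intro mult_left_mono) auto
    also have "\<dots> = ennreal (L * \<delta> * \<delta>)" using L \<delta> by (simp add: ennreal_mult[symmetric])
    finally have q: "wnorm s p (nonlinear \<nu> \<alpha> \<Omega> (x n)) \<le> ennreal (L * \<delta> * \<delta>)" .
    have "wnorm s p (x (Suc n)) \<le> ennreal (2 powr p) * (wnorm s p y + wnorm s p (nonlinear \<nu> \<alpha> \<Omega> (x n)))"
      using p by (intro wnorm_triangle) (auto simp: xS \<Phi>_def norm_triangle_ineq4)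
    also have "\<dots> \<le> ennreal (2 powr p) * (ennreal (\<delta> / (2 * 2 powr p)) + ennreal (L * \<delta> * \<delta>))"
      by (intro mult_left_mono add_mono y q) auto
    also have "\<dots> = ennreal (\<delta> / 2 + (2 powr p * (L * (2 * \<delta>))) * \<delta> / 2)"
      using L \<delta> by (simp add: ennreal_mult[symmetric] ennreal_plus[symmetric] distrib_left mult_ac del: ennreal_plus)
    also have "\<dots> \<le> ennreal \<delta>"
    proof (rule ennreal_leI)
      have "2 powr p * (L * (2 * \<delta>)) \<le> 2 powr p * 4 powr (- p)" using small by (intro mult_left_mono) auto
      with two have "2 powr p * (L * (2 * \<delta>)) \<le> 1" by linarith
      then have "(2 powr p * (L * (2 * \<delta>))) * \<delta> \<le> 1 * \<delta>" using \<delta> by (intro mult_right_mono) auto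
      then show "\<delta> / 2 + (2 powr p * (L * (2 * \<delta>))) * \<delta> / 2 \<le> \<delta>" by linarith
    qed
    finally show ?case .
  qed
  have dn: "wnorm s p (\<lambda>\<xi>. x (Suc n) \<xi> - x n \<xi>) \<le> ennreal (\<delta> * (4 powr (- p)) ^ n)" for n
  proof (induction n)
    case 0
    show ?case using xn[of 1] by (simp add: x0)
  next
    case (Suc n)
    have "wnorm s p (\<lambda>\<xi>. x (Suc (Suc n)) \<xi> - x (Suc n) \<xi>) \<le> ennreal (L * (\<delta> + \<delta>)) * wnorm s p (\<lambda>\<xi>. x (Suc n) \<xi> - x n \<xi>)"
      unfolding xS[of "Suc n"] xS[of n] \<Phi>d unfolding xS[symmetric]
      by (rule nonlinear_contraction) (use xn \<delta> in auto)
    also have "\<dots> \<le> ennreal (4 powr (- p)) * ennreal (\<delta> * (4 powr (- p)) ^ n)"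
      using small by (intro mult_mono Suc ennreal_leI) auto
    also have "\<dots> = ennreal (\<delta> * (4 powr (- p)) ^ Suc n)"
      using \<delta> by (simp add: ennreal_mult[symmetric] mult_ac)
    finally show ?case .
  qed
  obtain u where ub [measurable]: "u \<in> borel_measurable borel" and lim: "(\<lambda>n. wnorm s p (\<lambda>\<xi>. u \<xi> - x n \<xi>)) \<longlonglongrightarrow> 0"
    by (rule wnorm_complete[OF xb _ _ dn]) (use p \<delta> in auto)
  have Nu: "wnorm s p u \<le> ennreal (2 powr p * \<delta>)"
  proof (rule tendsto_lowerbound)
    have "(\<lambda>n. ennreal (2 powr p) * (ennreal \<delta> + wnorm s p (\<lambda>\<xi>. u \<xi> - x n \<xi>))) \<longlonglongrightarrow> ennreal (2 powr p) * (ennreal \<delta> + 0)"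
      by (intro ennreal_tendsto_cmult tendsto_add tendsto_const lim) auto
    then show "(\<lambda>n. ennreal (2 powr p) * (ennreal \<delta> + wnorm s p (\<lambda>\<xi>. u \<xi> - x n \<xi>))) \<longlonglongrightarrow> ennreal (2 powr p * \<delta>)"
      using \<delta> by (simp add: ennreal_mult)
    show "\<forall>\<^sub>F n in sequentially. wnorm s p u \<le> ennreal (2 powr p) * (ennreal \<delta> + wnorm s p (\<lambda>\<xi>. u \<xi> - x n \<xi>))"
    proof (intro always_eventually allI)
      fix n
      have "wnorm s p u \<le> ennreal (2 powr p) * (wnorm s p (x n) + wnorm s p (\<lambda>\<xi>. u \<xi> - x n \<xi>))"
      proof (rule wnorm_triangle)
        show "AE \<xi> in lborel. norm (u \<xi>) \<le> norm (x n \<xi>) + norm (u \<xi> - x n \<xi>)"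
          by (intro AE_I2) (metis add.commute diff_add_cancel norm_triangle_ineq)
      qed (use p in auto)
      also have "\<dots> \<le> ennreal (2 powr p) * (ennreal \<delta> + wnorm s p (\<lambda>\<xi>. u \<xi> - x n \<xi>))"
        by (intro mult_left_mono add_mono xn) auto
      finally show "wnorm s p u \<le> ennreal (2 powr p) * (ennreal \<delta> + wnorm s p (\<lambda>\<xi>. u \<xi> - x n \<xi>))" .
    qed
  qed simp
  \<comment> \<open>A Lipschitz constant between the iterates and the limit; being finite is enough,
    since it multiplies a quantity that tends to 0.\<close>
  let ?K = "ennreal (L * (\<delta> + 2 powr p * \<delta>))"
  have "wnorm s p (\<lambda>\<xi>. u \<xi> - \<Phi> u \<xi>) \<le> 0"
  proof (rule tendsto_lowerbound)
    have "(\<lambda>n. ennreal (2 powr p) * (wnorm s p (\<lambda>\<xi>. u \<xi> - x (Suc n) \<xi>) + ?K * wnorm s p (\<lambda>\<xi>. u \<xi> - x n \<xi>)))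
        \<longlonglongrightarrow> ennreal (2 powr p) * (0 + ?K * 0)"
      by (intro ennreal_tendsto_cmult tendsto_add LIMSEQ_Suc[OF lim] lim) auto
    then show "(\<lambda>n. ennreal (2 powr p) * (wnorm s p (\<lambda>\<xi>. u \<xi> - x (Suc n) \<xi>) + ?K * wnorm s p (\<lambda>\<xi>. u \<xi> - x n \<xi>))) \<longlonglongrightarrow> 0"
      by simp
    show "\<forall>\<^sub>F n in sequentially. wnorm s p (\<lambda>\<xi>. u \<xi> - \<Phi> u \<xi>) \<le>
        ennreal (2 powr p) * (wnorm s p (\<lambda>\<xi>. u \<xi> - x (Suc n) \<xi>) + ?K * wnorm s p (\<lambda>\<xi>. u \<xi> - x n \<xi>))"
    proof (intro always_eventually allI)
      fix n
      have "wnorm s p (\<lambda>\<xi>. u \<xi> - \<Phi> u \<xi>) \<le> ennreal (2 powr p) * (wnorm s p (\<lambda>\<xi>. u \<xi> - x (Suc n) \<xi>) + wnorm s p (\<lambda>\<xi>. \<Phi> (x n) \<xi> - \<Phi> u \<xi>))"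
      proof (rule wnorm_triangle)
        show "AE \<xi> in lborel. norm (u \<xi> - \<Phi> u \<xi>) \<le> norm (u \<xi> - x (Suc n) \<xi>) + norm (\<Phi> (x n) \<xi> - \<Phi> u \<xi>)"
          unfolding xS by (intro AE_I2) (metis diff_add_cancel add_diff_eq norm_triangle_ineq)
      qed (use p in auto)
      also have "wnorm s p (\<lambda>\<xi>. \<Phi> (x n) \<xi> - \<Phi> u \<xi>) \<le> ?K * wnorm s p (\<lambda>\<xi>. x n \<xi> - u \<xi>)"
        unfolding \<Phi>d by (rule nonlinear_contraction) (use xn Nu \<delta> in auto)
      also have "wnorm s p (\<lambda>\<xi>. x n \<xi> - u \<xi>) = wnorm s p (\<lambda>\<xi>. u \<xi> - x n \<xi>)" by (rule swap)
      finally show "wnorm s p (\<lambda>\<xi>. u \<xi> - \<Phi> u \<xi>) \<le>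
        ennreal (2 powr p) * (wnorm s p (\<lambda>\<xi>. u \<xi> - x (Suc n) \<xi>) + ?K * wnorm s p (\<lambda>\<xi>. u \<xi> - x n \<xi>))"
        by (simp add: mult_left_mono add_left_mono)
    qed
  qed simp
  then have "AE \<xi> in lborel. u \<xi> - \<Phi> u \<xi> = 0" by (intro wnorm_eq_0D) auto
  then have "AE \<xi> in lborel. u \<xi> = y \<xi> - nonlinear \<nu> \<alpha> \<Omega> u \<xi>" by (simp add: \<Phi>_def)
  with Nu show ?thesis by (intro that[of u]) auto
qed

end

section \<open>Return to Fourier-Besov norms\<close>

lemma ennreal_powr_le_iff:
  assumes "p > 0" "0 \<le> c"
  shows "ennreal_powr x p \<le> ennreal (c powr p) \<longleftrightarrow> x \<le> ennreal c"
proof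
  assume "ennreal_powr x p \<le> ennreal (c powr p)"
  then have "ennreal_powr (ennreal_powr x p) (1 / p) \<le> ennreal_powr (ennreal (c powr p)) (1 / p)"
    using assms by (intro ennreal_powr_mono) auto
  then show "x \<le> ennreal c" using assms by (simp add: ennreal_powr_inverse ennreal_powr_ennreal powr_powr)
next
  assume "x \<le> ennreal c"
  then have "ennreal_powr x p \<le> ennreal_powr (ennreal c) p" using assms by (intro ennreal_powr_mono) auto
  then show "ennreal_powr x p \<le> ennreal (c powr p)" using assms by (simp add: ennreal_powr_ennreal)
qed

lemma ennreal_le_divide:
  assumes "ennreal a * x \<le> ennreal e" "a > 0" "0 \<le> e"
  shows "x \<le> ennreal (e / a)"
  using assms by (cases x) (auto simp: ennreal_mult[symmetric] ennreal_mult_top top_unique field_simps)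

theorem theorem3p4:
  fixes \<phi> :: "real^3 \<Rightarrow> complex" and p \<alpha> \<nu> :: real
  assumes "littlewood_paley \<phi>"
    and "1 < p"
    and "1 / 2 < \<alpha>" and "\<alpha> < (5 - 3 / p) / 4"
    and "\<nu> > 0"
  shows "\<exists>\<epsilon>>0. \<forall>F \<in> fb_space \<phi> (4 - 4 * \<alpha> - 3 / p) p p. \<exists>\<Omega>\<^sub>0>0.
           \<forall>\<Omega>. \<bar>\<Omega>\<bar> \<ge> \<Omega>\<^sub>0 \<longrightarrow>
             (\<exists>!u. stationary_mild_solution \<phi> p \<nu> \<alpha> \<Omega> F u \<and>
                   fb_norm \<phi> (4 - 2 * \<alpha> - 3 / p) p p u \<le> ennreal (2 * \<epsilon>))"
proof -
  note lp = assms(1) and p = assms(2) and nu = assms(5)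
  define s where "s = 4 - 2 * \<alpha> - 3 / p"
  \<comment> \<open>The lower bound on \<open>s\<close> is the upper bound on \<alpha>, and the
    upper bound on \<open>s\<close> is \<open>1 / 2 < \<alpha>\<close>.\<close>
  have s: "3 / 2 * (1 - 1 / p) < s" "s < 3 * (1 - 1 / p)" and scaling: "s + (1 - 2 * \<alpha>) = 2 * s - 3 * (1 - 1 / p)"
    using assms(3,4) by (auto simp: s_def field_simps)
  have "1 / p < 1" using p by simp
  then have "0 < 3 / 2 * (1 - 1 / p)" by (intro mult_pos_pos) auto
  with s(1) have s0: "0 < s" by linarith
  have p0: "p > 0" using p by simp
  obtain L where L: "L > 0" and Q: "\<And>\<Omega> v w. v \<in> borel_measurable borel \<Longrightarrow> w \<in> borel_measurable borel \<Longrightarrow>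
     wnorm s p v < \<infinity> \<Longrightarrow> wnorm s p w < \<infinity> \<Longrightarrow>
     wnorm s p (\<lambda>\<xi>. nonlinear \<nu> \<alpha> \<Omega> v \<xi> - nonlinear \<nu> \<alpha> \<Omega> w \<xi>)
       \<le> ennreal L * (wnorm s p (\<lambda>\<xi>. v \<xi> - w \<xi>) * (wnorm s p v + wnorm s p w))"
    using nonlinear_difference[OF p nu s scaling] by blast
  obtain a b where ab: "a > 0" "b > 0" and
    lower: "\<And>f. fourier_fun f \<in> borel_measurable borel \<Longrightarrow> ennreal a * wnorm s p (fourier_fun f) \<le> ennreal_powr (fb_norm \<phi> s p p f) p" and
    upper: "\<And>f. fourier_fun f \<in> borel_measurable borel \<Longrightarrow> ennreal_powr (fb_norm \<phi> s p p f) p \<le> ennreal b * wnorm s p (fourier_fun f)"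
    using fb_norm_wnorm[OF lp p0, of s] by blast
  \<comment> \<open>\<open>e\<close> is the p-th power of the radius \<open>2 * \<epsilon>\<close>.
    The first entry serves uniqueness, where every competitor in the Fourier-Besov ball has
    \<open>wnorm\<close> at most \<open>e / a\<close>; the second is the smallness condition of the
    iteration, expressed through \<delta>. Neither involves the force or \<Omega>.\<close>
  define e where "e = min (a / (4 * L)) (b * 2 powr p * 4 powr (- p) / (2 * L))"
  have e: "e > 0" using ab L by (simp add: e_def)
  define \<epsilon> where "\<epsilon> = e powr (1 / p) / 2"
  have eps: "\<epsilon> > 0" "(2 * \<epsilon>) powr p = e" using e p0 by (auto simp: \<epsilon>_def powr_powr)
  \<comment> \<open>The iteration ends in the ball of radius \<open>2 powr p * \<delta>\<close>,
    which the upper equivalence constant \<open>b\<close> turns into exactly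
    \<open>e\<close>.\<close>
  define \<delta> where "\<delta> = e / (b * 2 powr p)"
  have \<delta>: "\<delta> > 0" using e ab by (simp add: \<delta>_def)
  have small: "L * (2 * \<delta>) \<le> 4 powr (- p)"
  proof -
    have "e \<le> b * 2 powr p * 4 powr (- p) / (2 * L)" by (simp add: e_def)
    then have "e * (2 * L) \<le> b * 2 powr p * 4 powr (- p)" using L by (simp add: pos_le_divide_eq)
    then show ?thesis using ab by (simp add: \<delta>_def divide_le_eq mult_ac)
  qed
  have unique: "L * (2 * (e / a)) \<le> 1 / 2"
  proof -
    have "e \<le> a / (4 * L)" by (simp add: e_def)
    then have "e * (4 * L) \<le> a" using L by (simp add: pos_le_divide_eq)
    then have "L * (2 * e) \<le> (1 / 2) * a" by (simp add: mult_ac)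
    then have "L * (2 * e) / a \<le> 1 / 2" using ab by (simp only: pos_divide_le_eq)
    then show ?thesis by simp
  qed
  have mild: "stationary_mild_solution \<phi> p \<nu> \<alpha> \<Omega> F u \<longleftrightarrow> (\<forall>m. \<exists>g. has_fourier_fun (u $ m) g) \<and> fb_norm \<phi> s p p u < \<infinity> \<and>
      (AE \<xi> in lborel. \<forall>m k. conv_integrable_at (\<lambda>\<eta>. fourier_fun u \<eta> $ m) (\<lambda>\<eta>. fourier_fun u \<eta> $ k) \<xi>) \<and>
      (AE \<xi> in lborel. fourier_fun u \<xi> = resolvent \<nu> \<alpha> \<Omega> \<xi> (leray_symbol \<xi> *v fourier_fun F \<xi>) - nonlinear \<nu> \<alpha> \<Omega> (fourier_fun u) \<xi>)" for \<Omega> F u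
    unfolding stationary_mild_solution_def Let_def mild_iff_resolvent[OF nu] nonlinear_def fb_space_def s_def by auto
  have "\<exists>\<Omega>\<^sub>0>0. \<forall>\<Omega>. \<bar>\<Omega>\<bar> \<ge> \<Omega>\<^sub>0 \<longrightarrow> (\<exists>!u. stationary_mild_solution \<phi> p \<nu> \<alpha> \<Omega> F u \<and> fb_norm \<phi> s p p u \<le> ennreal (2 * \<epsilon>))"
    if F: "F \<in> fb_space \<phi> (4 - 4 * \<alpha> - 3 / p) p p" for F
  proof -
    define G where "G = fourier_fun F"
    have G [measurable]: "G \<in> borel_measurable borel"
      using F by (auto simp: G_def fb_space_def intro: fourier_fun_borel)
    have "wnorm (s - 2 * \<alpha>) p G < \<infinity>"
    proof -
      have sF: "s - 2 * \<alpha> = 4 - 4 * \<alpha> - 3 / p" by (simp add: s_def)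
      obtain a' where a': "a' > 0" "ennreal a' * wnorm (s - 2 * \<alpha>) p G \<le> ennreal_powr (fb_norm \<phi> (s - 2 * \<alpha>) p p F) p"
        using fb_norm_wnorm[OF lp p0, of "s - 2 * \<alpha>"] G unfolding G_def by blast
      have "fb_norm \<phi> (s - 2 * \<alpha>) p p F \<noteq> \<infinity>" using F by (auto simp: fb_space_def sF)
      then have "ennreal_powr (fb_norm \<phi> (s - 2 * \<alpha>) p p F) p < \<infinity>" by (simp add: ennreal_powr_def)
      with a'(2) have "ennreal a' * wnorm (s - 2 * \<alpha>) p G < \<infinity>" by (rule le_less_trans)
      with a'(1) show ?thesis by (auto simp: ennreal_mult_less_top)
    qed
    \<comment> \<open>The only place where the size and shape of the force enter:
      \<open>\<Omega>\<^sub>0\<close> is so large that the linear response is an admissible starting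
      term for the iteration.\<close>
    from force_small[OF p nu G this, of "\<delta> / (2 * 2 powr p)"] \<delta>
    obtain \<Omega>\<^sub>0 where \<Omega>\<^sub>0: "\<Omega>\<^sub>0 > 0" "\<And>\<Omega>. \<bar>\<Omega>\<bar> \<ge> \<Omega>\<^sub>0 \<Longrightarrow>
       wnorm s p (\<lambda>\<xi>. resolvent \<nu> \<alpha> \<Omega> \<xi> (leray_symbol \<xi> *v G \<xi>)) \<le> ennreal (\<delta> / (2 * 2 powr p))" by auto
    have "\<exists>!u. stationary_mild_solution \<phi> p \<nu> \<alpha> \<Omega> F u \<and> fb_norm \<phi> s p p u \<le> ennreal (2 * \<epsilon>)" if Om: "\<bar>\<Omega>\<bar> \<ge> \<Omega>\<^sub>0" for \<Omega>
    proof (rule ex_ex1I)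
      let ?y = "\<lambda>\<xi>. resolvent \<nu> \<alpha> \<Omega> \<xi> (leray_symbol \<xi> *v G \<xi>)"
      have ym: "?y \<in> borel_measurable borel" by measurable
      obtain v where v [measurable]: "v \<in> borel_measurable borel" and Nv: "wnorm s p v \<le> ennreal (2 powr p * \<delta>)"
        and fixv: "AE \<xi> in lborel. v \<xi> = ?y \<xi> - nonlinear \<nu> \<alpha> \<Omega> v \<xi>"
        by (rule fixed_point_exists[OF p L Q ym \<delta> small \<Omega>\<^sub>0(2)[OF Om]]; (assumption | rule that, assumption+))
      have fin: "wnorm s p v < \<infinity>" by (rule le_less_trans[OF Nv]) simp
      obtain u :: "tempered^3" where u: "\<And>m. has_fourier_fun (u $ m) (\<lambda>\<xi>. v \<xi> $ m)"
        using tempered_vector_exists[OF v p s0 s(2) fin] by blast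
      \<comment> \<open>The representative chosen by \<open>fourier_fun\<close> agrees with
        \<open>v\<close> only almost everywhere, so bounds, convolutions and the equation are
        transferred to it.\<close>
      define v' where "v' = fourier_fun u"
      have v' [measurable]: "v' \<in> borel_measurable borel" unfolding v'_def using u by (intro fourier_fun_borel) blast
      have ae: "AE \<xi> in lborel. v' \<xi> = v \<xi>" unfolding v'_def by (rule fourier_fun_AE_unique[OF u])
      have N': "wnorm s p v' = wnorm s p v" by (rule wnorm_cong_AE) (use ae in \<open>auto elim: eventually_mono\<close>)
      have fin': "wnorm s p v' < \<infinity>" using fin by (simp add: N')
      have "ennreal_powr (fb_norm \<phi> s p p u) p \<le> ennreal b * wnorm s p v'"
        using upper[of u] v' by (simp add: v'_def)
      also have "\<dots> \<le> ennreal b * ennreal (2 powr p * \<delta>)" unfolding N' by (intro mult_left_mono Nv) auto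
      also have "\<dots> = ennreal ((2 * \<epsilon>) powr p)"
        using ab \<delta> by (simp add: ennreal_mult[symmetric] eps(2)) (simp add: \<delta>_def)
      finally have fb: "fb_norm \<phi> s p p u \<le> ennreal (2 * \<epsilon>)"
        using p0 eps(1) by (simp add: ennreal_powr_le_iff)
      have conv: "AE \<xi> in lborel. \<forall>m k. conv_integrable_at (\<lambda>\<eta>. v' \<eta> $ m) (\<lambda>\<eta>. v' \<eta> $ k) \<xi>"
      proof -
        have "AE \<xi> in lborel. nn_conv (mag v') (mag v') \<xi> < \<infinity>"
          using fin' by (intro nn_conv_finite_AE[OF p s]) (auto simp: mag_def[of v'])
        then show ?thesis by eventually_elim (auto intro!: conv_integrable_component)
      qed
      \<comment> \<open>The nonlinear term at one frequency depends on its argument at all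
        frequencies, so its insensitivity to null sets is not a pointwise matter; it follows from
        the difference estimate with distance 0.\<close>
      have "wnorm s p (\<lambda>\<xi>. nonlinear \<nu> \<alpha> \<Omega> v' \<xi> - nonlinear \<nu> \<alpha> \<Omega> v \<xi>) \<le> ennreal L * (wnorm s p (\<lambda>\<xi>. v' \<xi> - v \<xi>) * (wnorm s p v' + wnorm s p v))"
        by (rule Q[OF v' v fin' fin])
      also have "wnorm s p (\<lambda>\<xi>. v' \<xi> - v \<xi>) = wnorm s p (\<lambda>_. 0 :: complex^3)"
        by (rule wnorm_cong_AE) (use ae in \<open>auto elim: eventually_mono\<close>)
      finally have "wnorm s p (\<lambda>\<xi>. nonlinear \<nu> \<alpha> \<Omega> v' \<xi> - nonlinear \<nu> \<alpha> \<Omega> v \<xi>) = 0" using p0 by (simp add: wnorm_zero)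
      then have "AE \<xi> in lborel. nonlinear \<nu> \<alpha> \<Omega> v' \<xi> - nonlinear \<nu> \<alpha> \<Omega> v \<xi> = 0"
        by (rule wnorm_eq_0D) measurable
      with ae fixv have "AE \<xi> in lborel. v' \<xi> = ?y \<xi> - nonlinear \<nu> \<alpha> \<Omega> v' \<xi>"
        by eventually_elim auto
      then have "stationary_mild_solution \<phi> p \<nu> \<alpha> \<Omega> F u"
        unfolding mild using u conv le_less_trans[OF fb] unfolding v'_def G_def by auto
      with fb show "\<exists>u. stationary_mild_solution \<phi> p \<nu> \<alpha> \<Omega> F u \<and> fb_norm \<phi> s p p u \<le> ennreal (2 * \<epsilon>)" by blast
    next
      fix u u'
      assume 1: "stationary_mild_solution \<phi> p \<nu> \<alpha> \<Omega> F u \<and> fb_norm \<phi> s p p u \<le> ennreal (2 * \<epsilon>)"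
        and 2: "stationary_mild_solution \<phi> p \<nu> \<alpha> \<Omega> F u' \<and> fb_norm \<phi> s p p u' \<le> ennreal (2 * \<epsilon>)"
      have has: "\<exists>g. has_fourier_fun (u $ m) g" "\<exists>g. has_fourier_fun (u' $ m) g" for m
        using 1 2 by (auto simp: mild)
      note b = fourier_fun_borel[OF has(1)] fourier_fun_borel[OF has(2)]
      \<comment> \<open>Uniqueness concerns all solutions in the Fourier-Besov ball, not only limits
        of the iteration, hence the radius \<open>e / a\<close> from the lower equivalence
        constant.\<close>
      have small': "wnorm s p (fourier_fun f) \<le> ennreal (e / a)" if "fourier_fun f \<in> borel_measurable borel" "fb_norm \<phi> s p p f \<le> ennreal (2 * \<epsilon>)" for f
      proof (rule ennreal_le_divide)
        have "ennreal a * wnorm s p (fourier_fun f) \<le> ennreal_powr (fb_norm \<phi> s p p f) p" by (rule lower[OF that(1)])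
        also have "\<dots> \<le> ennreal ((2 * \<epsilon>) powr p)" using that(2) p0 eps(1) by (simp add: ennreal_powr_le_iff)
        finally show "ennreal a * wnorm s p (fourier_fun f) \<le> ennreal e" by (simp add: eps(2))
      qed (use ab e in auto)
      have "AE \<xi> in lborel. fourier_fun u \<xi> = fourier_fun u' \<xi>"
        by (rule fixed_point_unique[OF p L Q b small' small' _ unique])
           (use 1 2 b ab e in \<open>auto simp: mild\<close>)
      then show "u = u'" by (rule tempered_vector_eqI[OF has])
    qed
    with \<Omega>\<^sub>0(1) show ?thesis by blast
  qed
  with eps(1) show ?thesis unfolding s_def by blast
qed

end
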